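(* Let $\mathcal{C}$ be an $A$-coring with a group-like element $\mathbf{x}$, and let ${}^{*}\mathcal{C}$, $A^{\mathbf{x}}$, $({}^{*}\mathcal{C})^{\mathbf{x}}$, $B=A^{co\mathcal{C}}$ and $Q$ be as defined in the context. (1) $(A^{\mathbf{x}},{}^{*}\mathcal{C},A,({}^{*}\mathcal{C})^{\mathbf{x}},\widetilde{F},\widetilde{G})$ is a Morita context, namely the one derived from the right module $A_{{}^{*}\mathcal{C}}$, where $$\widetilde{F}:({}^{*}\mathcal{C})^{\mathbf{x}}\otimes_{A^{\mathbf{x}}}A\to {}^{*}\mathcal{C},\ q\otimes a\mapsto qa,\qquad \widetilde{G}:A\otimes_{{}^{*}\mathcal{C}}({}^{*}\mathcal{C})^{\mathbf{x}}\to A^{\mathbf{x}},\ a\otimes q\mapsto a\leftharpoonup q.$$ (2) $(B,{}^{*}\mathcal{C},A,Q,F,G)$ is a Morita context, where $$F:Q\otimes_{B}A\to {}^{*}\mathcal{C},\ q\otimes_B a\mapsto qa,\qquad G:A\otimes_{{}^{*}\mathcal{C}}Q\to B,\ a\otimes q\mapsto a\leftharpoonup q.$$ If moreover the left $A$-module ${}_A\mathcal{C}$ is locally projective, then the two Morita contexts coincide.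
   Context: Rings are associative with unit and modules are unital. $A$ is a not necessarily commutative ring with $1_A\neq 0$. An $A$-coring is an $A$-bimodule $\mathcal{C}$ with $A$-bilinear coassociative $\Delta_{\mathcal{C}}:\mathcal{C}\to\mathcal{C}\otimes_A\mathcal{C}$, $c\mapsto\sum c_1\otimes_A c_2$, and $A$-bilinear counit $\varepsilon_{\mathcal{C}}:\mathcal{C}\to A$. An element $\mathbf{x}\in\mathcal{C}$ is group-like if $\Delta_{\mathcal{C}}(\mathbf{x})=\mathbf{x}\otimes_A\mathbf{x}$ and $\varepsilon_{\mathcal{C}}(\mathbf{x})=1_A$. $A$ is a right $\mathcal{C}$-comodule via $\varrho_A:A\to A\otimes_A\mathcal{C}\simeq\mathcal{C}$, $a\mapsto\mathbf{x}a$. ${}^{*}\mathcal{C}:=\mathrm{Hom}_{A-}(\mathcal{C},A)$ (left $A$-linear maps) is a ring with product $(f\cdot g)(c)=\sum g(c_1f(c_2))$ and unit $\varepsilon_{\mathcal{C}}$, and an $A$-bimodule by $(af)(c)=f(ca)$, $(fa)(c)=f(c)a$. There is a ring morphism $A\to{}^{*}\mathcal{C}$, $a\mapsto\varepsilon_{\mathcal{C}}a=a\varepsilon_{\mathcal{C}}$, so every right ${}^{*}\mathcal{C}$-module is a right $A$-module. $A$ is a right ${}^{*}\mathcal{C}$-module by $a\leftharpoonup g:=g(\mathbf{x}a)$. For a right ${}^{*}\mathcal{C}$-module $M$: $M^{\mathbf{x}}:=\{m\in M\mid mg=mg(\mathbf{x})\ \forall g\in{}^{*}\mathcal{C}\}$;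 in particular $A^{\mathbf{x}}=\{a\in A\mid a\leftharpoonup g=ag(\mathbf{x})\ \forall g\}$ is a subring of $A$, and $({}^{*}\mathcal{C})^{\mathbf{x}}$ is formed for ${}^{*}\mathcal{C}$ as a right module over itself. $B:=A^{co\mathcal{C}}:=\{b\in A\mid b\mathbf{x}=\mathbf{x}b\}$ is a subring of $A^{\mathbf{x}}$. $Q:=\{q\in{}^{*}\mathcal{C}\mid\sum c_1q(c_2)=q(c)\mathbf{x}\ \forall c\in\mathcal{C}\}\subseteq({}^{*}\mathcal{C})^{\mathbf{x}}$. $A$ is an $(A^{\mathbf{x}},{}^{*}\mathcal{C})$- and $(B,{}^{*}\mathcal{C})$-bimodule; $({}^{*}\mathcal{C})^{\mathbf{x}}$ and $Q$ are left ${}^{*}\mathcal{C}$-modules by multiplication in ${}^{*}\mathcal{C}$ and right modules over $A^{\mathbf{x}}$, respectively $B$, by $(qb)(c)=q(c)b$. A Morita context $(S,T,P,P',F,G)$ consists of rings $S,T$, an $(S,T)$-bimodule $P$, a $(T,S)$-bimodule $P'$, a $T$-bilinear map $F:P'\otimes_SP\to T$ and an $S$-bilinear map $G:P\otimes_TP'\to S$ such that $F(q\otimes p)q'=qG(p\otimes q')$ and $G(p\otimes q)p'=pF(q\otimes p')$. The Morita context derived from a right $T$-module $P$ is the standard one with $S=\mathrm{End}(P_T)$, $P'=\mathrm{Hom}_{-T}(P,T)$, $F(f\otimes p)=f(p)$, $G(p\otimes f)(p')=pf(p')$; here it is transported along the isomorphisms $\mathrm{End}(A_{{}^{*}\mathcal{C}})\simeq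 A^{\mathbf{x}}$ and $\mathrm{Hom}_{-{}^{*}\mathcal{C}}(A,{}^{*}\mathcal{C})\simeq({}^{*}\mathcal{C})^{\mathbf{x}}$, $f\mapsto f(1_A)$. A left $A$-module $W$ is locally projective (Zimmermann-Huisgen) if for every surjective $A$-linear $\pi:L\to N$, every $A$-linear $g:W\to N$ and every finitely generated submodule $\iota:F_0\hookrightarrow W$ there is an $A$-linear $g':W\to L$ with $\pi g'\iota=g\iota$. *)

theory Defs
  imports
    "HOL-Algebra.Module"
    "HOL-Algebra.QuotRing"
    "HOL-Algebra.Free_Abelian_Groups"
    "HOL-Algebra.Generated_Groups"
begin

section \<open>Modules over noncommutative rings\<close>

text \<open>
  The library locale \<^locale>\<open>module\<close> asks for a commutative ring. We keep its record and add a
  field for a right action. As in the library, the ring fields \<^const>\<open>mult\<close> and \<^const>\<open>one\<close> of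
  a module record carry no meaning. One-sided modules are carried by the same records; the
  locales below look only at the action they name.
\<close>

record ('r, 's, 'm) bimodule = "('r, 'm) module" +
  rsmult :: "'m \<Rightarrow> 's \<Rightarrow> 'm" (infixl \<open>\<triangleleft>\<index>\<close> 70)

locale left_module = R?: ring R + M?: abelian_group M
  for R (structure) and M (structure) +
  assumes smult_closed: "\<lbrakk>a \<in> carrier R; x \<in> carrier M\<rbrakk> \<Longrightarrow> a \<odot>\<^bsub>M\<^esub> x \<in> carrier M"
    and smult_l_distr: "\<lbrakk>a \<in> carrier R; b \<in> carrier R; x \<in> carrier M\<rbrakk>
      \<Longrightarrow> (a \<oplus>\<^bsub>R\<^esub> b) \<odot>\<^bsub>M\<^esub> x = a \<odot>\<^bsub>M\<^esub> x \<oplus>\<^bsub>M\<^esub> b \<odot>\<^bsub>M\<^esub> x"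
    and smult_r_distr: "\<lbrakk>a \<in> carrier R; x \<in> carrier M; y \<in> carrier M\<rbrakk>
      \<Longrightarrow> a \<odot>\<^bsub>M\<^esub> (x \<oplus>\<^bsub>M\<^esub> y) = a \<odot>\<^bsub>M\<^esub> x \<oplus>\<^bsub>M\<^esub> a \<odot>\<^bsub>M\<^esub> y"
    and smult_assoc: "\<lbrakk>a \<in> carrier R; b \<in> carrier R; x \<in> carrier M\<rbrakk>
      \<Longrightarrow> (a \<otimes>\<^bsub>R\<^esub> b) \<odot>\<^bsub>M\<^esub> x = a \<odot>\<^bsub>M\<^esub> (b \<odot>\<^bsub>M\<^esub> x)"
    and smult_one: "x \<in> carrier M \<Longrightarrow> \<one>\<^bsub>R\<^esub> \<odot>\<^bsub>M\<^esub> x = x"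

locale right_module = S?: ring S + M?: abelian_group M
  for S (structure) and M (structure) +
  assumes rsmult_closed: "\<lbrakk>x \<in> carrier M; a \<in> carrier S\<rbrakk> \<Longrightarrow> x \<triangleleft>\<^bsub>M\<^esub> a \<in> carrier M"
    and rsmult_r_distr: "\<lbrakk>x \<in> carrier M; a \<in> carrier S; b \<in> carrier S\<rbrakk>
      \<Longrightarrow> x \<triangleleft>\<^bsub>M\<^esub> (a \<oplus>\<^bsub>S\<^esub> b) = x \<triangleleft>\<^bsub>M\<^esub> a \<oplus>\<^bsub>M\<^esub> x \<triangleleft>\<^bsub>M\<^esub> b"
    and rsmult_l_distr: "\<lbrakk>x \<in> carrier M; y \<in> carrier M; a \<in> carrier S\<rbrakk>
      \<Longrightarrow> (x \<oplus>\<^bsub>M\<^esub> y) \<triangleleft>\<^bsub>M\<^esub> a = x \<triangleleft>\<^bsub>M\<^esub> a \<oplus>\<^bsub>M\<^esub> y \<triangleleft>\<^bsub>M\<^esub> a"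
    and rsmult_assoc: "\<lbrakk>x \<in> carrier M; a \<in> carrier S; b \<in> carrier S\<rbrakk>
      \<Longrightarrow> x \<triangleleft>\<^bsub>M\<^esub> (a \<otimes>\<^bsub>S\<^esub> b) = (x \<triangleleft>\<^bsub>M\<^esub> a) \<triangleleft>\<^bsub>M\<^esub> b"
    and rsmult_one: "x \<in> carrier M \<Longrightarrow> x \<triangleleft>\<^bsub>M\<^esub> \<one>\<^bsub>S\<^esub> = x"

locale bimodule = left_module R M + right_module S M
  for R (structure) and S (structure) and M (structure) +
  assumes smult_rsmult: "\<lbrakk>a \<in> carrier R; x \<in> carrier M; b \<in> carrier S\<rbrakk>
      \<Longrightarrow> (a \<odot>\<^bsub>M\<^esub> x) \<triangleleft>\<^bsub>M\<^esub> b = a \<odot>\<^bsub>M\<^esub> (x \<triangleleft>\<^bsub>M\<^esub> b)"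

definition left_hom ::
  "('r, 'k) ring_scheme \<Rightarrow> ('r, 'm, 'x) module_scheme \<Rightarrow> ('r, 'n, 'y) module_scheme \<Rightarrow> ('m \<Rightarrow> 'n) set"
  where "left_hom R M N = {h \<in> hom (add_monoid M) (add_monoid N).
    \<forall>r \<in> carrier R. \<forall>m \<in> carrier M. h (r \<odot>\<^bsub>M\<^esub> m) = r \<odot>\<^bsub>N\<^esub> h m}"

definition right_hom ::
  "('s, 'k) ring_scheme \<Rightarrow> ('l, 's, 'm, 'x) bimodule_scheme \<Rightarrow> ('l2, 's, 'n, 'y) bimodule_scheme
    \<Rightarrow> ('m \<Rightarrow> 'n) set"
  where "right_hom S M N = {h \<in> hom (add_monoid M) (add_monoid N).
    \<forall>s \<in> carrier S. \<forall>m \<in> carrier M. h (m \<triangleleft>\<^bsub>M\<^esub> s) = h m \<triangleleft>\<^bsub>N\<^esub> s}"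

definition bimodule_hom ::
  "('r, 'k) ring_scheme \<Rightarrow> ('s, 'l) ring_scheme \<Rightarrow> ('r, 's, 'm, 'x) bimodule_scheme
    \<Rightarrow> ('r, 's, 'n, 'y) bimodule_scheme \<Rightarrow> ('m \<Rightarrow> 'n) set"
  where "bimodule_hom R S M N = left_hom R M N \<inter> right_hom S M N"

text \<open>A ring as a bimodule over itself.\<close>

definition regular_bimodule :: "('r, 'k) ring_scheme \<Rightarrow> ('r, 'r, 'r) bimodule"
  where "regular_bimodule R =
    \<lparr>carrier = carrier R, mult = mult R, one = one R, ring.zero = ring.zero R, add = add R,
     smult = mult R, rsmult = mult R\<rparr>"

section \<open>Tensor products\<close>

text \<open>
  \<open>M \<otimes>\<^sub>R N\<close> for a right \<open>R\<close>-module \<open>M\<close> and a left \<open>R\<close>-module \<open>N\<close>: the free abelian group on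
  \<open>M \<times> N\<close> modulo the usual relations. The library writes both the free abelian group and its
  quotient multiplicatively.
\<close>

definition tensor_relations ::
  "('r, 'k) ring_scheme \<Rightarrow> ('l, 'r, 'm, 'x) bimodule_scheme \<Rightarrow> ('r, 's, 'n, 'y) bimodule_scheme
    \<Rightarrow> ('m \<times> 'n \<Rightarrow>\<^sub>0 int) set"
  where "tensor_relations R M N =
    {frag_of (m \<oplus>\<^bsub>M\<^esub> m', n) - frag_of (m, n) - frag_of (m', n) | m m' n.
       m \<in> carrier M \<and> m' \<in> carrier M \<and> n \<in> carrier N} \<union>
    {frag_of (m, n \<oplus>\<^bsub>N\<^esub> n') - frag_of (m, n) - frag_of (m, n') | m n n'.
       m \<in> carrier M \<and> n \<in> carrier N \<and> n' \<in> carrier N} \<union>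
    {frag_of (m \<triangleleft>\<^bsub>M\<^esub> r, n) - frag_of (m, r \<odot>\<^bsub>N\<^esub> n) | m r n.
       m \<in> carrier M \<and> r \<in> carrier R \<and> n \<in> carrier N}"

definition tensor_kernel ::
  "('r, 'k) ring_scheme \<Rightarrow> ('l, 'r, 'm, 'x) bimodule_scheme \<Rightarrow> ('r, 's, 'n, 'y) bimodule_scheme
    \<Rightarrow> ('m \<times> 'n \<Rightarrow>\<^sub>0 int) set"
  where "tensor_kernel R M N =
    generate (free_Abelian_group (carrier M \<times> carrier N)) (tensor_relations R M N)"

definition tensor_group ::
  "('r, 'k) ring_scheme \<Rightarrow> ('l, 'r, 'm, 'x) bimodule_scheme \<Rightarrow> ('r, 's, 'n, 'y) bimodule_scheme
    \<Rightarrow> ('m \<times> 'n \<Rightarrow>\<^sub>0 int) set monoid"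
  where "tensor_group R M N =
    free_Abelian_group (carrier M \<times> carrier N) Mod tensor_kernel R M N"

text \<open>The pure tensor \<open>m \<otimes>\<^sub>R n\<close>.\<close>

definition pure_tensor ::
  "('r, 'k) ring_scheme \<Rightarrow> ('l, 'r, 'm, 'x) bimodule_scheme \<Rightarrow> ('r, 's, 'n, 'y) bimodule_scheme
    \<Rightarrow> 'm \<Rightarrow> 'n \<Rightarrow> ('m \<times> 'n \<Rightarrow>\<^sub>0 int) set"
  where "pure_tensor R M N m n =
    tensor_kernel R M N #>\<^bsub>free_Abelian_group (carrier M \<times> carrier N)\<^esub> frag_of (m, n)"

text \<open>
  The additive map out of \<open>M \<otimes>\<^sub>R N\<close> with \<open>m \<otimes> n \<mapsto> f m n\<close>, i.e. the map written
  \<open>\<Sum> m \<otimes> n \<mapsto> \<Sum> f m n\<close>. It exists and is unique for every \<open>R\<close>-balanced \<open>f\<close>, see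
  \<open>tensor_lift\<close> below.
\<close>

definition tensor_lift ::
  "('r, 'k) ring_scheme \<Rightarrow> ('l, 'r, 'm, 'x) bimodule_scheme \<Rightarrow> ('r, 's, 'n, 'y) bimodule_scheme
    \<Rightarrow> ('g, 'z) monoid_scheme \<Rightarrow> ('m \<Rightarrow> 'n \<Rightarrow> 'g) \<Rightarrow> ('m \<times> 'n \<Rightarrow>\<^sub>0 int) set \<Rightarrow> 'g"
  where "tensor_lift R M N G f = (THE h.
    h \<in> hom (tensor_group R M N) G \<and>
    h \<in> extensional (carrier (tensor_group R M N)) \<and>
    (\<forall>m \<in> carrier M. \<forall>n \<in> carrier N. h (pure_tensor R M N m n) = f m n))"

lemma tensor_lift:
  assumes M: "abelian_group M" "\<And>m r. \<lbrakk>m \<in> carrier M; r \<in> carrier R\<rbrakk> \<Longrightarrow> m \<triangleleft>\<^bsub>M\<^esub> r \<in> carrier M"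
    and N: "abelian_group N" "\<And>r n. \<lbrakk>r \<in> carrier R; n \<in> carrier N\<rbrakk> \<Longrightarrow> r \<odot>\<^bsub>N\<^esub> n \<in> carrier N"
    and G: "comm_group G"
    and closed: "\<And>m n. \<lbrakk>m \<in> carrier M; n \<in> carrier N\<rbrakk> \<Longrightarrow> f m n \<in> carrier G"
    and add_l: "\<And>m m' n. \<lbrakk>m \<in> carrier M; m' \<in> carrier M; n \<in> carrier N\<rbrakk>
      \<Longrightarrow> f (m \<oplus>\<^bsub>M\<^esub> m') n = f m n \<otimes>\<^bsub>G\<^esub> f m' n"
    and add_r: "\<And>m n n'. \<lbrakk>m \<in> carrier M; n \<in> carrier N; n' \<in> carrier N\<rbrakk>
      \<Longrightarrow> f m (n \<oplus>\<^bsub>N\<^esub> n') = f m n \<otimes>\<^bsub>G\<^esub> f m n'"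
    and balanced: "\<And>m r n. \<lbrakk>m \<in> carrier M; r \<in> carrier R; n \<in> carrier N\<rbrakk>
      \<Longrightarrow> f (m \<triangleleft>\<^bsub>M\<^esub> r) n = f m (r \<odot>\<^bsub>N\<^esub> n)"
  shows "tensor_lift R M N G f \<in> hom (tensor_group R M N) G"
    and "tensor_lift R M N G f \<in> extensional (carrier (tensor_group R M N))"
    and "\<lbrakk>m \<in> carrier M; n \<in> carrier N\<rbrakk> \<Longrightarrow> tensor_lift R M N G f (pure_tensor R M N m n) = f m n"
proof -
  interpret G: comm_group G by (rule G)
  interpret M: abelian_group M by (rule M)
  interpret N: abelian_group N by (rule N)
  define S where "S = carrier M \<times> carrier N"
  define Fr where "Fr = free_Abelian_group S"
  define K where "K = tensor_kernel R M N"
  interpret Fr: comm_group Fr by (simp add: Fr_def abelian_free_Abelian_group)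
  have cFr: "c \<in> carrier Fr \<longleftrightarrow> Poly_Mapping.keys c \<subseteq> S" for c by (simp add: Fr_def)
  have multFr: "a \<otimes>\<^bsub>Fr\<^esub> b = a + b" for a b by (simp add: Fr_def)
  have invFr: "inv\<^bsub>Fr\<^esub> a = - a" if "a \<in> carrier Fr" for a using that by (simp add: Fr_def)
  have of: "frag_of (m, n) \<in> carrier Fr" if "m \<in> carrier M" "n \<in> carrier N" for m n
    using that by (simp add: Fr_def S_def)
  have diff: "a - b \<in> carrier Fr" if "a \<in> carrier Fr" "b \<in> carrier Fr" for a b
    using that unfolding cFr by (meson Un_least keys_diff order_trans)
  have relsub: "tensor_relations R M N \<subseteq> carrier Fr"
    unfolding tensor_relations_def
    by (intro Un_least subsetI; elim CollectE exE conjE; hypsubst)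
      (intro diff of M(2) N(2) M.a_closed N.a_closed; assumption)+
  have K: "K = generate Fr (tensor_relations R M N)"
    by (simp add: K_def tensor_kernel_def Fr_def S_def)
  have Ksub: "subgroup K Fr" unfolding K by (rule Fr.generate_is_subgroup[OF relsub])
  have Knorm: "K \<lhd> Fr" by (rule Fr.subgroup_imp_normal[OF Ksub])
  have TG: "tensor_group R M N = Fr Mod K"
    by (simp add: tensor_group_def Fr_def S_def K_def)
  have pt: "pure_tensor R M N m n = K #>\<^bsub>Fr\<^esub> frag_of (m, n)" for m n
    by (simp add: pure_tensor_def Fr_def S_def K_def)
  have "(\<lambda>p. f (fst p) (snd p)) ` S \<subseteq> carrier G"
    using closed by (auto simp: S_def)
  from G.free_Abelian_group_universal[OF this]
  obtain h0 where h0: "h0 \<in> hom Fr G" "\<And>p. p \<in> S \<Longrightarrow> h0 (frag_of p) = f (fst p) (snd p)"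
    unfolding Fr_def by blast
  interpret h0: group_hom Fr G h0 using h0(1) by unfold_locales
  have h0of: "h0 (frag_of (m, n)) = f m n" if "m \<in> carrier M" "n \<in> carrier N" for m n
    using h0(2) that by (simp add: S_def)
  have h0diff: "h0 (a - b) = h0 a \<otimes>\<^bsub>G\<^esub> inv\<^bsub>G\<^esub> h0 b" if "a \<in> carrier Fr" "b \<in> carrier Fr" for a b
  proof -
    have "h0 (a \<otimes>\<^bsub>Fr\<^esub> inv\<^bsub>Fr\<^esub> b) = h0 a \<otimes>\<^bsub>G\<^esub> inv\<^bsub>G\<^esub> h0 b"
      using that by (simp add: h0.hom_inv)
    then show ?thesis using that by (simp add: multFr invFr)
  qed
  have cancel: "(a \<otimes>\<^bsub>G\<^esub> b) \<otimes>\<^bsub>G\<^esub> inv\<^bsub>G\<^esub> a \<otimes>\<^bsub>G\<^esub> inv\<^bsub>G\<^esub> b = \<one>\<^bsub>G\<^esub>"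
    if "a \<in> carrier G" "b \<in> carrier G" for a b
    using that by (metis G.inv_closed G.inv_solve_right' G.m_closed G.m_comm G.r_inv)
  have "tensor_relations R M N \<subseteq> kernel Fr G h0"
  proof
    fix c assume c: "c \<in> tensor_relations R M N"
    then have "h0 c = \<one>\<^bsub>G\<^esub>"
      unfolding tensor_relations_def
      by (elim UnE CollectE exE conjE; hypsubst)
        (simp_all only: h0diff diff of h0of add_l add_r balanced closed cancel
          M(2) N(2) M.a_closed N.a_closed G.r_inv)
    then show "c \<in> kernel Fr G h0" using c relsub by (auto simp: kernel_def)
  qed
  then have Kker: "K \<subseteq> kernel Fr G h0"
    unfolding K by (rule Fr.generate_subgroup_incl[OF _ h0.subgroup_kernel])
  obtain g where g: "g \<in> hom (Fr Mod K) G" "\<And>c. c \<in> carrier Fr \<Longrightarrow> g (K #>\<^bsub>Fr\<^esub> c) = h0 c"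
    using h0.FactGroup_universal_kernel[OF Knorm Kker] by blast
  interpret Q: group "Fr Mod K" by (rule normal.factorgroup_is_group[OF Knorm])
  define P where "P h \<longleftrightarrow> h \<in> hom (tensor_group R M N) G \<and>
    h \<in> extensional (carrier (tensor_group R M N)) \<and>
    (\<forall>m \<in> carrier M. \<forall>n \<in> carrier N. h (pure_tensor R M N m n) = f m n)" for h
  have cQ: "K #>\<^bsub>Fr\<^esub> c \<in> carrier (Fr Mod K)" if "c \<in> carrier Fr" for c
    using that by (auto simp: carrier_FactGroup)
  have ex: "P (restrict g (carrier (Fr Mod K)))"
    unfolding P_def TG pt
  proof (intro conjI ballI)
    show "restrict g (carrier (Fr Mod K)) \<in> hom (Fr Mod K) G"
      using g(1) Q.m_closed by (simp add: hom_def Pi_iff)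
  qed (auto simp: cQ of g(2) h0of)
  have uniq: "h = h'" if "P h" "P h'" for h h'
  proof (rule extensionalityI)
    show "h \<in> extensional (carrier (Fr Mod K))" "h' \<in> extensional (carrier (Fr Mod K))"
      using that by (auto simp: P_def TG)
    fix X assume "X \<in> carrier (Fr Mod K)"
    then obtain c where c: "c \<in> carrier Fr" "X = K #>\<^bsub>Fr\<^esub> c"
      by (auto simp: carrier_FactGroup)
    have hh: "h \<in> hom (Fr Mod K) G" "h' \<in> hom (Fr Mod K) G" using that by (auto simp: P_def TG)
    interpret h: group_hom "Fr Mod K" G h using hh by unfold_locales
    interpret h': group_hom "Fr Mod K" G h' using hh by unfold_locales
    have proj: "(\<lambda>a. K #>\<^bsub>Fr\<^esub> a) \<in> hom Fr (Fr Mod K)"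
      by (rule normal.r_coset_hom_Mod[OF Knorm])
    interpret pr: group_hom Fr "Fr Mod K" "\<lambda>a. K #>\<^bsub>Fr\<^esub> a"
      using proj by unfold_locales
    have "Poly_Mapping.keys c \<subseteq> S" using c cFr by simp
    then have "h (K #>\<^bsub>Fr\<^esub> c) = h' (K #>\<^bsub>Fr\<^esub> c)"
    proof (rule free_Abelian_group_induct)
      have "K #>\<^bsub>Fr\<^esub> \<one>\<^bsub>Fr\<^esub> = \<one>\<^bsub>Fr Mod K\<^esub>" by (rule pr.hom_one)
      moreover have "\<one>\<^bsub>Fr\<^esub> = 0" by (simp add: Fr_def)
      ultimately show "h (K #>\<^bsub>Fr\<^esub> 0) = h' (K #>\<^bsub>Fr\<^esub> 0)"
        using h.hom_one h'.hom_one by metis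
    next
      fix a b assume ab: "Poly_Mapping.keys a \<subseteq> S" "Poly_Mapping.keys b \<subseteq> S"
        "h (K #>\<^bsub>Fr\<^esub> a) = h' (K #>\<^bsub>Fr\<^esub> a)" "h (K #>\<^bsub>Fr\<^esub> b) = h' (K #>\<^bsub>Fr\<^esub> b)"
      then have ca: "a \<in> carrier Fr" "b \<in> carrier Fr" by (auto simp: cFr)
      have e: "K #>\<^bsub>Fr\<^esub> (a - b) = (K #>\<^bsub>Fr\<^esub> a) \<otimes>\<^bsub>Fr Mod K\<^esub> inv\<^bsub>Fr Mod K\<^esub> (K #>\<^bsub>Fr\<^esub> b)"
      proof -
        have "a - b = a \<otimes>\<^bsub>Fr\<^esub> inv\<^bsub>Fr\<^esub> b" using ca by (simp add: multFr invFr)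
        then show ?thesis using ca pr.hom_mult[of a "inv\<^bsub>Fr\<^esub> b"] pr.hom_inv[of b] by simp
      qed
      show "h (K #>\<^bsub>Fr\<^esub> (a - b)) = h' (K #>\<^bsub>Fr\<^esub> (a - b))"
        unfolding e using ca ab(3,4) cQ
        by (simp add: h.hom_inv h'.hom_inv del: mult_FactGroup)
    next
      fix p assume "p \<in> S"
      then show "h (K #>\<^bsub>Fr\<^esub> frag_of p) = h' (K #>\<^bsub>Fr\<^esub> frag_of p)"
        using that by (auto simp: P_def S_def pt)
    qed
    then show "h X = h' X" by (simp add: c)
  qed
  have "P (THE h. P h)"
    using theI[of P "restrict g (carrier (Fr Mod K))", OF ex] uniq[OF _ ex] by blast
  then have "P (tensor_lift R M N G f)"
    by (simp add: tensor_lift_def P_def)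
  then show "tensor_lift R M N G f \<in> hom (tensor_group R M N) G"
    and "tensor_lift R M N G f \<in> extensional (carrier (tensor_group R M N))"
    and "\<lbrakk>m \<in> carrier M; n \<in> carrier N\<rbrakk> \<Longrightarrow> tensor_lift R M N G f (pure_tensor R M N m n) = f m n"
    by (auto simp: P_def)
qed

definition tensor ::
  "('r, 'k) ring_scheme \<Rightarrow> ('l, 'r, 'm, 'x) bimodule_scheme \<Rightarrow> ('r, 's, 'n, 'y) bimodule_scheme
    \<Rightarrow> ('l, 's, ('m \<times> 'n \<Rightarrow>\<^sub>0 int) set) bimodule"
  where "tensor R M N =
    \<lparr>carrier = carrier (tensor_group R M N), mult = undefined, one = undefined,
     ring.zero = \<one>\<^bsub>tensor_group R M N\<^esub>, add = mult (tensor_group R M N),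
     smult = (\<lambda>l. tensor_lift R M N (tensor_group R M N)
       (\<lambda>m n. pure_tensor R M N (l \<odot>\<^bsub>M\<^esub> m) n)),
     rsmult = (\<lambda>t s. tensor_lift R M N (tensor_group R M N)
       (\<lambda>m n. pure_tensor R M N m (n \<triangleleft>\<^bsub>N\<^esub> s)) t)\<rparr>"

section \<open>Local projectivity\<close>

text \<open>The submodule generated by \<open>X\<close>.\<close>

definition left_span :: "('r, 'k) ring_scheme \<Rightarrow> ('r, 'm, 'x) module_scheme \<Rightarrow> 'm set \<Rightarrow> 'm set"
  where "left_span R M X = \<Inter> {U. subgroup U (add_monoid M) \<and>
    (\<forall>r \<in> carrier R. \<forall>u \<in> U. r \<odot>\<^bsub>M\<^esub> u \<in> U) \<and> X \<subseteq> U}"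

definition lifts_locally ::
  "('r, 'k) ring_scheme \<Rightarrow> ('r, 'w, 'x) module_scheme \<Rightarrow> ('r, 'l, 'y) module_scheme
    \<Rightarrow> ('r, 'n, 'z) module_scheme \<Rightarrow> bool"
  where "lifts_locally R W L N \<longleftrightarrow>
    (\<forall>\<pi> \<in> left_hom R L N. \<forall>g \<in> left_hom R W N. \<forall>X.
       \<pi> ` carrier L = carrier N \<longrightarrow> finite X \<longrightarrow> X \<subseteq> carrier W \<longrightarrow>
       (\<exists>g' \<in> left_hom R W L. \<forall>w \<in> left_span R W X. \<pi> (g' w) = g w))"

text \<open>
  HOL cannot quantify over modules of all types, so the definition ranges over test modules
  \<open>L\<close> and \<open>N\<close> on fixed types. These are large enough for the property to hold then for test
  modules on arbitrary types: see \<open>locally_projective_lifts\<close> below.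
\<close>

definition locally_projective ::
  "('r, 'k) ring_scheme \<Rightarrow> ('r, 'w, 'x) module_scheme \<Rightarrow> bool"
  where "locally_projective R W \<longleftrightarrow> left_module R W \<and>
    (\<forall>(L :: ('r, 'w \<Rightarrow> 'r) module) (N :: ('r, 'w) module).
       left_module R L \<longrightarrow> left_module R N \<longrightarrow> lifts_locally R W L N)"

text \<open>Auxiliary notions for the proof of \<open>locally_projective_lifts\<close> only.\<close>

definition free_module :: "('r, 'k) ring_scheme \<Rightarrow> 'w set \<Rightarrow> ('r, 'w \<Rightarrow> 'r) module"
  where "free_module R I =
    \<lparr>carrier = {f. (\<forall>w \<in> I. f w \<in> carrier R) \<and> (\<forall>w. w \<notin> I \<longrightarrow> f w = \<zero>\<^bsub>R\<^esub>) \<and>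
       finite {w. f w \<noteq> \<zero>\<^bsub>R\<^esub>}},
     mult = undefined, one = undefined,
     ring.zero = (\<lambda>w. \<zero>\<^bsub>R\<^esub>), add = (\<lambda>f g w. f w \<oplus>\<^bsub>R\<^esub> g w), smult = (\<lambda>r f w. r \<otimes>\<^bsub>R\<^esub> f w)\<rparr>"

definition free_lift ::
  "('r, 'k) ring_scheme \<Rightarrow> ('r, 'l, 'y) module_scheme \<Rightarrow> ('w \<Rightarrow> 'l) \<Rightarrow> ('w \<Rightarrow> 'r) \<Rightarrow> 'l"
  where "free_lift R L l f = (\<Oplus>\<^bsub>L\<^esub>w \<in> {w. f w \<noteq> \<zero>\<^bsub>R\<^esub>}. f w \<odot>\<^bsub>L\<^esub> l w)"

lemma (in left_module) smult_zeros:
  shows "x \<in> carrier M \<Longrightarrow> \<zero>\<^bsub>R\<^esub> \<odot>\<^bsub>M\<^esub> x = \<zero>\<^bsub>M\<^esub>"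
    and "a \<in> carrier R \<Longrightarrow> a \<odot>\<^bsub>M\<^esub> \<zero>\<^bsub>M\<^esub> = \<zero>\<^bsub>M\<^esub>"
proof -
  show "\<zero>\<^bsub>R\<^esub> \<odot>\<^bsub>M\<^esub> x = \<zero>\<^bsub>M\<^esub>" if x: "x \<in> carrier M"
  proof -
    have "\<zero>\<^bsub>R\<^esub> \<odot>\<^bsub>M\<^esub> x = \<zero>\<^bsub>R\<^esub> \<odot>\<^bsub>M\<^esub> x \<oplus>\<^bsub>M\<^esub> \<zero>\<^bsub>R\<^esub> \<odot>\<^bsub>M\<^esub> x"
      using smult_l_distr[of "\<zero>\<^bsub>R\<^esub>" "\<zero>\<^bsub>R\<^esub>" x] x by simp
    then show ?thesis using x smult_closed[of "\<zero>\<^bsub>R\<^esub>" x] by (metis M.add.r_cancel_one' R.zero_closed)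
  qed
  show "a \<odot>\<^bsub>M\<^esub> \<zero>\<^bsub>M\<^esub> = \<zero>\<^bsub>M\<^esub>" if a: "a \<in> carrier R"
  proof -
    have "a \<odot>\<^bsub>M\<^esub> \<zero>\<^bsub>M\<^esub> = a \<odot>\<^bsub>M\<^esub> \<zero>\<^bsub>M\<^esub> \<oplus>\<^bsub>M\<^esub> a \<odot>\<^bsub>M\<^esub> \<zero>\<^bsub>M\<^esub>"
      using smult_r_distr[of a "\<zero>\<^bsub>M\<^esub>" "\<zero>\<^bsub>M\<^esub>"] a by simp
    then show ?thesis using a smult_closed[of a "\<zero>\<^bsub>M\<^esub>"] by (metis M.add.r_cancel_one' M.zero_closed)
  qed
qed

lemma left_hom_finsum:
  assumes L: "left_module R L" and N: "left_module R N" and h: "h \<in> left_hom R L N"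
    and f: "f \<in> S \<rightarrow> carrier L"
  shows "h (finsum L f S) = finsum N (\<lambda>i. h (f i)) S"
proof -
  interpret L: left_module R L by (rule L)
  interpret N: left_module R N by (rule N)
  have hom: "h \<in> hom (add_monoid L) (add_monoid N)" using h by (simp add: left_hom_def)
  have hc: "h x \<in> carrier N" if "x \<in> carrier L" for x using hom that by (auto simp: hom_def)
  have ha: "h (x \<oplus>\<^bsub>L\<^esub> y) = h x \<oplus>\<^bsub>N\<^esub> h y" if "x \<in> carrier L" "y \<in> carrier L" for x y
    using hom that by (auto simp: hom_def)
  interpret hg: group_hom "add_monoid L" "add_monoid N" h
    using hom L.M.a_group N.M.a_group by (simp add: group_hom_def group_hom_axioms_def)
  have h0: "h \<zero>\<^bsub>L\<^esub> = \<zero>\<^bsub>N\<^esub>" using hg.hom_one by simp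
  show ?thesis using f
  proof (induction S rule: infinite_finite_induct)
    case (insert a S)
    then have "f a \<in> carrier L" "f \<in> S \<rightarrow> carrier L" by auto
    moreover have "(\<lambda>i. h (f i)) \<in> S \<rightarrow> carrier N" using \<open>f \<in> S \<rightarrow> carrier L\<close> hc by auto
    ultimately show ?case using insert by (simp add: ha hc)
  qed (auto simp: h0)
qed

lemma free_module_left_module:
  assumes "ring R"
  shows "left_module R (free_module R I)"
proof -
  interpret ring R by (rule assms)
  have in_R: "f w \<in> carrier R" if "f \<in> carrier (free_module R I)" for f w
    using that by (cases "w \<in> I") (auto simp: free_module_def)
  have fin_add: "finite {w. f w \<oplus>\<^bsub>R\<^esub> g w \<noteq> \<zero>\<^bsub>R\<^esub>}"
    if "finite {w. f w \<noteq> \<zero>\<^bsub>R\<^esub>}" "finite {w. g w \<noteq> \<zero>\<^bsub>R\<^esub>}" for f g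
    by (rule finite_subset[OF _ finite_UnI[OF that]]) auto
  have fin_mult: "finite {w. r \<otimes>\<^bsub>R\<^esub> f w \<noteq> \<zero>\<^bsub>R\<^esub>}"
    if "r \<in> carrier R" "finite {w. f w \<noteq> \<zero>\<^bsub>R\<^esub>}" for r f
    by (rule finite_subset[OF _ that(2)]) (use that(1) in auto)
  show ?thesis
  proof (rule left_module.intro[OF assms _ left_module_axioms.intro])
    show "abelian_group (free_module R I)"
    proof (rule abelian_groupI)
      fix f assume f: "f \<in> carrier (free_module R I)"
      let ?g = "\<lambda>w. \<ominus>\<^bsub>R\<^esub> f w"
      have "{w. ?g w \<noteq> \<zero>\<^bsub>R\<^esub>} \<subseteq> {w. f w \<noteq> \<zero>\<^bsub>R\<^esub>}" by auto
      then have "finite {w. ?g w \<noteq> \<zero>\<^bsub>R\<^esub>}"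
        by (rule finite_subset) (use f in \<open>simp add: free_module_def\<close>)
      then have "?g \<in> carrier (free_module R I)"
        using f by (simp add: free_module_def)
      moreover have "?g \<oplus>\<^bsub>free_module R I\<^esub> f = \<zero>\<^bsub>free_module R I\<^esub>"
        using in_R[OF f] by (simp add: free_module_def l_neg)
      ultimately show "\<exists>g \<in> carrier (free_module R I). g \<oplus>\<^bsub>free_module R I\<^esub> f = \<zero>\<^bsub>free_module R I\<^esub>"
        by blast
    next
      fix f g assume "f \<in> carrier (free_module R I)" "g \<in> carrier (free_module R I)"
      then show "f \<oplus>\<^bsub>free_module R I\<^esub> g \<in> carrier (free_module R I)"
        by (simp add: free_module_def fin_add)
    next
      fix f g h assume fgh: "f \<in> carrier (free_module R I)" "g \<in> carrier (free_module R I)"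
        "h \<in> carrier (free_module R I)"
      show "f \<oplus>\<^bsub>free_module R I\<^esub> g \<oplus>\<^bsub>free_module R I\<^esub> h
          = f \<oplus>\<^bsub>free_module R I\<^esub> (g \<oplus>\<^bsub>free_module R I\<^esub> h)"
        using fgh[THEN in_R] by (simp add: free_module_def a_assoc)
    next
      fix f g assume fg: "f \<in> carrier (free_module R I)" "g \<in> carrier (free_module R I)"
      show "f \<oplus>\<^bsub>free_module R I\<^esub> g = g \<oplus>\<^bsub>free_module R I\<^esub> f"
        using fg[THEN in_R] by (simp add: free_module_def a_comm)
    next
      fix f assume f: "f \<in> carrier (free_module R I)"
      show "\<zero>\<^bsub>free_module R I\<^esub> \<oplus>\<^bsub>free_module R I\<^esub> f = f"
        using f[THEN in_R] by (simp add: free_module_def)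
    qed (simp add: free_module_def)
  next
    fix r f assume rf: "r \<in> carrier R" "f \<in> carrier (free_module R I)"
    then show "r \<odot>\<^bsub>free_module R I\<^esub> f \<in> carrier (free_module R I)"
      by (simp add: free_module_def fin_mult)
  next
    fix r f g assume r: "r \<in> carrier R"
      and fg: "f \<in> carrier (free_module R I)" "g \<in> carrier (free_module R I)"
    show "r \<odot>\<^bsub>free_module R I\<^esub> (f \<oplus>\<^bsub>free_module R I\<^esub> g)
        = r \<odot>\<^bsub>free_module R I\<^esub> f \<oplus>\<^bsub>free_module R I\<^esub> r \<odot>\<^bsub>free_module R I\<^esub> g"
      using r fg[THEN in_R] by (simp add: free_module_def r_distr)
  next
    fix r s f assume rs: "r \<in> carrier R" "s \<in> carrier R" and f: "f \<in> carrier (free_module R I)"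
    show "(r \<oplus>\<^bsub>R\<^esub> s) \<odot>\<^bsub>free_module R I\<^esub> f
        = r \<odot>\<^bsub>free_module R I\<^esub> f \<oplus>\<^bsub>free_module R I\<^esub> s \<odot>\<^bsub>free_module R I\<^esub> f"
      using rs f[THEN in_R] by (simp add: free_module_def l_distr)
    show "(r \<otimes>\<^bsub>R\<^esub> s) \<odot>\<^bsub>free_module R I\<^esub> f
        = r \<odot>\<^bsub>free_module R I\<^esub> (s \<odot>\<^bsub>free_module R I\<^esub> f)"
      using rs f[THEN in_R] by (simp add: free_module_def m_assoc)
  next
    fix f assume f: "f \<in> carrier (free_module R I)"
    show "\<one>\<^bsub>R\<^esub> \<odot>\<^bsub>free_module R I\<^esub> f = f"
      using f[THEN in_R] by (simp add: free_module_def)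
  qed
qed

lemma free_lift_eq:
  assumes L: "left_module R L" and l: "\<And>w. w \<in> I \<Longrightarrow> l w \<in> carrier L"
    and f: "f \<in> carrier (free_module R I)" and S: "finite S" "{w. f w \<noteq> \<zero>\<^bsub>R\<^esub>} \<subseteq> S" "S \<subseteq> I"
  shows "free_lift R L l f = (\<Oplus>\<^bsub>L\<^esub>w \<in> S. f w \<odot>\<^bsub>L\<^esub> l w)"
proof -
  interpret L: left_module R L by (rule L)
  have "f w \<in> carrier R" if "w \<in> I" for w using f that by (auto simp: free_module_def)
  with S l show ?thesis
    unfolding free_lift_def
    by (intro L.M.add.finprod_mono_neutral_cong_left)
       (auto simp: L.smult_zeros intro!: L.smult_closed)
qed

lemma free_lift_hom:
  assumes L: "left_module R L" and l: "\<And>w. w \<in> I \<Longrightarrow> l w \<in> carrier L"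
  shows "free_lift R L l \<in> left_hom R (free_module R I) L"
proof -
  interpret L: left_module R L by (rule L)
  interpret FM: left_module R "free_module R I"
    by (rule free_module_left_module) (rule L.R.ring_axioms)
  let ?F = "free_module R I"
  have supp: "finite {w. f w \<noteq> \<zero>\<^bsub>R\<^esub>}" "{w. f w \<noteq> \<zero>\<^bsub>R\<^esub>} \<subseteq> I"
    "\<And>w. w \<in> I \<Longrightarrow> f w \<in> carrier R" if "f \<in> carrier ?F" for f
    using that by (auto simp: free_module_def)
  have cl: "(\<lambda>w. f w \<odot>\<^bsub>L\<^esub> l w) \<in> S \<rightarrow> carrier L" if "f \<in> carrier ?F" "S \<subseteq> I" for f S
    using that supp(3)[OF that(1)] l by (auto intro!: L.smult_closed)
  have c: "free_lift R L l f \<in> carrier L" if f: "f \<in> carrier ?F" for f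
    unfolding free_lift_def using cl[OF f supp(2)[OF f]] by (rule L.M.finsum_closed)
  have a: "free_lift R L l (f \<oplus>\<^bsub>?F\<^esub> g) = free_lift R L l f \<oplus>\<^bsub>L\<^esub> free_lift R L l g"
    if f: "f \<in> carrier ?F" and g: "g \<in> carrier ?F" for f g
  proof -
    let ?S = "{w. f w \<noteq> \<zero>\<^bsub>R\<^esub>} \<union> {w. g w \<noteq> \<zero>\<^bsub>R\<^esub>}"
    have fg: "f \<oplus>\<^bsub>?F\<^esub> g \<in> carrier ?F" using f g by (rule FM.M.a_closed)
    have S: "finite ?S" "?S \<subseteq> I" using supp(1,2)[OF f] supp(1,2)[OF g] by auto
    have sub: "{w. (f \<oplus>\<^bsub>?F\<^esub> g) w \<noteq> \<zero>\<^bsub>R\<^esub>} \<subseteq> ?S" by (auto simp: free_module_def)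
    have "free_lift R L l (f \<oplus>\<^bsub>?F\<^esub> g) = (\<Oplus>\<^bsub>L\<^esub>w \<in> ?S. (f \<oplus>\<^bsub>?F\<^esub> g) w \<odot>\<^bsub>L\<^esub> l w)"
      by (rule free_lift_eq[OF L l fg S(1) sub S(2)])
    also have "\<dots> = (\<Oplus>\<^bsub>L\<^esub>w \<in> ?S. f w \<odot>\<^bsub>L\<^esub> l w \<oplus>\<^bsub>L\<^esub> g w \<odot>\<^bsub>L\<^esub> l w)"
    proof (rule L.M.finsum_cong'[OF refl])
      show "(\<lambda>w. f w \<odot>\<^bsub>L\<^esub> l w \<oplus>\<^bsub>L\<^esub> g w \<odot>\<^bsub>L\<^esub> l w) \<in> ?S \<rightarrow> carrier L"
        using cl[OF f S(2)] cl[OF g S(2)] by (auto simp: Pi_iff)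
      show "(f \<oplus>\<^bsub>?F\<^esub> g) w \<odot>\<^bsub>L\<^esub> l w = f w \<odot>\<^bsub>L\<^esub> l w \<oplus>\<^bsub>L\<^esub> g w \<odot>\<^bsub>L\<^esub> l w" if "w \<in> ?S" for w
        using L.smult_l_distr[of "f w" "g w" "l w"] supp(3)[OF f] supp(3)[OF g] l S(2) that
        by (auto simp: free_module_def)
    qed
    also have "\<dots> = (\<Oplus>\<^bsub>L\<^esub>w \<in> ?S. f w \<odot>\<^bsub>L\<^esub> l w) \<oplus>\<^bsub>L\<^esub> (\<Oplus>\<^bsub>L\<^esub>w \<in> ?S. g w \<odot>\<^bsub>L\<^esub> l w)"
      by (rule L.M.finsum_addf[OF cl[OF f S(2)] cl[OF g S(2)]])
    also have "(\<Oplus>\<^bsub>L\<^esub>w \<in> ?S. f w \<odot>\<^bsub>L\<^esub> l w) = free_lift R L l f"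
      by (rule free_lift_eq[OF L l f S(1) _ S(2), symmetric]) auto
    also have "(\<Oplus>\<^bsub>L\<^esub>w \<in> ?S. g w \<odot>\<^bsub>L\<^esub> l w) = free_lift R L l g"
      by (rule free_lift_eq[OF L l g S(1) _ S(2), symmetric]) auto
    finally show ?thesis .
  qed
  have s: "free_lift R L l (r \<odot>\<^bsub>?F\<^esub> f) = r \<odot>\<^bsub>L\<^esub> free_lift R L l f"
    if r: "r \<in> carrier R" and f: "f \<in> carrier ?F" for r f
  proof -
    let ?S = "{w. f w \<noteq> \<zero>\<^bsub>R\<^esub>}"
    have rf: "r \<odot>\<^bsub>?F\<^esub> f \<in> carrier ?F" using r f by (rule FM.smult_closed)
    have S: "finite ?S" "?S \<subseteq> I" using supp(1,2)[OF f] by auto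
    have sub: "{w. (r \<odot>\<^bsub>?F\<^esub> f) w \<noteq> \<zero>\<^bsub>R\<^esub>} \<subseteq> ?S" using r by (auto simp: free_module_def)
    have hr: "(\<lambda>x. r \<odot>\<^bsub>L\<^esub> x) \<in> hom (add_monoid L) (add_monoid L)"
      using r by (auto simp: hom_def L.smult_closed L.smult_r_distr)
    have dist: "r \<odot>\<^bsub>L\<^esub> finsum L k T = (\<Oplus>\<^bsub>L\<^esub>w \<in> T. r \<odot>\<^bsub>L\<^esub> k w)"
      if "k \<in> T \<rightarrow> carrier L" for k T
      using that
    proof (induction T rule: infinite_finite_induct)
      case (insert a T)
      then have "k a \<in> carrier L" "k \<in> T \<rightarrow> carrier L" by auto
      moreover have "(\<lambda>i. r \<odot>\<^bsub>L\<^esub> k i) \<in> T \<rightarrow> carrier L"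
        using \<open>k \<in> T \<rightarrow> carrier L\<close> r L.smult_closed by auto
      ultimately show ?case using insert r by (simp add: L.smult_r_distr L.smult_closed)
    qed (use r in \<open>auto simp: L.smult_zeros\<close>)
    have "free_lift R L l (r \<odot>\<^bsub>?F\<^esub> f) = (\<Oplus>\<^bsub>L\<^esub>w \<in> ?S. (r \<odot>\<^bsub>?F\<^esub> f) w \<odot>\<^bsub>L\<^esub> l w)"
      by (rule free_lift_eq[OF L l rf S(1) sub S(2)])
    also have "\<dots> = (\<Oplus>\<^bsub>L\<^esub>w \<in> ?S. r \<odot>\<^bsub>L\<^esub> (f w \<odot>\<^bsub>L\<^esub> l w))"
    proof (rule L.M.finsum_cong'[OF refl])
      show "(\<lambda>w. r \<odot>\<^bsub>L\<^esub> (f w \<odot>\<^bsub>L\<^esub> l w)) \<in> ?S \<rightarrow> carrier L"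
        using cl[OF f S(2)] r L.smult_closed by (auto simp: Pi_iff)
      show "(r \<odot>\<^bsub>?F\<^esub> f) w \<odot>\<^bsub>L\<^esub> l w = r \<odot>\<^bsub>L\<^esub> (f w \<odot>\<^bsub>L\<^esub> l w)" if "w \<in> ?S" for w
        using L.smult_assoc[of r "f w" "l w"] supp(3)[OF f] l S(2) r that
        by (auto simp: free_module_def)
    qed
    also have "\<dots> = r \<odot>\<^bsub>L\<^esub> free_lift R L l f"
      unfolding free_lift_def by (rule dist[OF cl[OF f S(2)], symmetric])
    finally show ?thesis .
  qed
  show ?thesis by (auto simp: left_hom_def hom_def c a s)
qed

lemma locally_projective_lifts:
  assumes lp: "locally_projective R W" and L: "left_module R L" and N: "left_module R N"
  shows "lifts_locally R W L N"
  unfolding lifts_locally_def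
proof (intro ballI allI impI)
  fix \<pi> g X
  assume \<pi>: "\<pi> \<in> left_hom R L N" and g: "g \<in> left_hom R W N"
    and surj: "\<pi> ` carrier L = carrier N" and X: "finite X" "X \<subseteq> carrier W"
  have W: "left_module R W" using lp by (simp add: locally_projective_def)
  interpret W: left_module R W by (rule W)
  interpret L: left_module R L by (rule L)
  interpret N: left_module R N by (rule N)
  define W' where "W' = module.truncate W"
  have W'_simps: "carrier W' = carrier W" "add W' = add W" "ring.zero W' = ring.zero W"
    "smult W' = smult W" by (simp_all add: W'_def module.truncate_def)
  have "abelian_group W'"
    by (rule abelian_groupI)
       (auto simp: W'_simps W.M.a_ac intro: W.M.l_neg W.M.a_inv_closed)
  then have W': "left_module R W'"
    by (auto intro!: left_module.intro left_module_axioms.intro W.R.ring_axioms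
        simp: W'_simps W.smult_closed W.smult_l_distr W.smult_r_distr W.smult_assoc W.smult_one)
  let ?I = "carrier W"
  let ?F = "free_module R ?I"
  have F: "left_module R ?F" by (rule free_module_left_module) (rule W.R.ring_axioms)
  have p: "free_lift R W' (\<lambda>w. w) \<in> left_hom R ?F W'" (is "?p \<in> _")
    by (rule free_lift_hom[OF W']) (simp add: W'_simps)
  have p_sum: "?p f = (\<Oplus>\<^bsub>W\<^esub>w \<in> {w. f w \<noteq> \<zero>\<^bsub>R\<^esub>}. f w \<odot>\<^bsub>W\<^esub> w)" for f
    by (simp add: free_lift_def finsum_def finprod_def W'_simps)
  have p_surj: "?p ` carrier ?F = carrier W'"
  proof
    show "?p ` carrier ?F \<subseteq> carrier W'" using p by (auto simp: left_hom_def hom_def)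
    show "carrier W' \<subseteq> ?p ` carrier ?F"
    proof
      fix w assume "w \<in> carrier W'"
      then have w: "w \<in> carrier W" by (simp add: W'_simps)
      let ?e = "\<lambda>v. if v = w then \<one>\<^bsub>R\<^esub> else \<zero>\<^bsub>R\<^esub>"
      have e: "?e \<in> carrier ?F"
        using w by (auto simp: free_module_def intro: rev_finite_subset[of "{w}"])
      have "?p ?e = (\<Oplus>\<^bsub>W'\<^esub>v \<in> {w}. ?e v \<odot>\<^bsub>W'\<^esub> v)"
        by (rule free_lift_eq[OF W' _ e]) (use w in \<open>auto simp: W'_simps\<close>)
      also have "\<dots> = w"
      proof -
        interpret W': left_module R W' by (rule W')
        show ?thesis using w by (simp add: W'_simps W.smult_one)
      qed
      finally show "w \<in> ?p ` carrier ?F" using e by (metis imageI)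
    qed
  qed
  have idh: "(\<lambda>w. w) \<in> left_hom R W W'" by (auto simp: left_hom_def hom_def W'_simps)
  have "lifts_locally R W ?F W'"
    using lp F W' unfolding locally_projective_def by blast
  from this[unfolded lifts_locally_def, rule_format, OF p idh p_surj X] obtain s where s: "s \<in> left_hom R W ?F" "\<forall>w \<in> left_span R W X. ?p (s w) = w"
    by blast
  define l where "l w = (SOME y. y \<in> carrier L \<and> \<pi> y = g w)" for w
  have l: "l w \<in> carrier L \<and> \<pi> (l w) = g w" if "w \<in> carrier W" for w
  proof -
    have "g w \<in> carrier N" using g that by (auto simp: left_hom_def hom_def)
    then have "\<exists>y. y \<in> carrier L \<and> \<pi> y = g w" using surj by (metis imageE)
    then show ?thesis unfolding l_def by (rule someI_ex)
  qed
  have h: "free_lift R L l \<in> left_hom R ?F L" (is "?h \<in> _")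
    by (rule free_lift_hom[OF L]) (use l in simp)
  have comp: "\<pi> (?h f) = g (?p f)" if f: "f \<in> carrier ?F" for f
  proof -
    let ?S = "{w. f w \<noteq> \<zero>\<^bsub>R\<^esub>}"
    have fS: "?S \<subseteq> carrier W" "\<And>w. w \<in> carrier W \<Longrightarrow> f w \<in> carrier R"
      using f by (auto simp: free_module_def)
    have "\<pi> (?h f) = (\<Oplus>\<^bsub>N\<^esub>w \<in> ?S. \<pi> (f w \<odot>\<^bsub>L\<^esub> l w))"
      unfolding free_lift_def
      by (rule left_hom_finsum[OF L N \<pi>]) (use fS l in \<open>auto intro!: L.smult_closed\<close>)
    also have "\<dots> = (\<Oplus>\<^bsub>N\<^esub>w \<in> ?S. g (f w \<odot>\<^bsub>W\<^esub> w))"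
    proof (rule N.M.finsum_cong'[OF refl])
      show "(\<lambda>w. g (f w \<odot>\<^bsub>W\<^esub> w)) \<in> ?S \<rightarrow> carrier N"
        using g fS by (auto simp: left_hom_def hom_def Pi_iff intro!: W.smult_closed)
      show "\<pi> (f w \<odot>\<^bsub>L\<^esub> l w) = g (f w \<odot>\<^bsub>W\<^esub> w)" if "w \<in> ?S" for w
      proof -
        have "w \<in> carrier W" "f w \<in> carrier R" using fS that by auto
        with l[of w] \<pi> g show ?thesis by (simp add: left_hom_def)
      qed
    qed
    also have "\<dots> = g (?p f)"
      unfolding p_sum
      by (rule left_hom_finsum[OF W N g, symmetric]) (use fS in \<open>auto intro!: W.smult_closed\<close>)
    finally show ?thesis .
  qed
  have span: "left_span R W X \<subseteq> carrier W"
  proof -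
    have "subgroup (carrier W) (add_monoid W)"
      using W.M.a_group group.subgroup_self by fastforce
    then show ?thesis unfolding left_span_def using X W.smult_closed by blast
  qed
  show "\<exists>g' \<in> left_hom R W L. \<forall>w \<in> left_span R W X. \<pi> (g' w) = g w"
  proof (intro bexI ballI)
    show "(\<lambda>w. ?h (s w)) \<in> left_hom R W L"
      using h s(1) by (auto simp: left_hom_def hom_def Pi_iff)
    show "\<pi> (?h (s w)) = g w" if "w \<in> left_span R W X" for w
    proof -
      have "s w \<in> carrier ?F" using s(1) span that by (auto simp: left_hom_def hom_def)
      then show ?thesis using comp s(2) that by simp
    qed
  qed
qed

section \<open>Morita contexts\<close>

text \<open>
  The Morita context \<open>(S, T, P, P', F, G)\<close>; \<open>F\<close> and \<open>G\<close> are functions on the tensor products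
  \<open>P' \<otimes>\<^sub>S P\<close> and \<open>P \<otimes>\<^sub>T P'\<close>.
\<close>

record ('s, 't, 'p, 'q) morita =
  mS :: "'s ring"
  mT :: "'t ring"
  mP :: "('s, 't, 'p) bimodule"
  mP' :: "('t, 's, 'q) bimodule"
  mF :: "('q \<times> 'p \<Rightarrow>\<^sub>0 int) set \<Rightarrow> 't"
  mG :: "('p \<times> 'q \<Rightarrow>\<^sub>0 int) set \<Rightarrow> 's"

definition morita_context :: "('s, 't, 'p, 'q) morita \<Rightarrow> bool"
  where "morita_context X \<longleftrightarrow>
    (let S = mS X; T = mT X; P = mP X; P' = mP' X;
         F = (\<lambda>q p. mF X (pure_tensor S P' P q p));
         G = (\<lambda>p q. mG X (pure_tensor T P P' p q))
     in ring S \<and> ring T \<and> bimodule S T P \<and> bimodule T S P' \<and>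
        mF X \<in> bimodule_hom T T (tensor S P' P) (regular_bimodule T) \<and>
        mG X \<in> bimodule_hom S S (tensor T P P') (regular_bimodule S) \<and>
        (\<forall>q \<in> carrier P'. \<forall>p \<in> carrier P. \<forall>q' \<in> carrier P'.
           F q p \<odot>\<^bsub>P'\<^esub> q' = q \<triangleleft>\<^bsub>P'\<^esub> G p q') \<and>
        (\<forall>p \<in> carrier P. \<forall>q \<in> carrier P'. \<forall>p' \<in> carrier P.
           G p q \<odot>\<^bsub>P\<^esub> p' = p \<triangleleft>\<^bsub>P\<^esub> F q p'))"

text \<open>
  \<open>Y\<close> is the structure obtained from \<open>X\<close> by transport along the bijections
  \<open>\<sigma>, \<tau>, \<phi>, \<phi>'\<close>. As \<open>F\<close> and \<open>G\<close> are additive, it is enough to compare them on pure tensors.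
\<close>

definition morita_iso ::
  "('s1, 't1, 'p1, 'q1) morita \<Rightarrow> ('s2, 't2, 'p2, 'q2) morita
    \<Rightarrow> ('s1 \<Rightarrow> 's2) \<Rightarrow> ('t1 \<Rightarrow> 't2) \<Rightarrow> ('p1 \<Rightarrow> 'p2) \<Rightarrow> ('q1 \<Rightarrow> 'q2) \<Rightarrow> bool"
  where "morita_iso X Y \<sigma> \<tau> \<phi> \<phi>' \<longleftrightarrow>
    \<sigma> \<in> ring_iso (mS X) (mS Y) \<and> \<tau> \<in> ring_iso (mT X) (mT Y) \<and>
    \<phi> \<in> iso (add_monoid (mP X)) (add_monoid (mP Y)) \<and>
    \<phi>' \<in> iso (add_monoid (mP' X)) (add_monoid (mP' Y)) \<and>
    (\<forall>s \<in> carrier (mS X). \<forall>p \<in> carrier (mP X). \<phi> (s \<odot>\<^bsub>mP X\<^esub> p) = \<sigma> s \<odot>\<^bsub>mP Y\<^esub> \<phi> p) \<and>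
    (\<forall>p \<in> carrier (mP X). \<forall>t \<in> carrier (mT X). \<phi> (p \<triangleleft>\<^bsub>mP X\<^esub> t) = \<phi> p \<triangleleft>\<^bsub>mP Y\<^esub> \<tau> t) \<and>
    (\<forall>t \<in> carrier (mT X). \<forall>q \<in> carrier (mP' X). \<phi>' (t \<odot>\<^bsub>mP' X\<^esub> q) = \<tau> t \<odot>\<^bsub>mP' Y\<^esub> \<phi>' q) \<and>
    (\<forall>q \<in> carrier (mP' X). \<forall>s \<in> carrier (mS X). \<phi>' (q \<triangleleft>\<^bsub>mP' X\<^esub> s) = \<phi>' q \<triangleleft>\<^bsub>mP' Y\<^esub> \<sigma> s) \<and>
    (\<forall>q \<in> carrier (mP' X). \<forall>p \<in> carrier (mP X).
       \<tau> (mF X (pure_tensor (mS X) (mP' X) (mP X) q p))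
         = mF Y (pure_tensor (mS Y) (mP' Y) (mP Y) (\<phi>' q) (\<phi> p))) \<and>
    (\<forall>p \<in> carrier (mP X). \<forall>q \<in> carrier (mP' X).
       \<sigma> (mG X (pure_tensor (mT X) (mP X) (mP' X) p q))
         = mG Y (pure_tensor (mT Y) (mP Y) (mP' Y) (\<phi> p) (\<phi>' q)))"

definition End_ring ::
  "('t, 'k) ring_scheme \<Rightarrow> ('l, 't, 'p, 'x) bimodule_scheme \<Rightarrow> ('p \<Rightarrow> 'p) ring"
  where "End_ring T P =
    \<lparr>carrier = right_hom T P P \<inter> extensional (carrier P),
     mult = compose (carrier P), one = (\<lambda>p \<in> carrier P. p),
     ring.zero = (\<lambda>p \<in> carrier P. \<zero>\<^bsub>P\<^esub>), add = (\<lambda>f g. \<lambda>p \<in> carrier P. f p \<oplus>\<^bsub>P\<^esub> g p)\<rparr>"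

definition dual_bimodule ::
  "('t, 'k) ring_scheme \<Rightarrow> ('l, 't, 'p, 'x) bimodule_scheme \<Rightarrow> ('t, 'p \<Rightarrow> 'p, 'p \<Rightarrow> 't) bimodule"
  where "dual_bimodule T P =
    \<lparr>carrier = right_hom T P (regular_bimodule T) \<inter> extensional (carrier P),
     mult = undefined, one = undefined,
     ring.zero = (\<lambda>p \<in> carrier P. \<zero>\<^bsub>T\<^esub>), add = (\<lambda>f g. \<lambda>p \<in> carrier P. f p \<oplus>\<^bsub>T\<^esub> g p),
     smult = (\<lambda>t f. \<lambda>p \<in> carrier P. t \<otimes>\<^bsub>T\<^esub> f p),
     rsmult = (\<lambda>f s. compose (carrier P) f s)\<rparr>"

text \<open>The Morita context derived from a right \<open>T\<close>-module \<open>P\<close>; a left action of \<open>P\<close> is ignored.\<close>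

definition derived_morita ::
  "'t ring \<Rightarrow> ('l, 't, 'p, 'x) bimodule_scheme \<Rightarrow> ('p \<Rightarrow> 'p, 't, 'p, 'p \<Rightarrow> 't) morita"
  where "derived_morita T P =
    (let S = End_ring T P;
         P\<^sub>S = \<lparr>carrier = carrier P, mult = mult P, one = one P, ring.zero = ring.zero P, add = add P,
                smult = (\<lambda>f p. f p), rsmult = rsmult P\<rparr>;
         P' = dual_bimodule T P
     in \<lparr>mS = S, mT = T, mP = P\<^sub>S, mP' = P',
         mF = tensor_lift S P' P\<^sub>S (add_monoid T) (\<lambda>f p. f p),
         mG = tensor_lift T P\<^sub>S P' (add_monoid S) (\<lambda>p f. \<lambda>p' \<in> carrier P. p \<triangleleft>\<^bsub>P\<^esub> f p')\<rparr>)"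

section \<open>Corings\<close>

record ('a, 'c) coring = "('a, 'a, 'c) bimodule" +
  comult :: "'c \<Rightarrow> ('c \<times> 'c \<Rightarrow>\<^sub>0 int) set"
  counit :: "'c \<Rightarrow> 'a"

text \<open>\<open>(C \<otimes>\<^sub>A C) \<otimes>\<^sub>A C \<rightarrow> C \<otimes>\<^sub>A (C \<otimes>\<^sub>A C)\<close>, \<open>(c \<otimes> d) \<otimes> e \<mapsto> c \<otimes> (d \<otimes> e)\<close>.\<close>

definition tensor_assoc ::
  "'a ring \<Rightarrow> ('a, 'a, 'c, 'x) bimodule_scheme
    \<Rightarrow> (('c \<times> 'c \<Rightarrow>\<^sub>0 int) set \<times> 'c \<Rightarrow>\<^sub>0 int) set \<Rightarrow> ('c \<times> ('c \<times> 'c \<Rightarrow>\<^sub>0 int) set \<Rightarrow>\<^sub>0 int) set"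
  where "tensor_assoc A C =
    (let CC = tensor A C C; G = tensor_group A C CC
     in tensor_lift A CC C G
          (\<lambda>u e. tensor_lift A C C G (\<lambda>c d. pure_tensor A C CC c (pure_tensor A C C d e)) u))"

locale coring = bimodule A A C
  for A :: "'a ring" (structure) and C :: "('a, 'c, 'x) coring_scheme" (structure) +
  assumes one_not_zero: "\<one>\<^bsub>A\<^esub> \<noteq> \<zero>\<^bsub>A\<^esub>"
    and comult_hom: "comult C \<in> bimodule_hom A A C (tensor A C C)"
    and counit_hom: "counit C \<in> bimodule_hom A A C (regular_bimodule A)"
    and coassoc: "c \<in> carrier C \<Longrightarrow>
      tensor_assoc A C
        (tensor_lift A C C (tensor_group A (tensor A C C) C)
           (\<lambda>c\<^sub>1 c\<^sub>2. pure_tensor A (tensor A C C) C (comult C c\<^sub>1) c\<^sub>2) (comult C c))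
      = tensor_lift A C C (tensor_group A C (tensor A C C))
           (\<lambda>c\<^sub>1 c\<^sub>2. pure_tensor A C (tensor A C C) c\<^sub>1 (comult C c\<^sub>2)) (comult C c)"
    and counit_left: "c \<in> carrier C \<Longrightarrow>
      tensor_lift A C C (add_monoid C) (\<lambda>c\<^sub>1 c\<^sub>2. counit C c\<^sub>1 \<odot>\<^bsub>C\<^esub> c\<^sub>2) (comult C c) = c"
    and counit_right: "c \<in> carrier C \<Longrightarrow>
      tensor_lift A C C (add_monoid C) (\<lambda>c\<^sub>1 c\<^sub>2. c\<^sub>1 \<triangleleft>\<^bsub>C\<^esub> counit C c\<^sub>2) (comult C c) = c"

definition grouplike :: "'a ring \<Rightarrow> ('a, 'c, 'x) coring_scheme \<Rightarrow> 'c \<Rightarrow> bool"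
  where "grouplike A C x \<longleftrightarrow> x \<in> carrier C \<and>
    comult C x = pure_tensor A C C x x \<and> counit C x = \<one>\<^bsub>A\<^esub>"

text \<open>
  The left dual ring \<open>\<^sup>*C\<close>, with \<open>(f \<cdot> g)(c) = \<Sum> g (c\<^sub>1 f (c\<^sub>2))\<close>. Its elements are left linear maps,
  made unique as HOL functions by being \<^const>\<open>undefined\<close> off the carrier of \<open>C\<close>.
\<close>

definition ldual :: "'a ring \<Rightarrow> ('a, 'c, 'x) coring_scheme \<Rightarrow> ('c \<Rightarrow> 'a) ring"
  where "ldual A C =
    \<lparr>carrier = left_hom A C (regular_bimodule A) \<inter> extensional (carrier C),
     mult = (\<lambda>f g. \<lambda>c \<in> carrier C.
       tensor_lift A C C (add_monoid A) (\<lambda>c\<^sub>1 c\<^sub>2. g (c\<^sub>1 \<triangleleft>\<^bsub>C\<^esub> f c\<^sub>2)) (comult C c)),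
     one = restrict (counit C) (carrier C),
     ring.zero = (\<lambda>c \<in> carrier C. \<zero>\<^bsub>A\<^esub>),
     add = (\<lambda>f g. \<lambda>c \<in> carrier C. f c \<oplus>\<^bsub>A\<^esub> g c)\<rparr>"

text \<open>The right \<open>A\<close>-action \<open>(q a)(c) = q (c) a\<close> on \<open>\<^sup>*C\<close>, and the ring map \<open>A \<rightarrow> \<^sup>*C\<close>, \<open>a \<mapsto> \<epsilon> a\<close>.\<close>

definition ldual_rsmult ::
  "'a ring \<Rightarrow> ('a, 'c, 'x) coring_scheme \<Rightarrow> ('c \<Rightarrow> 'a) \<Rightarrow> 'a \<Rightarrow> ('c \<Rightarrow> 'a)"
  where "ldual_rsmult A C q a = (\<lambda>c \<in> carrier C. q c \<otimes>\<^bsub>A\<^esub> a)"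

definition ldual_unit_map :: "'a ring \<Rightarrow> ('a, 'c, 'x) coring_scheme \<Rightarrow> 'a \<Rightarrow> ('c \<Rightarrow> 'a)"
  where "ldual_unit_map A C a = ldual_rsmult A C \<one>\<^bsub>ldual A C\<^esub> a"

text \<open>
  \<open>M\<^sup>x\<close> for a right \<open>\<^sup>*C\<close>-module \<open>M\<close>; in \<open>m g = m g(x)\<close> the right \<open>A\<close>-module structure of \<open>M\<close>
  is the one induced by \<open>A \<rightarrow> \<^sup>*C\<close>.
\<close>

definition invariants ::
  "'a ring \<Rightarrow> ('a, 'c, 'x) coring_scheme \<Rightarrow> 'c \<Rightarrow> ('l, 'c \<Rightarrow> 'a, 'm, 'y) bimodule_scheme \<Rightarrow> 'm set"
  where "invariants A C x M = {m \<in> carrier M. \<forall>g \<in> carrier (ldual A C).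
    m \<triangleleft>\<^bsub>M\<^esub> g = m \<triangleleft>\<^bsub>M\<^esub> ldual_unit_map A C (g x)}"

text \<open>The action \<open>a \<leftharpoonup> g = g (x a)\<close>, and \<open>A\<close> with left multiplication and this right action.\<close>

definition harpoon :: "('a, 'c, 'x) coring_scheme \<Rightarrow> 'c \<Rightarrow> 'a \<Rightarrow> ('c \<Rightarrow> 'a) \<Rightarrow> 'a"
  where "harpoon C x a g = g (x \<triangleleft>\<^bsub>C\<^esub> a)"

definition A_module ::
  "'a ring \<Rightarrow> ('a, 'c, 'x) coring_scheme \<Rightarrow> 'c \<Rightarrow> ('a, 'c \<Rightarrow> 'a, 'a) bimodule"
  where "A_module A C x =
    \<lparr>carrier = carrier A, mult = mult A, one = one A, ring.zero = ring.zero A, add = add A,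
     smult = mult A, rsmult = harpoon C x\<rparr>"

definition A_inv :: "'a ring \<Rightarrow> ('a, 'c, 'x) coring_scheme \<Rightarrow> 'c \<Rightarrow> 'a set"
  where "A_inv A C x = invariants A C x (A_module A C x)"

definition ldual_inv :: "'a ring \<Rightarrow> ('a, 'c, 'x) coring_scheme \<Rightarrow> 'c \<Rightarrow> ('c \<Rightarrow> 'a) set"
  where "ldual_inv A C x = invariants A C x (regular_bimodule (ldual A C))"

definition coinvariants :: "'a ring \<Rightarrow> ('a, 'c, 'x) coring_scheme \<Rightarrow> 'c \<Rightarrow> 'a set"
  where "coinvariants A C x = {b \<in> carrier A. b \<odot>\<^bsub>C\<^esub> x = x \<triangleleft>\<^bsub>C\<^esub> b}"

definition Q_set :: "'a ring \<Rightarrow> ('a, 'c, 'x) coring_scheme \<Rightarrow> 'c \<Rightarrow> ('c \<Rightarrow> 'a) set"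
  where "Q_set A C x = {q \<in> carrier (ldual A C). \<forall>c \<in> carrier C.
    tensor_lift A C C (add_monoid C) (\<lambda>c\<^sub>1 c\<^sub>2. c\<^sub>1 \<triangleleft>\<^bsub>C\<^esub> q c\<^sub>2) (comult C c) = q c \<odot>\<^bsub>C\<^esub> x}"

text \<open>
  The data \<open>(S, \<^sup>*C, A, U, q \<otimes> a \<mapsto> q a, a \<otimes> q \<mapsto> a \<leftharpoonup> q)\<close> for \<open>S \<subseteq> A\<close> and \<open>U \<subseteq> \<^sup>*C\<close>, with the
  operations of \<open>A\<close> and \<open>\<^sup>*C\<close>.
\<close>

definition ldual_part ::
  "'a ring \<Rightarrow> ('a, 'c, 'x) coring_scheme \<Rightarrow> ('c \<Rightarrow> 'a) set \<Rightarrow> ('c \<Rightarrow> 'a, 'a, 'c \<Rightarrow> 'a) bimodule"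
  where "ldual_part A C U =
    \<lparr>carrier = U, mult = mult (ldual A C), one = one (ldual A C), ring.zero = ring.zero (ldual A C),
     add = add (ldual A C), smult = mult (ldual A C), rsmult = ldual_rsmult A C\<rparr>"

definition coring_morita ::
  "'a ring \<Rightarrow> ('a, 'c, 'x) coring_scheme \<Rightarrow> 'c \<Rightarrow> 'a set \<Rightarrow> ('c \<Rightarrow> 'a) set
    \<Rightarrow> ('a, 'c \<Rightarrow> 'a, 'a, 'c \<Rightarrow> 'a) morita"
  where "coring_morita A C x S U =
    (let R = A\<lparr>carrier := S\<rparr>; T = ldual A C; P = A_module A C x; P' = ldual_part A C U
     in \<lparr>mS = R, mT = T, mP = P, mP' = P',
         mF = tensor_lift R P' P (add_monoid T) (ldual_rsmult A C),
         mG = tensor_lift T P P' (add_monoid R) (harpoon C x)\<rparr>)"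

definition inv_morita ::
  "'a ring \<Rightarrow> ('a, 'c, 'x) coring_scheme \<Rightarrow> 'c \<Rightarrow> ('a, 'c \<Rightarrow> 'a, 'a, 'c \<Rightarrow> 'a) morita"
  where "inv_morita A C x = coring_morita A C x (A_inv A C x) (ldual_inv A C x)"

definition coinv_morita ::
  "'a ring \<Rightarrow> ('a, 'c, 'x) coring_scheme \<Rightarrow> 'c \<Rightarrow> ('a, 'c \<Rightarrow> 'a, 'a, 'c \<Rightarrow> 'a) morita"
  where "coinv_morita A C x = coring_morita A C x (coinvariants A C x) (Q_set A C x)"

end

theory Submission
  imports Defs "HOL-Algebra.Subrings"
begin

text \<open>
  Write \<open>R\<^sub>f(c) = \<Sum> c\<^sub>1 f(c\<^sub>2)\<close>, so that \<open>(f \<cdot> g)(c) = g(R\<^sub>f(c))\<close>. Coassociativity gives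
  \<open>\<Delta>(R\<^sub>f(c)) = \<Sum> c\<^sub>1 \<otimes> R\<^sub>f(c\<^sub>2)\<close>, hence \<open>R\<^bsub>f\<cdot>g\<^esub> = R\<^sub>g \<circ> R\<^sub>f\<close>; this is both the associativity
  of \<open>\<^sup>*C\<close> and the reason why \<open>Q\<close>, the set of \<open>q\<close> with \<open>R\<^sub>q(c) = q(c) x\<close>, is a left ideal.
  Every subring \<open>S\<close> of \<open>A\<^sup>x\<close> and every \<open>(\<^sup>*C, S)\<close>-subbimodule \<open>U\<close> of \<open>(\<^sup>*C)\<^sup>x\<close> whose elements send
  \<open>xA\<close> into \<open>S\<close> give a Morita context by the same formulas, and both contexts are instances.
  The conditions defining \<open>A\<^sup>x\<close> and \<open>(\<^sup>*C)\<^sup>x\<close> are those defining \<open>B\<close> and \<open>Q\<close>, tested against all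
  functionals in \<open>\<^sup>*C\<close>; these separate the points of \<open>C\<close> if \<open>C\<close> is locally projective.
\<close>

section \<open>Tensor products\<close>

text \<open>The hypotheses on \<open>f\<close> in \<open>tensor_lift\<close>, bundled. The target is
  written multiplicatively, so it may be a \<open>tensor_group\<close> as well as the
  \<open>add_monoid\<close> of a module.\<close>

definition balanced ::
  "('r, 'k) ring_scheme \<Rightarrow> ('l, 'r, 'm, 'x) bimodule_scheme \<Rightarrow> ('r, 's, 'n, 'y) bimodule_scheme
    \<Rightarrow> ('g, 'z) monoid_scheme \<Rightarrow> ('m \<Rightarrow> 'n \<Rightarrow> 'g) \<Rightarrow> bool"
  where "balanced R M N G f \<longleftrightarrow>
    (\<forall>m \<in> carrier M. \<forall>n \<in> carrier N. f m n \<in> carrier G) \<and>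
    (\<forall>m \<in> carrier M. \<forall>m' \<in> carrier M. \<forall>n \<in> carrier N. f (m \<oplus>\<^bsub>M\<^esub> m') n = f m n \<otimes>\<^bsub>G\<^esub> f m' n) \<and>
    (\<forall>m \<in> carrier M. \<forall>n \<in> carrier N. \<forall>n' \<in> carrier N. f m (n \<oplus>\<^bsub>N\<^esub> n') = f m n \<otimes>\<^bsub>G\<^esub> f m n') \<and>
    (\<forall>m \<in> carrier M. \<forall>r \<in> carrier R. \<forall>n \<in> carrier N. f (m \<triangleleft>\<^bsub>M\<^esub> r) n = f m (r \<odot>\<^bsub>N\<^esub> n))"

lemma balancedI:
  assumes "\<And>m n. \<lbrakk>m \<in> carrier M; n \<in> carrier N\<rbrakk> \<Longrightarrow> f m n \<in> carrier G"
    and "\<And>m m' n. \<lbrakk>m \<in> carrier M; m' \<in> carrier M; n \<in> carrier N\<rbrakk>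
      \<Longrightarrow> f (m \<oplus>\<^bsub>M\<^esub> m') n = f m n \<otimes>\<^bsub>G\<^esub> f m' n"
    and "\<And>m n n'. \<lbrakk>m \<in> carrier M; n \<in> carrier N; n' \<in> carrier N\<rbrakk>
      \<Longrightarrow> f m (n \<oplus>\<^bsub>N\<^esub> n') = f m n \<otimes>\<^bsub>G\<^esub> f m n'"
    and "\<And>m r n. \<lbrakk>m \<in> carrier M; r \<in> carrier R; n \<in> carrier N\<rbrakk>
      \<Longrightarrow> f (m \<triangleleft>\<^bsub>M\<^esub> r) n = f m (r \<odot>\<^bsub>N\<^esub> n)"
  shows "balanced R M N G f"
  using assms by (simp add: balanced_def)

lemma balanced_comp:
  assumes "balanced R M N G f" and "h \<in> hom G H"
  shows "balanced R M N H (\<lambda>m n. h (f m n))"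
  using assms by (auto simp: balanced_def hom_def Pi_iff)

text \<open>Abelian groups closed under the two middle actions carry the universal property. In this
  form the locale also covers triple tensor products and the derived context, where just this
  closure is established beforehand.\<close>

locale tensor_pair =
  fixes R :: "('r, 'k) ring_scheme" and M :: "('l, 'r, 'm, 'x) bimodule_scheme"
    and N :: "('r, 's, 'n, 'y) bimodule_scheme"
  assumes M_group: "abelian_group M"
    and M_closed: "\<lbrakk>m \<in> carrier M; r \<in> carrier R\<rbrakk> \<Longrightarrow> m \<triangleleft>\<^bsub>M\<^esub> r \<in> carrier M"
    and N_group: "abelian_group N"
    and N_closed: "\<lbrakk>r \<in> carrier R; n \<in> carrier N\<rbrakk> \<Longrightarrow> r \<odot>\<^bsub>N\<^esub> n \<in> carrier N"
begin

abbreviation "Fr \<equiv> free_Abelian_group (carrier M \<times> carrier N)"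
abbreviation "K \<equiv> tensor_kernel R M N"

sublocale Fr: comm_group Fr
  by (rule abelian_free_Abelian_group)

lemma Fr_diff: "\<lbrakk>a \<in> carrier Fr; b \<in> carrier Fr\<rbrakk> \<Longrightarrow> a - b \<in> carrier Fr"
  unfolding carrier_free_Abelian_group_iff by (meson Un_least keys_diff order_trans)

lemma Fr_diff_eq: "\<lbrakk>a \<in> carrier Fr; b \<in> carrier Fr\<rbrakk> \<Longrightarrow> a \<otimes>\<^bsub>Fr\<^esub> inv\<^bsub>Fr\<^esub> b = a - b"
  by simp

lemma Fr_of: "\<lbrakk>m \<in> carrier M; n \<in> carrier N\<rbrakk> \<Longrightarrow> frag_of (m, n) \<in> carrier Fr"
  by simp

lemma relations_closed: "tensor_relations R M N \<subseteq> carrier Fr"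
proof -
  interpret M: abelian_group M by (rule M_group)
  interpret N: abelian_group N by (rule N_group)
  show ?thesis
    unfolding tensor_relations_def
    by (intro Un_least subsetI; elim CollectE exE conjE; hypsubst)
      (intro Fr_diff Fr_of M_closed N_closed M.a_closed N.a_closed; assumption)+
qed

lemma K_subgroup: "subgroup K Fr"
  unfolding tensor_kernel_def by (rule Fr.generate_is_subgroup[OF relations_closed])

lemma K_normal: "K \<lhd> Fr"
  by (rule Fr.subgroup_imp_normal[OF K_subgroup])

lemma tensor_comm_group: "comm_group (tensor_group R M N)"
  unfolding tensor_group_def
  by (rule Fr.abelian_FactGroup[OF K_subgroup])

lemma proj_hom: "(\<lambda>a. K #>\<^bsub>Fr\<^esub> a) \<in> hom Fr (tensor_group R M N)"
  unfolding tensor_group_def by (rule normal.r_coset_hom_Mod[OF K_normal])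

lemma pure_closed:
  "\<lbrakk>m \<in> carrier M; n \<in> carrier N\<rbrakk> \<Longrightarrow> pure_tensor R M N m n \<in> carrier (tensor_group R M N)"
  unfolding pure_tensor_def using hom_in_carrier[OF proj_hom Fr_of] .

text \<open>Passes from the multiplicative coset criterion to differences of formal sums.\<close>

lemma coset_eq:
  assumes "a \<in> carrier Fr" "b \<in> carrier Fr" "a - b \<in> K"
  shows "K #>\<^bsub>Fr\<^esub> a = K #>\<^bsub>Fr\<^esub> b"
proof -
  have "a \<otimes>\<^bsub>Fr\<^esub> inv\<^bsub>Fr\<^esub> b \<in> K" using assms by (simp only: Fr_diff_eq)
  then have "a \<in> K #>\<^bsub>Fr\<^esub> b"
    using subgroup.rcos_module_rev[OF K_subgroup] Fr.is_group assms by blast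
  then show ?thesis using Fr.repr_independence K_subgroup assms by metis
qed

lemma relation_in_K: "c \<in> tensor_relations R M N \<Longrightarrow> c \<in> K"
  unfolding tensor_kernel_def by (rule generate.incl)

lemma proj_add:
  "\<lbrakk>a \<in> carrier Fr; b \<in> carrier Fr\<rbrakk>
    \<Longrightarrow> (K #>\<^bsub>Fr\<^esub> a) \<otimes>\<^bsub>tensor_group R M N\<^esub> (K #>\<^bsub>Fr\<^esub> b) = K #>\<^bsub>Fr\<^esub> (a + b)"
  using hom_mult[OF proj_hom, of a b] by simp

lemma Fr_add: "\<lbrakk>a \<in> carrier Fr; b \<in> carrier Fr\<rbrakk> \<Longrightarrow> a + b \<in> carrier Fr"
  using Fr.m_closed[of a b] by simp

text \<open>Each law equates two cosets whose representatives differ by one of the defining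
  relations.\<close>

lemma balanced_pure: "balanced R M N (tensor_group R M N) (pure_tensor R M N)"
proof (rule balancedI)
  interpret M: abelian_group M by (rule M_group)
  interpret N: abelian_group N by (rule N_group)
  fix m n assume mn: "m \<in> carrier M" "n \<in> carrier N"
  show "pure_tensor R M N m n \<in> carrier (tensor_group R M N)" using mn by (rule pure_closed)
  show "pure_tensor R M N (m \<oplus>\<^bsub>M\<^esub> m') n
      = pure_tensor R M N m n \<otimes>\<^bsub>tensor_group R M N\<^esub> pure_tensor R M N m' n"
    if "m' \<in> carrier M" for m'
  proof -
    \<comment> \<open>The bracketed sum comes from the product of two cosets; unfolding restores
      \<open>a - b - c\<close>, the shape in which the relations are listed.\<close>
    have "frag_of (m \<oplus>\<^bsub>M\<^esub> m', n) - (frag_of (m, n) + frag_of (m', n)) \<in> K"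
      unfolding diff_diff_eq[symmetric]
      by (rule relation_in_K) (use that mn in \<open>unfold tensor_relations_def, blast\<close>)
    then show ?thesis
      unfolding pure_tensor_def using that mn
      by (simp only: proj_add Fr_of)
        (rule coset_eq, auto intro!: Fr_add Fr_of simp del: carrier_free_Abelian_group_iff)
  qed
  show "pure_tensor R M N m (n \<oplus>\<^bsub>N\<^esub> n')
      = pure_tensor R M N m n \<otimes>\<^bsub>tensor_group R M N\<^esub> pure_tensor R M N m n'"
    if "n' \<in> carrier N" for n'
  proof -
    have "frag_of (m, n \<oplus>\<^bsub>N\<^esub> n') - (frag_of (m, n) + frag_of (m, n')) \<in> K"
      unfolding diff_diff_eq[symmetric]
      by (rule relation_in_K) (use that mn in \<open>unfold tensor_relations_def, blast\<close>)
    then show ?thesis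
      unfolding pure_tensor_def using that mn
      by (simp only: proj_add Fr_of)
        (rule coset_eq, auto intro!: Fr_add Fr_of simp del: carrier_free_Abelian_group_iff)
  qed
  show "pure_tensor R M N (m \<triangleleft>\<^bsub>M\<^esub> r) n = pure_tensor R M N m (r \<odot>\<^bsub>N\<^esub> n)"
    if "r \<in> carrier R" for r
  proof -
    have "frag_of (m \<triangleleft>\<^bsub>M\<^esub> r, n) - frag_of (m, r \<odot>\<^bsub>N\<^esub> n) \<in> K"
      by (rule relation_in_K) (use that mn in \<open>unfold tensor_relations_def, blast\<close>)
    then show ?thesis
      unfolding pure_tensor_def using that mn
      by (intro coset_eq Fr_of M_closed N_closed)
  qed
qed

text \<open>Pure tensors generate the tensor product: both maps pull back to the free abelian group,
  where they agree on generators. Identities between maps on arbitrary tensors are checked on pure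
  ones through this lemma.\<close>

lemma hom_eqI:
  assumes G: "group G"
    and h: "h \<in> hom (tensor_group R M N) G" and h': "h' \<in> hom (tensor_group R M N) G"
    and eq: "\<And>m n. \<lbrakk>m \<in> carrier M; n \<in> carrier N\<rbrakk>
      \<Longrightarrow> h (pure_tensor R M N m n) = h' (pure_tensor R M N m n)"
    and u: "u \<in> carrier (tensor_group R M N)"
  shows "h u = h' u"
proof -
  let ?p = "\<lambda>c. K #>\<^bsub>Fr\<^esub> c"
  obtain c where c: "c \<in> carrier Fr" "u = ?p c"
    using u by (auto simp: tensor_group_def carrier_FactGroup)
  interpret T: comm_group "tensor_group R M N" by (rule tensor_comm_group)
  interpret hg: group_hom Fr G "\<lambda>c. h (?p c)"
    using hom_compose[OF proj_hom h] G Fr.is_group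
    by (simp add: group_hom_def group_hom_axioms_def comp_def)
  interpret hg': group_hom Fr G "\<lambda>c. h' (?p c)"
    using hom_compose[OF proj_hom h'] G Fr.is_group
    by (simp add: group_hom_def group_hom_axioms_def comp_def)
  have "Poly_Mapping.keys c \<subseteq> carrier M \<times> carrier N" using c by simp
  then have "h (?p c) = h' (?p c)"
  \<comment> \<open>The induction builds formal sums from zero and generators by differences, which
    the pulled back homomorphisms respect.\<close>
  proof (rule free_Abelian_group_induct)
    show "h (?p 0) = h' (?p 0)" using hg.hom_one hg'.hom_one by simp
  next
    fix a b assume ab: "Poly_Mapping.keys a \<subseteq> carrier M \<times> carrier N"
      "Poly_Mapping.keys b \<subseteq> carrier M \<times> carrier N"
      "h (?p a) = h' (?p a)" "h (?p b) = h' (?p b)"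
    then have ca: "a \<in> carrier Fr" "b \<in> carrier Fr" by auto
    show "h (?p (a - b)) = h' (?p (a - b))"
      using ab(3,4) ca hg.hom_mult[OF ca(1) Fr.inv_closed[OF ca(2)]]
        hg'.hom_mult[OF ca(1) Fr.inv_closed[OF ca(2)]]
      by (simp only: hg.hom_inv hg'.hom_inv Fr_diff_eq)
  next
    fix p assume "p \<in> carrier M \<times> carrier N"
    then show "h (?p (frag_of p)) = h' (?p (frag_of p))"
      using eq by (auto simp: pure_tensor_def)
  qed
  then show ?thesis by (simp add: c)
qed

context
  fixes G :: "('g, 'z) monoid_scheme" and f
  assumes G: "comm_group G" and f: "balanced R M N G f"
begin

lemma lift_hom: "tensor_lift R M N G f \<in> hom (tensor_group R M N) G"
  using f unfolding balanced_def
  by (intro tensor_lift(1) M_group N_group M_closed N_closed G) auto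

lemma lift_pure:
  "\<lbrakk>m \<in> carrier M; n \<in> carrier N\<rbrakk> \<Longrightarrow> tensor_lift R M N G f (pure_tensor R M N m n) = f m n"
  using f unfolding balanced_def
  by (intro tensor_lift(3) M_group N_group M_closed N_closed G) auto

lemma lift_closed: "u \<in> carrier (tensor_group R M N) \<Longrightarrow> tensor_lift R M N G f u \<in> carrier G"
  using lift_hom by (rule hom_in_carrier)

lemma lift_unique:
  assumes "h \<in> hom (tensor_group R M N) G"
    and "\<And>m n. \<lbrakk>m \<in> carrier M; n \<in> carrier N\<rbrakk> \<Longrightarrow> h (pure_tensor R M N m n) = f m n"
    and "u \<in> carrier (tensor_group R M N)"
  shows "h u = tensor_lift R M N G f u"
  by (rule hom_eqI[OF _ assms(1) lift_hom _ assms(3)])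
    (use G comm_group.axioms(2) in \<open>auto simp: assms(2) lift_pure\<close>)

end

text \<open>An additive map moves under a Sweedler sum, by uniqueness of the lift.\<close>

lemma hom_lift:
  assumes G: "comm_group G" and f: "balanced R M N G f" and H: "comm_group H"
    and h: "h \<in> hom G H" and u: "u \<in> carrier (tensor_group R M N)"
  shows "h (tensor_lift R M N G f u) = tensor_lift R M N H (\<lambda>m n. h (f m n)) u"
proof (rule lift_unique[OF H balanced_comp[OF f h] _ _ u])
  show "(\<lambda>u. h (tensor_lift R M N G f u)) \<in> hom (tensor_group R M N) H"
    using hom_compose[OF lift_hom[OF G f] h] by (simp add: comp_def)
qed (simp add: lift_pure[OF G f])

text \<open>The definite description behind \<open>tensor_lift\<close> consults the function on the
  carriers alone, so the two describing predicates coincide.\<close>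

lemma lift_cong:
  assumes "\<And>m n. \<lbrakk>m \<in> carrier M; n \<in> carrier N\<rbrakk> \<Longrightarrow> f m n = g m n"
  shows "tensor_lift R M N G f = tensor_lift R M N G g"
proof -
  have "(\<forall>m \<in> carrier M. \<forall>n \<in> carrier N. h (pure_tensor R M N m n) = f m n) \<longleftrightarrow>
    (\<forall>m \<in> carrier M. \<forall>n \<in> carrier N. h (pure_tensor R M N m n) = g m n)" for h
    using assms by auto
  then show ?thesis unfolding tensor_lift_def by presburger
qed

end

section \<open>Tensor products as abelian groups, and linear maps\<close>

lemma carrier_tensor: "carrier (tensor R M N) = carrier (tensor_group R M N)"
  and add_tensor: "add (tensor R M N) = mult (tensor_group R M N)"
  and smult_tensor: "l \<odot>\<^bsub>tensor R M N\<^esub> u = tensor_lift R M N (tensor_group R M N)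
    (\<lambda>m n. pure_tensor R M N (l \<odot>\<^bsub>M\<^esub> m) n) u"
  and rsmult_tensor: "u \<triangleleft>\<^bsub>tensor R M N\<^esub> s = tensor_lift R M N (tensor_group R M N)
    (\<lambda>m n. pure_tensor R M N m (n \<triangleleft>\<^bsub>N\<^esub> s)) u"
  by (simp_all add: tensor_def)

lemma comm_group_cong:
  assumes "comm_group G" and "carrier H = carrier G" "mult H = mult G" "one H = one G"
  shows "comm_group H"
proof -
  interpret comm_group G by (rule assms(1))
  show ?thesis
    by (rule comm_groupI) (use l_inv_ex in \<open>auto simp: assms(2-4) m_ac\<close>)
qed

lemma abelian_group_iff_comm_group: "abelian_group M \<longleftrightarrow> comm_group (add_monoid M)"
  by (auto simp: abelian_group_def abelian_group_axioms_def abelian_monoid_def comm_group_def)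

lemmas abelian_group_comm_group = iffD1[OF abelian_group_iff_comm_group]

lemma abelian_group_cong:
  assumes "abelian_group M" and "carrier N = carrier M" "add N = add M" "\<zero>\<^bsub>N\<^esub> = \<zero>\<^bsub>M\<^esub>"
  shows "abelian_group N"
  unfolding abelian_group_iff_comm_group
  by (rule comm_group_cong[OF abelian_group_comm_group[OF assms(1)]]) (simp_all add: assms)

lemma (in tensor_pair) tensor_abelian_group: "abelian_group (tensor R M N)"
  unfolding abelian_group_iff_comm_group
  by (rule comm_group_cong[OF tensor_comm_group]) (simp_all add: tensor_def)

text \<open>Lifts are maps on \<open>tensor_group\<close>, linear maps are maps on
  \<open>tensor\<close>; the records differ but share their elements and operation.\<close>

lemma hom_tensor: "hom (add_monoid (tensor R M N)) G = hom (tensor_group R M N) G"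
  "hom G (add_monoid (tensor R M N)) = hom G (tensor_group R M N)"
  by (simp_all add: hom_def tensor_def)

lemma left_homD:
  assumes "h \<in> left_hom R M N"
  shows "h \<in> hom (add_monoid M) (add_monoid N)"
    and "m \<in> carrier M \<Longrightarrow> h m \<in> carrier N"
    and "\<lbrakk>m \<in> carrier M; m' \<in> carrier M\<rbrakk> \<Longrightarrow> h (m \<oplus>\<^bsub>M\<^esub> m') = h m \<oplus>\<^bsub>N\<^esub> h m'"
    and "\<lbrakk>r \<in> carrier R; m \<in> carrier M\<rbrakk> \<Longrightarrow> h (r \<odot>\<^bsub>M\<^esub> m) = r \<odot>\<^bsub>N\<^esub> h m"
  using assms by (auto simp: left_hom_def hom_def)

lemma right_homD:
  assumes "h \<in> right_hom S M N"
  shows "h \<in> hom (add_monoid M) (add_monoid N)"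
    and "m \<in> carrier M \<Longrightarrow> h m \<in> carrier N"
    and "\<lbrakk>m \<in> carrier M; m' \<in> carrier M\<rbrakk> \<Longrightarrow> h (m \<oplus>\<^bsub>M\<^esub> m') = h m \<oplus>\<^bsub>N\<^esub> h m'"
    and "\<lbrakk>s \<in> carrier S; m \<in> carrier M\<rbrakk> \<Longrightarrow> h (m \<triangleleft>\<^bsub>M\<^esub> s) = h m \<triangleleft>\<^bsub>N\<^esub> s"
  using assms by (auto simp: right_hom_def hom_def)

lemma left_homI:
  assumes "\<And>m. m \<in> carrier M \<Longrightarrow> h m \<in> carrier N"
    and "\<And>m m'. \<lbrakk>m \<in> carrier M; m' \<in> carrier M\<rbrakk> \<Longrightarrow> h (m \<oplus>\<^bsub>M\<^esub> m') = h m \<oplus>\<^bsub>N\<^esub> h m'"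
    and "\<And>r m. \<lbrakk>r \<in> carrier R; m \<in> carrier M\<rbrakk> \<Longrightarrow> h (r \<odot>\<^bsub>M\<^esub> m) = r \<odot>\<^bsub>N\<^esub> h m"
  shows "h \<in> left_hom R M N"
  using assms by (simp add: left_hom_def hom_def)

lemma right_homI:
  assumes "\<And>m. m \<in> carrier M \<Longrightarrow> h m \<in> carrier N"
    and "\<And>m m'. \<lbrakk>m \<in> carrier M; m' \<in> carrier M\<rbrakk> \<Longrightarrow> h (m \<oplus>\<^bsub>M\<^esub> m') = h m \<oplus>\<^bsub>N\<^esub> h m'"
    and "\<And>s m. \<lbrakk>s \<in> carrier S; m \<in> carrier M\<rbrakk> \<Longrightarrow> h (m \<triangleleft>\<^bsub>M\<^esub> s) = h m \<triangleleft>\<^bsub>N\<^esub> s"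
  shows "h \<in> right_hom S M N"
  using assms by (simp add: right_hom_def hom_def)

lemma regular_bimodule_simps [simp]:
  "carrier (regular_bimodule R) = carrier R" "\<zero>\<^bsub>regular_bimodule R\<^esub> = \<zero>\<^bsub>R\<^esub>"
  "a \<oplus>\<^bsub>regular_bimodule R\<^esub> b = a \<oplus>\<^bsub>R\<^esub> b"
  "a \<odot>\<^bsub>regular_bimodule R\<^esub> b = a \<otimes>\<^bsub>R\<^esub> b" "a \<triangleleft>\<^bsub>regular_bimodule R\<^esub> b = a \<otimes>\<^bsub>R\<^esub> b"
  by (simp_all add: regular_bimodule_def)

section \<open>Outer actions on a tensor product of bimodules\<close>

locale bimodule_pair = M: bimodule L R M + N: bimodule R S N
  for L :: "('l, 'i) ring_scheme" and R :: "('r, 'j) ring_scheme" and S :: "('s, 'k) ring_scheme"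
    and M :: "('l, 'r, 'm, 'x) bimodule_scheme" and N :: "('r, 's, 'n, 'y) bimodule_scheme"
begin

sublocale tensor_pair R M N
  by unfold_locales (rule M.rsmult_closed N.smult_closed; assumption)+

text \<open>The outer action respects the relations because it commutes with the middle one, which
  is \<open>smult_rsmult\<close>.\<close>

lemma balanced_smult:
  assumes "l \<in> carrier L"
  shows "balanced R M N (tensor_group R M N) (\<lambda>m n. pure_tensor R M N (l \<odot>\<^bsub>M\<^esub> m) n)"
  by (rule balancedI) (use balanced_pure[unfolded balanced_def] assms in
    \<open>simp_all add: M.smult_closed M.smult_r_distr M.smult_rsmult[symmetric]\<close>)

lemma balanced_rsmult:
  assumes "s \<in> carrier S"
  shows "balanced R M N (tensor_group R M N) (\<lambda>m n. pure_tensor R M N m (n \<triangleleft>\<^bsub>N\<^esub> s))"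
  by (rule balancedI) (use balanced_pure[unfolded balanced_def] assms in
    \<open>simp_all add: N.rsmult_closed N.rsmult_l_distr N.smult_rsmult\<close>)

lemma smult_pure:
  "\<lbrakk>l \<in> carrier L; m \<in> carrier M; n \<in> carrier N\<rbrakk>
    \<Longrightarrow> l \<odot>\<^bsub>tensor R M N\<^esub> pure_tensor R M N m n = pure_tensor R M N (l \<odot>\<^bsub>M\<^esub> m) n"
  unfolding smult_tensor by (rule lift_pure[OF tensor_comm_group balanced_smult])

lemma rsmult_pure:
  "\<lbrakk>s \<in> carrier S; m \<in> carrier M; n \<in> carrier N\<rbrakk>
    \<Longrightarrow> pure_tensor R M N m n \<triangleleft>\<^bsub>tensor R M N\<^esub> s = pure_tensor R M N m (n \<triangleleft>\<^bsub>N\<^esub> s)"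
  unfolding rsmult_tensor by (rule lift_pure[OF tensor_comm_group balanced_rsmult])

lemma smult_hom:
  assumes "l \<in> carrier L"
  shows "(\<lambda>u. l \<odot>\<^bsub>tensor R M N\<^esub> u) \<in> hom (tensor_group R M N) (tensor_group R M N)"
  unfolding smult_tensor using lift_hom[OF tensor_comm_group balanced_smult[OF assms]] .

lemma rsmult_hom:
  assumes "s \<in> carrier S"
  shows "(\<lambda>u. u \<triangleleft>\<^bsub>tensor R M N\<^esub> s) \<in> hom (tensor_group R M N) (tensor_group R M N)"
  unfolding rsmult_tensor using lift_hom[OF tensor_comm_group balanced_rsmult[OF assms]] .

text \<open>For a fixed scalar both sides of the linearity law are additive in the tensor, so pure
  tensors suffice.\<close>

lemma left_hom_tensor:
  assumes "left_module L G" and "h \<in> hom (tensor_group R M N) (add_monoid G)"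
    and "\<And>l m n. \<lbrakk>l \<in> carrier L; m \<in> carrier M; n \<in> carrier N\<rbrakk>
      \<Longrightarrow> h (pure_tensor R M N (l \<odot>\<^bsub>M\<^esub> m) n) = l \<odot>\<^bsub>G\<^esub> h (pure_tensor R M N m n)"
  shows "h \<in> left_hom L (tensor R M N) G"
proof -
  interpret G: left_module L G by (rule assms(1))
  have "h (l \<odot>\<^bsub>tensor R M N\<^esub> u) = l \<odot>\<^bsub>G\<^esub> h u"
    if l: "l \<in> carrier L" and u: "u \<in> carrier (tensor_group R M N)" for l u
  proof (rule hom_eqI[OF G.M.a_group _ _ _ u])
    show "(\<lambda>u. h (l \<odot>\<^bsub>tensor R M N\<^esub> u)) \<in> hom (tensor_group R M N) (add_monoid G)"
      using hom_compose[OF smult_hom[OF l] assms(2)] by (simp add: comp_def)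
    show "(\<lambda>u. l \<odot>\<^bsub>G\<^esub> h u) \<in> hom (tensor_group R M N) (add_monoid G)"
      using assms(2) l by (auto simp: hom_def Pi_iff G.smult_closed G.smult_r_distr)
  qed (simp add: smult_pure l assms(3))
  then show ?thesis
    using assms(2) unfolding left_hom_def hom_tensor by (simp add: carrier_tensor)
qed

lemma right_hom_tensor:
  assumes "right_module S G" and "h \<in> hom (tensor_group R M N) (add_monoid G)"
    and "\<And>s m n. \<lbrakk>s \<in> carrier S; m \<in> carrier M; n \<in> carrier N\<rbrakk>
      \<Longrightarrow> h (pure_tensor R M N m (n \<triangleleft>\<^bsub>N\<^esub> s)) = h (pure_tensor R M N m n) \<triangleleft>\<^bsub>G\<^esub> s"
  shows "h \<in> right_hom S (tensor R M N) G"
proof -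
  interpret G: right_module S G by (rule assms(1))
  have "h (u \<triangleleft>\<^bsub>tensor R M N\<^esub> s) = h u \<triangleleft>\<^bsub>G\<^esub> s"
    if s: "s \<in> carrier S" and u: "u \<in> carrier (tensor_group R M N)" for s u
  proof (rule hom_eqI[OF G.M.a_group _ _ _ u])
    show "(\<lambda>u. h (u \<triangleleft>\<^bsub>tensor R M N\<^esub> s)) \<in> hom (tensor_group R M N) (add_monoid G)"
      using hom_compose[OF rsmult_hom[OF s] assms(2)] by (simp add: comp_def)
    show "(\<lambda>u. h u \<triangleleft>\<^bsub>G\<^esub> s) \<in> hom (tensor_group R M N) (add_monoid G)"
      using assms(2) s by (auto simp: hom_def Pi_iff G.rsmult_closed G.rsmult_l_distr)
  qed (simp add: rsmult_pure s assms(3))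
  then show ?thesis
    using assms(2) unfolding right_hom_def hom_tensor by (simp add: carrier_tensor)
qed

end

section \<open>The left dual ring of a coring\<close>

text \<open>\<open>c \<mapsto> \<Sum> c\<^sub>1 f(c\<^sub>2)\<close>, so that \<open>(f \<cdot> g)(c) = g (slice f c)\<close>.\<close>

definition slice :: "'a ring \<Rightarrow> ('a, 'c, 'x) coring_scheme \<Rightarrow> ('c \<Rightarrow> 'a) \<Rightarrow> 'c \<Rightarrow> 'c"
  where "slice A C f c = tensor_lift A C C (add_monoid C) (\<lambda>c d. c \<triangleleft>\<^bsub>C\<^esub> f d) (comult C c)"

section \<open>Slices, the counit and coassociativity\<close>

context coring
begin

abbreviation "CC \<equiv> tensor A C C"
abbreviation "CG \<equiv> tensor_group A C C"

sublocale CC: bimodule_pair A A A C C ..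

text \<open>This and the next pair are the two bracketings of the triple tensor product, the source
  and the target of \<open>tensor_assoc\<close>.\<close>

sublocale CC_C: tensor_pair A CC C
proof (rule tensor_pair.intro)
  show "m \<triangleleft>\<^bsub>CC\<^esub> r \<in> carrier CC" if "m \<in> carrier CC" "r \<in> carrier A" for m r
    using hom_in_carrier[OF CC.rsmult_hom[OF that(2)]] that(1) by (simp add: carrier_tensor)
qed (rule CC.tensor_abelian_group M.abelian_group_axioms smult_closed; assumption?)+

sublocale C_CC: tensor_pair A C CC
proof (rule tensor_pair.intro)
  show "r \<odot>\<^bsub>CC\<^esub> m \<in> carrier CC" if "m \<in> carrier CC" "r \<in> carrier A" for m r
    using hom_in_carrier[OF CC.smult_hom[OF that(2)]] that(1) by (simp add: carrier_tensor)
qed (rule CC.tensor_abelian_group M.abelian_group_axioms rsmult_closed; assumption?)+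

abbreviation "LH \<equiv> left_hom A C (regular_bimodule A)"

lemma C_comm_group: "comm_group (add_monoid C)"
  by (rule abelian_group_comm_group) (rule M.abelian_group_axioms)

lemma A_comm_group: "comm_group (add_monoid A)"
  by (rule abelian_group_comm_group) (rule R.abelian_group_axioms)

lemma comult_left_hom: "comult C \<in> left_hom A C CC"
  and comult_right_hom: "comult C \<in> right_hom A C CC"
  using comult_hom by (simp_all add: bimodule_hom_def)

lemma counit_left_hom: "counit C \<in> LH"
  and counit_right_hom: "counit C \<in> right_hom A C (regular_bimodule A)"
  using counit_hom by (simp_all add: bimodule_hom_def)

lemma comult_closed: "c \<in> carrier C \<Longrightarrow> comult C c \<in> carrier CG"
  using left_homD(2)[OF comult_left_hom] by (simp add: carrier_tensor)

lemmas LH_closed = left_homD(2)[where N = "regular_bimodule A" and M = C and R = A, simplified]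
lemmas LH_add = left_homD(3)[where N = "regular_bimodule A" and M = C and R = A, simplified]
lemmas LH_smult = left_homD(4)[where N = "regular_bimodule A" and M = C and R = A, simplified]

lemma LH_hom: "f \<in> LH \<Longrightarrow> f \<in> hom (add_monoid C) (add_monoid A)"
  by (simp add: hom_def Pi_iff LH_closed LH_add)

text \<open>Left linearity of \<open>f\<close> balances the map:
  \<open>(c r) f(d) = c (r f(d)) = c f(r d)\<close>.\<close>

lemma balanced_slice: "f \<in> LH \<Longrightarrow> balanced A C C (add_monoid C) (\<lambda>c d. c \<triangleleft>\<^bsub>C\<^esub> f d)"
  by (rule balancedI)
    (simp_all add: LH_closed LH_add LH_smult rsmult_closed rsmult_l_distr rsmult_r_distr rsmult_assoc)

lemma slice_closed: "\<lbrakk>f \<in> LH; c \<in> carrier C\<rbrakk> \<Longrightarrow> slice A C f c \<in> carrier C"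
  unfolding slice_def
  using CC.lift_closed[OF C_comm_group balanced_slice comult_closed] by simp

text \<open>Scalars from the left act on the first leg, while \<open>f\<close> consumes the
  second.\<close>

lemma lift_slice_left_hom:
  assumes f: "f \<in> LH"
  shows "tensor_lift A C C (add_monoid C) (\<lambda>c d. c \<triangleleft>\<^bsub>C\<^esub> f d) \<in> left_hom A CC C"
  by (rule CC.left_hom_tensor[OF left_module_axioms CC.lift_hom[OF C_comm_group balanced_slice[OF f]]])
    (simp add: CC.lift_pure[OF C_comm_group balanced_slice[OF f]] smult_closed smult_rsmult LH_closed f)

lemma slice_left_hom:
  assumes f: "f \<in> LH"
  shows "slice A C f \<in> left_hom A C C"
  unfolding slice_def
  using left_homD[OF lift_slice_left_hom[OF f]] left_homD[OF comult_left_hom]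
  by (intro left_homI) simp_all

text \<open>With \<open>h\<close> a functional this turns the product formula of the dual ring into
  composition with a slice; with \<open>h\<close> the comultiplication it expands
  \<open>comult C (slice A C f c)\<close>.\<close>

lemma lift_apply_slice:
  assumes "f \<in> LH" "c \<in> carrier C" "comm_group H" "h \<in> hom (add_monoid C) H"
  shows "h (slice A C f c) = tensor_lift A C C H (\<lambda>c d. h (c \<triangleleft>\<^bsub>C\<^esub> f d)) (comult C c)"
  unfolding slice_def
  by (rule CC.hom_lift[OF C_comm_group balanced_slice[OF assms(1)] assms(3,4) comult_closed[OF assms(2)]])

lemma slice_counit: "c \<in> carrier C \<Longrightarrow> slice A C (counit C) c = c"
  unfolding slice_def by (rule counit_right)

text \<open>\<open>counit(c1 f(c2)) = counit(c1) f(c2) = f(counit(c1) c2)\<close>, by right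
  linearity of the counit and left linearity of \<open>f\<close>; the left counit law then collapses
  the sum.\<close>

lemma counit_slice:
  assumes f: "f \<in> LH" and c: "c \<in> carrier C"
  shows "counit C (slice A C f c) = f c"
proof -
  have b: "balanced A C C (add_monoid C) (\<lambda>c d. counit C c \<odot>\<^bsub>C\<^esub> d)"
    using right_homD[OF counit_right_hom]
    by (intro balancedI) (simp_all add: smult_closed smult_l_distr smult_r_distr smult_assoc)
  have "counit C (slice A C f c)
      = tensor_lift A C C (add_monoid A) (\<lambda>c d. counit C (c \<triangleleft>\<^bsub>C\<^esub> f d)) (comult C c)"
    by (rule lift_apply_slice[OF f c A_comm_group LH_hom[OF counit_left_hom]])
  also have "\<dots> = tensor_lift A C C (add_monoid A) (\<lambda>c d. f (counit C c \<odot>\<^bsub>C\<^esub> d)) (comult C c)"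
    by (rule arg_cong[where f = "\<lambda>h. h _", OF CC.lift_cong])
      (use right_homD[OF counit_right_hom] f in \<open>simp add: LH_closed LH_smult\<close>)
  also have "\<dots> = f c"
    using CC.hom_lift[OF C_comm_group b A_comm_group LH_hom[OF f] comult_closed[OF c]]
      counit_left[OF c] by simp
  finally show ?thesis .
qed

text \<open>Makes \<open>id \<otimes> slice\<close> well defined; the scalar crosses the tensor sign
  because slices are left linear.\<close>

lemma balanced_id_slice:
  assumes f: "f \<in> LH"
  shows "balanced A C C CG (\<lambda>c d. pure_tensor A C C c (slice A C f d))"
  by (rule balancedI) (use CC.balanced_pure[unfolded balanced_def] left_homD[OF slice_left_hom[OF f]]
    in simp_all)

text \<open>
  \<open>\<Delta>(\<Sum> c\<^sub>1 f(c\<^sub>2)) = \<Sum> c\<^sub>1 \<otimes> c\<^sub>2 f(c\<^sub>3)\<close>: apply \<open>c \<otimes> (d \<otimes> e) \<mapsto> c \<otimes> d f(e)\<close> to both sides of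
  coassociativity.
\<close>

lemma comult_slice:
  assumes f: "f \<in> LH" and c: "c \<in> carrier C"
  shows "comult C (slice A C f c)
    = tensor_lift A C C CG (\<lambda>c d. pure_tensor A C C c (slice A C f d)) (comult C c)"
proof -
  \<comment> \<open>The slice is \<open>\<rho>\<close> composed with the comultiplication.\<close>
  define \<rho> where "\<rho> = tensor_lift A C C (add_monoid C) (\<lambda>c d. c \<triangleleft>\<^bsub>C\<^esub> f d)"
  have \<rho>: "\<rho> \<in> left_hom A CC C" unfolding \<rho>_def by (rule lift_slice_left_hom[OF f])
  note \<rho>D = left_homD[OF \<rho>, unfolded carrier_tensor]
  have \<rho>_pure: "\<rho> (pure_tensor A C C c d) = c \<triangleleft>\<^bsub>C\<^esub> f d" if "c \<in> carrier C" "d \<in> carrier C" for c d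
    unfolding \<rho>_def using that by (rule CC.lift_pure[OF C_comm_group balanced_slice[OF f]])
  let ?G3 = "tensor_group A C CC" and ?G3' = "tensor_group A CC C"
  \<comment> \<open>This is \<open>id \<otimes> \<rho>\<close>, the map to be applied to
    coassociativity.\<close>
  define \<psi> where "\<psi> = tensor_lift A C CC CG (\<lambda>c u. pure_tensor A C C c (\<rho> u))"
  have b\<psi>: "balanced A C CC CG (\<lambda>c u. pure_tensor A C C c (\<rho> u))"
    by (rule balancedI) (use CC.balanced_pure[unfolded balanced_def] \<rho>D in \<open>simp_all add: carrier_tensor\<close>)
  note \<psi>_hom = C_CC.lift_hom[OF CC.tensor_comm_group b\<psi>, folded \<psi>_def]
  note \<psi>_pure = C_CC.lift_pure[OF CC.tensor_comm_group b\<psi>, folded \<psi>_def, unfolded carrier_tensor]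
  \<comment> \<open>The inner lift of \<open>tensor_assoc\<close>, with the last leg
    \<open>e\<close> fixed.\<close>
  define \<alpha> where "\<alpha> e = tensor_lift A C C ?G3 (\<lambda>c d. pure_tensor A C CC c (pure_tensor A C C d e))" for e
  have CCp: "pure_tensor A C C c d \<in> carrier CC" if "c \<in> carrier C" "d \<in> carrier C" for c d
    using CC.pure_closed that by (simp add: carrier_tensor)
  have b\<alpha>: "balanced A C C ?G3 (\<lambda>c d. pure_tensor A C CC c (pure_tensor A C C d e))"
    if e: "e \<in> carrier C" for e
    by (rule balancedI)
      (use e CC.balanced_pure[unfolded balanced_def] C_CC.balanced_pure[unfolded balanced_def]
        in \<open>simp_all add: CCp add_tensor[symmetric] CC.smult_pure\<close>)
  have G3: "comm_group ?G3" by (rule C_CC.tensor_comm_group)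
  have G3': "comm_group ?G3'" by (rule CC_C.tensor_comm_group)
  note \<alpha>_hom = CC.lift_hom[OF G3 b\<alpha>, folded \<alpha>_def]
  note \<alpha>_pure = CC.lift_pure[OF G3 b\<alpha>, folded \<alpha>_def]
  \<comment> \<open>Well-definedness of \<open>tensor_assoc\<close>. Its first argument is an
    arbitrary tensor, so additivity in \<open>e\<close> and the shift of a scalar are compared on
    pure tensors.\<close>
  have b3: "balanced A CC C ?G3 (\<lambda>u e. \<alpha> e u)"
  proof (rule balancedI)
    fix u e assume u: "u \<in> carrier CC" and e: "e \<in> carrier C"
    note u' = u[unfolded carrier_tensor]
    show "\<alpha> e u \<in> carrier ?G3" using hom_in_carrier[OF \<alpha>_hom[OF e] u'] .
    show "\<alpha> e (u \<oplus>\<^bsub>CC\<^esub> v) = \<alpha> e u \<otimes>\<^bsub>?G3\<^esub> \<alpha> e v" if "v \<in> carrier CC" for v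
      using hom_mult[OF \<alpha>_hom[OF e] u'] that by (simp add: add_tensor carrier_tensor)
    show "\<alpha> (e \<oplus>\<^bsub>C\<^esub> e') u = \<alpha> e u \<otimes>\<^bsub>?G3\<^esub> \<alpha> e' u" if e': "e' \<in> carrier C" for e'
    proof (rule CC.hom_eqI[OF comm_group.axioms(2)[OF G3] \<alpha>_hom _ _ u'])
      show "(\<lambda>u. \<alpha> e u \<otimes>\<^bsub>?G3\<^esub> \<alpha> e' u) \<in> hom CG ?G3"
        using comm_group.hom_group_mult[OF G3 \<alpha>_hom[OF e] \<alpha>_hom[OF e']] .
      show "\<alpha> (e \<oplus>\<^bsub>C\<^esub> e') (pure_tensor A C C c d)
          = \<alpha> e (pure_tensor A C C c d) \<otimes>\<^bsub>?G3\<^esub> \<alpha> e' (pure_tensor A C C c d)"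
        if "c \<in> carrier C" "d \<in> carrier C" for c d
        using that e e' CC.balanced_pure[unfolded balanced_def] C_CC.balanced_pure[unfolded balanced_def]
        by (simp add: \<alpha>_pure CCp add_tensor[symmetric])
    qed (use e e' in simp)
    show "\<alpha> e (u \<triangleleft>\<^bsub>CC\<^esub> r) = \<alpha> (r \<odot>\<^bsub>C\<^esub> e) u" if r: "r \<in> carrier A" for r
    proof (rule CC.hom_eqI[OF comm_group.axioms(2)[OF G3] _ \<alpha>_hom _ u'])
      show "(\<lambda>u. \<alpha> e (u \<triangleleft>\<^bsub>CC\<^esub> r)) \<in> hom CG ?G3"
        using hom_compose[OF CC.rsmult_hom[OF r] \<alpha>_hom[OF e]] by (simp add: comp_def)
      show "\<alpha> e (pure_tensor A C C c d \<triangleleft>\<^bsub>CC\<^esub> r) = \<alpha> (r \<odot>\<^bsub>C\<^esub> e) (pure_tensor A C C c d)"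
        if "c \<in> carrier C" "d \<in> carrier C" for c d
        using that e r CC.balanced_pure[unfolded balanced_def]
        by (simp add: \<alpha>_pure CC.rsmult_pure rsmult_closed smult_closed)
    qed (use e r smult_closed in simp)
  qed
  have assoc: "tensor_assoc A C = tensor_lift A CC C ?G3 (\<lambda>u e. \<alpha> e u)"
    by (simp add: tensor_assoc_def Let_def \<alpha>_def)
  note assoc_hom = CC_C.lift_hom[OF G3 b3, folded assoc]
  note assoc_pure = CC_C.lift_pure[OF G3 b3, folded assoc, unfolded carrier_tensor]
  \<comment> \<open>On \<open>c \<otimes> d\<close> both sides are
    \<open>c \<otimes> d f(e)\<close>.\<close>
  have \<psi>\<alpha>: "\<psi> (\<alpha> e u) = u \<triangleleft>\<^bsub>CC\<^esub> f e" if u: "u \<in> carrier CG" and e: "e \<in> carrier C" for u e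
  proof (rule CC.hom_eqI[OF comm_group.axioms(2)[OF CC.tensor_comm_group] _ CC.rsmult_hom _ u])
    show "(\<lambda>u. \<psi> (\<alpha> e u)) \<in> hom CG CG"
      using hom_compose[OF \<alpha>_hom[OF e] \<psi>_hom] by (simp add: comp_def)
    show "\<psi> (\<alpha> e (pure_tensor A C C c d)) = pure_tensor A C C c d \<triangleleft>\<^bsub>CC\<^esub> f e"
      if "c \<in> carrier C" "d \<in> carrier C" for c d
      using that e f by (simp add: \<alpha>_pure \<psi>_pure CC.pure_closed \<rho>_pure CC.rsmult_pure LH_closed)
  qed (use e f LH_closed in simp)
  note cl = comult_closed left_homD(2)[OF comult_left_hom]
  \<comment> \<open>Moving a scalar across uses right linearity of the comultiplication here and
    left linearity in \<open>bR\<close>.\<close>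
  have bL: "balanced A C C ?G3' (\<lambda>c d. pure_tensor A CC C (comult C c) d)"
    by (rule balancedI)
      (use cl CC_C.balanced_pure[unfolded balanced_def] left_homD[OF comult_left_hom]
        right_homD[OF comult_right_hom] in simp_all)
  have bR: "balanced A C C ?G3 (\<lambda>c d. pure_tensor A C CC c (comult C d))"
    by (rule balancedI)
      (use cl C_CC.balanced_pure[unfolded balanced_def] left_homD[OF comult_left_hom] in simp_all)
  have "\<psi> (tensor_assoc A C (tensor_lift A C C ?G3' (\<lambda>c d. pure_tensor A CC C (comult C c) d) (comult C c)))
      = \<psi> (tensor_lift A C C ?G3 (\<lambda>c d. pure_tensor A C CC c (comult C d)) (comult C c))"
    by (simp only: coassoc[OF c])
  \<comment> \<open>Left side: the comultiplication of \<open>c1\<close>, times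
    \<open>f(c2)\<close>, is the comultiplication of \<open>c1 f(c2)\<close> by right
    linearity.\<close>
  moreover have "\<psi> (tensor_assoc A C (tensor_lift A C C ?G3' (\<lambda>c d. pure_tensor A CC C (comult C c) d) (comult C c)))
      = tensor_lift A C C CG (\<lambda>c d. comult C (c \<triangleleft>\<^bsub>C\<^esub> f d)) (comult C c)"
  proof -
    have h: "(\<lambda>u. \<psi> (tensor_assoc A C u)) \<in> hom ?G3' CG"
      using hom_compose[OF assoc_hom \<psi>_hom] by (simp add: comp_def)
    have "\<psi> (tensor_assoc A C (pure_tensor A CC C (comult C c) d)) = comult C (c \<triangleleft>\<^bsub>C\<^esub> f d)"
      if "c \<in> carrier C" "d \<in> carrier C" for c d
      using that cl right_homD(4)[OF comult_right_hom, of "f d" c] LH_closed[OF f]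
      by (simp add: assoc_pure \<psi>\<alpha>)
    then show ?thesis
      unfolding CC.hom_lift[OF G3' bL CC.tensor_comm_group h comult_closed[OF c]]
      by (intro arg_cong[where f = "\<lambda>h. h _", OF CC.lift_cong]) simp
  qed
  \<comment> \<open>Right side: \<open>\<rho>\<close> applied to the comultiplication of the second
    leg is a slice of that leg.\<close>
  moreover have "\<psi> (tensor_lift A C C ?G3 (\<lambda>c d. pure_tensor A C CC c (comult C d)) (comult C c))
      = tensor_lift A C C CG (\<lambda>c d. pure_tensor A C C c (slice A C f d)) (comult C c)"
    unfolding CC.hom_lift[OF G3 bR CC.tensor_comm_group \<psi>_hom comult_closed[OF c]]
    by (intro arg_cong[where f = "\<lambda>h. h _", OF CC.lift_cong])
      (use cl in \<open>simp add: \<psi>_pure \<rho>_def slice_def\<close>)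
  moreover have "comult C (slice A C f c) = tensor_lift A C C CG (\<lambda>c d. comult C (c \<triangleleft>\<^bsub>C\<^esub> f d)) (comult C c)"
    by (rule lift_apply_slice[OF f c CC.tensor_comm_group])
      (use left_homD(1)[OF comult_left_hom] in \<open>simp add: hom_tensor\<close>)
  ultimately show ?thesis by simp
qed

end

lemma (in ring) bimodule_regular: "bimodule R R (regular_bimodule R)"
proof -
  have "abelian_group (regular_bimodule R)"
    by (rule abelian_group_cong[OF abelian_group_axioms]) (simp_all add: regular_bimodule_def)
  then show ?thesis
    by (intro bimodule.intro left_module.intro right_module.intro left_module_axioms.intro
        right_module_axioms.intro bimodule_axioms.intro)
      (simp_all add: ring_axioms l_distr r_distr m_assoc)
qed

section \<open>The ring structure of the left dual\<close>

context coring
begin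

abbreviation "T \<equiv> ldual A C"

lemma carrier_ldual: "carrier T = LH \<inter> extensional (carrier C)"
  and one_ldual: "\<one>\<^bsub>T\<^esub> = restrict (counit C) (carrier C)"
  and zero_ldual: "\<zero>\<^bsub>T\<^esub> = (\<lambda>c \<in> carrier C. \<zero>\<^bsub>A\<^esub>)"
  and add_ldual: "f \<oplus>\<^bsub>T\<^esub> g = (\<lambda>c \<in> carrier C. f c \<oplus>\<^bsub>A\<^esub> g c)"
  by (simp_all add: ldual_def)

lemma ldual_LH: "f \<in> carrier T \<Longrightarrow> f \<in> LH"
  by (simp add: carrier_ldual)

lemma ldual_apply_closed: "\<lbrakk>f \<in> carrier T; c \<in> carrier C\<rbrakk> \<Longrightarrow> f c \<in> carrier A"
  by (rule LH_closed[OF ldual_LH])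

text \<open>Elements of \<open>T\<close> are \<open>undefined\<close> off the carrier, so a linear
  map enters \<open>T\<close> by restriction.\<close>

lemma restrict_ldual: "h \<in> LH \<Longrightarrow> restrict h (carrier C) \<in> carrier T"
  unfolding carrier_ldual
  by (intro IntI left_homI) (simp_all add: LH_closed LH_add LH_smult smult_closed)

lemma ldual_eqI:
  "\<lbrakk>f \<in> carrier T; g \<in> carrier T; \<And>c. c \<in> carrier C \<Longrightarrow> f c = g c\<rbrakk> \<Longrightarrow> f = g"
  by (auto simp: carrier_ldual intro: extensionalityI)

text \<open>Additivity lets \<open>g\<close> leave the Sweedler sum, so multiplication in
  \<open>T\<close> is composition with a slice.\<close>

lemma mult_ldual:
  assumes "f \<in> carrier T" "g \<in> carrier T"
  shows "f \<otimes>\<^bsub>T\<^esub> g = (\<lambda>c \<in> carrier C. g (slice A C f c))"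
proof -
  have "f \<otimes>\<^bsub>T\<^esub> g = (\<lambda>c \<in> carrier C.
      tensor_lift A C C (add_monoid A) (\<lambda>c\<^sub>1 c\<^sub>2. g (c\<^sub>1 \<triangleleft>\<^bsub>C\<^esub> f c\<^sub>2)) (comult C c))"
    by (simp add: ldual_def)
  also have "\<dots> = (\<lambda>c \<in> carrier C. g (slice A C f c))"
    by (rule restrict_ext)
      (simp add: lift_apply_slice[OF ldual_LH[OF assms(1)] _ A_comm_group LH_hom[OF ldual_LH[OF assms(2)]]])
  finally show ?thesis .
qed

lemma mult_ldual_apply:
  "\<lbrakk>f \<in> carrier T; g \<in> carrier T; c \<in> carrier C\<rbrakk> \<Longrightarrow> (f \<otimes>\<^bsub>T\<^esub> g) c = g (slice A C f c)"
  by (simp add: mult_ldual)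

lemma mult_ldual_closed: "\<lbrakk>f \<in> carrier T; g \<in> carrier T\<rbrakk> \<Longrightarrow> f \<otimes>\<^bsub>T\<^esub> g \<in> carrier T"
  unfolding mult_ldual
  using left_homD[OF slice_left_hom[OF ldual_LH]]
  by (intro restrict_ldual left_homI) (simp_all add: ldual_LH LH_closed LH_add LH_smult)

lemma slice_cong: "(\<And>c. c \<in> carrier C \<Longrightarrow> f c = g c) \<Longrightarrow> slice A C f = slice A C g"
  unfolding slice_def by (subst CC.lift_cong[where g = "\<lambda>c d. c \<triangleleft>\<^bsub>C\<^esub> g d"]) simp_all

text \<open>By \<open>comult_slice\<close>, slicing twice is the sum of
  \<open>c1 g(slice f c2)\<close>, and \<open>g(slice f c2)\<close> is the product of
  \<open>f\<close> and \<open>g\<close> evaluated at \<open>c2\<close>.\<close>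

lemma slice_mult:
  assumes f: "f \<in> carrier T" and g: "g \<in> carrier T" and c: "c \<in> carrier C"
  shows "slice A C (f \<otimes>\<^bsub>T\<^esub> g) c = slice A C g (slice A C f c)"
proof -
  note fg = ldual_LH[OF f] ldual_LH[OF g]
  note sl = slice_closed[OF fg(1)]
  have "slice A C g (slice A C f c) = tensor_lift A C C (add_monoid C) (\<lambda>c d. c \<triangleleft>\<^bsub>C\<^esub> g d)
      (tensor_lift A C C CG (\<lambda>c d. pure_tensor A C C c (slice A C f d)) (comult C c))"
    unfolding comult_slice[OF fg(1) c, symmetric] by (simp add: slice_def)
  also have "\<dots> = tensor_lift A C C (add_monoid C) (\<lambda>c d. tensor_lift A C C (add_monoid C)
      (\<lambda>c d. c \<triangleleft>\<^bsub>C\<^esub> g d) (pure_tensor A C C c (slice A C f d))) (comult C c)"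
    by (rule CC.hom_lift[OF CC.tensor_comm_group balanced_id_slice[OF fg(1)] C_comm_group
          CC.lift_hom[OF C_comm_group balanced_slice[OF fg(2)]] comult_closed[OF c]])
  also have "\<dots> = slice A C (f \<otimes>\<^bsub>T\<^esub> g) c"
    unfolding slice_def[of _ _ "f \<otimes>\<^bsub>T\<^esub> g"]
    by (rule arg_cong[where f = "\<lambda>h. h _", OF CC.lift_cong])
      (simp add: CC.lift_pure[OF C_comm_group balanced_slice[OF fg(2)]] sl mult_ldual f g)
  finally show ?thesis ..
qed

lemma slice_one: "c \<in> carrier C \<Longrightarrow> slice A C \<one>\<^bsub>T\<^esub> c = c"
  using slice_cong[of "\<one>\<^bsub>T\<^esub>" "counit C"] by (simp add: one_ldual slice_counit)

lemma one_ldual_closed: "\<one>\<^bsub>T\<^esub> \<in> carrier T"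
  unfolding one_ldual by (rule restrict_ldual[OF counit_left_hom])

lemma add_ldual_closed:
  assumes "f \<in> carrier T" "g \<in> carrier T"
  shows "f \<oplus>\<^bsub>T\<^esub> g \<in> carrier T"
  unfolding add_ldual using assms[THEN ldual_LH]
  by (intro restrict_ldual left_homI)
    (simp_all add: LH_closed LH_add LH_smult R.a_ac R.r_distr)

text \<open>The sum of the two lifts and the lift for the sum are additive maps on
  \<open>C \<otimes> C\<close> that agree on pure tensors.\<close>

lemma slice_add:
  assumes f: "f \<in> carrier T" and g: "g \<in> carrier T" and c: "c \<in> carrier C"
  shows "slice A C (f \<oplus>\<^bsub>T\<^esub> g) c = slice A C f c \<oplus>\<^bsub>C\<^esub> slice A C g c"
proof -
  note b = balanced_slice[OF ldual_LH]
  let ?l = "\<lambda>f. tensor_lift A C C (add_monoid C) (\<lambda>c d. c \<triangleleft>\<^bsub>C\<^esub> f d)"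
  have "?l f u \<oplus>\<^bsub>C\<^esub> ?l g u = ?l (f \<oplus>\<^bsub>T\<^esub> g) u" if u: "u \<in> carrier CG" for u
  proof (rule CC.lift_unique[OF C_comm_group b[OF add_ldual_closed[OF f g]] _ _ u])
    show "(\<lambda>u. ?l f u \<oplus>\<^bsub>C\<^esub> ?l g u) \<in> hom CG (add_monoid C)"
      using comm_group.hom_group_mult[OF C_comm_group CC.lift_hom[OF C_comm_group b[OF f]]
        CC.lift_hom[OF C_comm_group b[OF g]]] by simp
  qed (simp add: CC.lift_pure[OF C_comm_group b] f g add_ldual ldual_apply_closed rsmult_r_distr)
  then show ?thesis using comult_closed[OF c] by (simp add: slice_def)
qed

text \<open>Associativity is \<open>slice_mult\<close>; the left unit law is the right counit law,
  the right unit law is \<open>counit_slice\<close>. Distributivity is \<open>slice_add\<close> on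
  one side and pointwise on the other.\<close>

sublocale T: ring T
proof (rule ringI)
  show "abelian_group T"
  proof (rule abelian_groupI)
    have "(\<lambda>c. \<zero>\<^bsub>A\<^esub>) \<in> LH" by (intro left_homI) simp_all
    then show "\<zero>\<^bsub>T\<^esub> \<in> carrier T" unfolding zero_ldual by (rule restrict_ldual)
    then show "\<zero>\<^bsub>T\<^esub> \<oplus>\<^bsub>T\<^esub> f = f" if "f \<in> carrier T" for f
      using that by (intro ldual_eqI add_ldual_closed) (simp_all add: add_ldual zero_ldual ldual_apply_closed)
    fix f assume f: "f \<in> carrier T"
    have h: "(\<lambda>c. \<ominus>\<^bsub>A\<^esub> f c) \<in> LH"
      using ldual_LH[OF f]
      by (intro left_homI) (simp_all add: LH_closed LH_add LH_smult R.minus_add R.r_minus)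
    have "(\<lambda>c \<in> carrier C. \<ominus>\<^bsub>A\<^esub> f c) \<oplus>\<^bsub>T\<^esub> f = \<zero>\<^bsub>T\<^esub>"
      using ldual_apply_closed[OF f] by (auto simp: add_ldual zero_ldual R.l_neg)
    then show "\<exists>g \<in> carrier T. g \<oplus>\<^bsub>T\<^esub> f = \<zero>\<^bsub>T\<^esub>" using restrict_ldual[OF h] by blast
  next
    fix f g h assume fgh: "f \<in> carrier T" "g \<in> carrier T" "h \<in> carrier T"
    show "f \<oplus>\<^bsub>T\<^esub> g \<oplus>\<^bsub>T\<^esub> h = f \<oplus>\<^bsub>T\<^esub> (g \<oplus>\<^bsub>T\<^esub> h)"
      using fgh by (intro ldual_eqI add_ldual_closed)
        (simp_all add: add_ldual ldual_apply_closed R.a_assoc)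
  next
    fix f g assume fg: "f \<in> carrier T" "g \<in> carrier T"
    show "f \<oplus>\<^bsub>T\<^esub> g = g \<oplus>\<^bsub>T\<^esub> f"
      using fg by (intro ldual_eqI add_ldual_closed)
        (simp_all add: add_ldual ldual_apply_closed R.a_comm)
  qed (rule add_ldual_closed)
  show "Group.monoid T"
  proof (rule monoidI)
    fix f g h assume fgh: "f \<in> carrier T" "g \<in> carrier T" "h \<in> carrier T"
    show "f \<otimes>\<^bsub>T\<^esub> g \<otimes>\<^bsub>T\<^esub> h = f \<otimes>\<^bsub>T\<^esub> (g \<otimes>\<^bsub>T\<^esub> h)"
      using fgh by (intro ldual_eqI mult_ldual_closed)
        (simp_all add: mult_ldual_apply mult_ldual_closed slice_mult slice_closed ldual_LH)
  next
    fix f assume f: "f \<in> carrier T"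
    show "\<one>\<^bsub>T\<^esub> \<otimes>\<^bsub>T\<^esub> f = f"
      using f by (intro ldual_eqI mult_ldual_closed)
        (simp_all add: mult_ldual one_ldual_closed slice_one)
    show "f \<otimes>\<^bsub>T\<^esub> \<one>\<^bsub>T\<^esub> = f"
      using f by (intro ldual_eqI mult_ldual_closed)
        (simp_all add: mult_ldual one_ldual_closed, simp add: one_ldual counit_slice slice_closed ldual_LH)
  qed (rule mult_ldual_closed one_ldual_closed; assumption)+
next
  fix f g h assume fgh: "f \<in> carrier T" "g \<in> carrier T" "h \<in> carrier T"
  show "(f \<oplus>\<^bsub>T\<^esub> g) \<otimes>\<^bsub>T\<^esub> h = f \<otimes>\<^bsub>T\<^esub> h \<oplus>\<^bsub>T\<^esub> g \<otimes>\<^bsub>T\<^esub> h"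
    using fgh by (intro ldual_eqI add_ldual_closed mult_ldual_closed)
      (simp_all add: mult_ldual add_ldual_closed slice_add LH_add ldual_LH slice_closed,
       simp add: add_ldual)
  show "h \<otimes>\<^bsub>T\<^esub> (f \<oplus>\<^bsub>T\<^esub> g) = h \<otimes>\<^bsub>T\<^esub> f \<oplus>\<^bsub>T\<^esub> h \<otimes>\<^bsub>T\<^esub> g"
    using fgh by (intro ldual_eqI add_ldual_closed mult_ldual_closed)
      (simp_all add: mult_ldual add_ldual_closed, simp add: add_ldual ldual_LH slice_closed)
qed

section \<open>Scalars from \<open>A\<close> acting on the left dual\<close>

abbreviation "rs \<equiv> ldual_rsmult A C"
abbreviation "\<iota> \<equiv> ldual_unit_map A C"

lemma rs_apply: "c \<in> carrier C \<Longrightarrow> rs q a c = q c \<otimes>\<^bsub>A\<^esub> a"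
  by (simp add: ldual_rsmult_def)

lemma rs_closed: "\<lbrakk>q \<in> carrier T; a \<in> carrier A\<rbrakk> \<Longrightarrow> rs q a \<in> carrier T"
  unfolding ldual_rsmult_def
  by (intro restrict_ldual left_homI)
    (simp_all add: ldual_LH LH_closed LH_add LH_smult R.l_distr R.m_assoc)

lemma unit_map_closed: "a \<in> carrier A \<Longrightarrow> \<iota> a \<in> carrier T"
  unfolding ldual_unit_map_def by (rule rs_closed[OF one_ldual_closed])

lemma unit_map_apply: "c \<in> carrier C \<Longrightarrow> \<iota> a c = counit C c \<otimes>\<^bsub>A\<^esub> a"
  by (simp add: ldual_unit_map_def rs_apply one_ldual)

text \<open>\<open>counit_slice\<close> evaluates the product. Hence the right
  \<open>A\<close>-action induced through \<open>\<iota>\<close> is the explicit action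
  \<open>rs\<close>.\<close>

lemma mult_unit_map:
  assumes q: "q \<in> carrier T" and a: "a \<in> carrier A"
  shows "q \<otimes>\<^bsub>T\<^esub> \<iota> a = rs q a"
  using assms
  by (intro ldual_eqI T.m_closed rs_closed unit_map_closed)
    (simp_all add: mult_ldual unit_map_closed unit_map_apply slice_closed ldual_LH counit_slice rs_apply)

end

section \<open>The right module \<open>A\<close> given by a group-like element, and
  invariants\<close>

locale grouplike_coring = coring A C for A :: "'a ring" and C :: "('a, 'c, 'x) coring_scheme" +
  fixes x :: 'c
  assumes grouplike: "grouplike A C x"
begin

lemma x_closed: "x \<in> carrier C"
  and comult_x: "comult C x = pure_tensor A C C x x"
  and counit_x: "counit C x = \<one>\<^bsub>A\<^esub>"
  using grouplike by (simp_all add: grouplike_def)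

abbreviation "P \<equiv> A_module A C x"
abbreviation "act \<equiv> harpoon C x"

lemma P_simps [simp]: "carrier P = carrier A" "\<zero>\<^bsub>P\<^esub> = \<zero>\<^bsub>A\<^esub>" "a \<oplus>\<^bsub>P\<^esub> b = a \<oplus>\<^bsub>A\<^esub> b"
  "a \<odot>\<^bsub>P\<^esub> b = a \<otimes>\<^bsub>A\<^esub> b" "a \<triangleleft>\<^bsub>P\<^esub> g = act a g"
  by (simp_all add: A_module_def)

lemma xa_closed: "a \<in> carrier A \<Longrightarrow> x \<triangleleft>\<^bsub>C\<^esub> a \<in> carrier C"
  by (rule rsmult_closed[OF x_closed])

text \<open>The comultiplication of \<open>x a\<close> is the single pure tensor
  \<open>x \<otimes> x a\<close>, because \<open>x\<close> is group-like and the comultiplication is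
  right linear. This is why \<open>act\<close> is associative in
  \<open>harpoon_mult\<close>.\<close>

lemma slice_xa:
  assumes f: "f \<in> carrier T" and a: "a \<in> carrier A"
  shows "slice A C f (x \<triangleleft>\<^bsub>C\<^esub> a) = x \<triangleleft>\<^bsub>C\<^esub> f (x \<triangleleft>\<^bsub>C\<^esub> a)"
proof -
  have "comult C (x \<triangleleft>\<^bsub>C\<^esub> a) = pure_tensor A C C x (x \<triangleleft>\<^bsub>C\<^esub> a)"
    using right_homD(4)[OF comult_right_hom a x_closed]
    by (simp add: comult_x CC.rsmult_pure a x_closed)
  then show ?thesis
    by (simp add: slice_def CC.lift_pure[OF C_comm_group balanced_slice[OF ldual_LH[OF f]]]
        x_closed xa_closed a)
qed

lemma harpoon_closed: "\<lbrakk>a \<in> carrier A; g \<in> carrier T\<rbrakk> \<Longrightarrow> act a g \<in> carrier A"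
  by (simp add: harpoon_def ldual_apply_closed xa_closed)

lemma harpoon_mult:
  "\<lbrakk>a \<in> carrier A; f \<in> carrier T; g \<in> carrier T\<rbrakk> \<Longrightarrow> act a (f \<otimes>\<^bsub>T\<^esub> g) = act (act a f) g"
  by (simp add: harpoon_def mult_ldual xa_closed slice_xa)

text \<open>\<open>counit(x a) b = a b\<close> as \<open>counit(x) = 1\<close>: restricting
  \<open>act\<close> along \<open>\<iota>\<close> gives back multiplication in
  \<open>A\<close>.\<close>

lemma harpoon_unit_map:
  assumes "a \<in> carrier A" "b \<in> carrier A"
  shows "act a (\<iota> b) = a \<otimes>\<^bsub>A\<^esub> b"
  using assms right_homD(4)[OF counit_right_hom, of a x]
  by (simp add: harpoon_def unit_map_apply xa_closed counit_x x_closed)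

lemma harpoon_one: "g \<in> carrier T \<Longrightarrow> act \<one>\<^bsub>A\<^esub> g = g x"
  by (simp add: harpoon_def rsmult_one x_closed)

lemma harpoon_rs: "a \<in> carrier A \<Longrightarrow> act a (rs q b) = act a q \<otimes>\<^bsub>A\<^esub> b"
  by (simp add: harpoon_def rs_apply xa_closed)

lemma unit_map_one: "\<iota> \<one>\<^bsub>A\<^esub> = \<one>\<^bsub>T\<^esub>"
  using mult_unit_map[OF one_ldual_closed R.one_closed] unit_map_closed[OF R.one_closed]
  by (intro ldual_eqI) (simp_all add: unit_map_apply one_ldual LH_closed[OF counit_left_hom] one_ldual_closed[unfolded one_ldual])

lemma right_module_P: "right_module T P"
proof (intro right_module.intro right_module_axioms.intro)
  show "abelian_group P"
    by (rule abelian_group_cong[OF R.abelian_group_axioms]) (simp_all add: A_module_def)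
  show "a \<triangleleft>\<^bsub>P\<^esub> \<one>\<^bsub>T\<^esub> = a" if "a \<in> carrier P" for a
    using that harpoon_unit_map[of a "\<one>\<^bsub>A\<^esub>"] by (simp add: unit_map_one)
qed (simp_all add: T.ring_axioms harpoon_closed harpoon_mult,
     simp_all add: harpoon_def add_ldual xa_closed rsmult_r_distr x_closed LH_add ldual_LH)

text \<open>The scalars in \<open>invariants\<close> act through \<open>\<iota>\<close>;
  \<open>harpoon_unit_map\<close> here and \<open>mult_unit_map\<close> in the next lemma make them
  explicit.\<close>

lemma A_inv_iff: "s \<in> A_inv A C x \<longleftrightarrow> s \<in> carrier A \<and> (\<forall>g \<in> carrier T. act s g = s \<otimes>\<^bsub>A\<^esub> g x)"
  by (auto simp: A_inv_def invariants_def harpoon_unit_map ldual_apply_closed x_closed)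

lemma ldual_inv_iff:
  "q \<in> ldual_inv A C x \<longleftrightarrow> q \<in> carrier T \<and> (\<forall>g \<in> carrier T. q \<otimes>\<^bsub>T\<^esub> g = rs q (g x))"
  by (auto simp: ldual_inv_def invariants_def mult_unit_map ldual_apply_closed x_closed)

text \<open>Evaluation at \<open>x\<close> is the action on 1, and \<open>\<iota> a\<close> sends 1
  to \<open>a\<close>. So the product of \<open>\<iota> a\<close> and \<open>g\<close> is the
  functional to test invariance with.\<close>

lemma unit_map_mult_x:
  assumes "a \<in> carrier A" "g \<in> carrier T"
  shows "(\<iota> a \<otimes>\<^bsub>T\<^esub> g) x = act a g"
  using harpoon_mult[OF R.one_closed unit_map_closed[OF assms(1)] assms(2)] assms
  by (simp add: harpoon_one harpoon_unit_map unit_map_closed)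

text \<open>Write \<open>s a\<close> as \<open>act s (\<iota> a)\<close> and test the invariance of
  \<open>s\<close> against the product of \<open>\<iota> a\<close> and \<open>g\<close>.\<close>

lemma A_inv_harpoon:
  assumes s: "s \<in> A_inv A C x" and a: "a \<in> carrier A" and g: "g \<in> carrier T"
  shows "act (s \<otimes>\<^bsub>A\<^esub> a) g = s \<otimes>\<^bsub>A\<^esub> act a g"
proof -
  have sA: "s \<in> carrier A" using s by (simp add: A_inv_iff)
  have "act (s \<otimes>\<^bsub>A\<^esub> a) g = act s (\<iota> a \<otimes>\<^bsub>T\<^esub> g)"
    by (simp add: harpoon_mult sA a g unit_map_closed harpoon_unit_map)
  also have "\<dots> = s \<otimes>\<^bsub>A\<^esub> act a g"
    using s a g by (simp add: A_inv_iff unit_map_closed unit_map_mult_x)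
  finally show ?thesis .
qed

text \<open>The same test for elements of the dual. It yields both the right linearity of the first
  pairing and the first mixed associativity law.\<close>

lemma ldual_inv_rs_mult:
  assumes q: "q \<in> ldual_inv A C x" and a: "a \<in> carrier A" and g: "g \<in> carrier T"
  shows "rs q a \<otimes>\<^bsub>T\<^esub> g = rs q (act a g)"
proof -
  have qT: "q \<in> carrier T" using q by (simp add: ldual_inv_iff)
  have "rs q a \<otimes>\<^bsub>T\<^esub> g = q \<otimes>\<^bsub>T\<^esub> (\<iota> a \<otimes>\<^bsub>T\<^esub> g)"
    by (simp add: mult_unit_map[symmetric] qT a g unit_map_closed T.m_assoc)
  also have "\<dots> = rs q (act a g)"
    using q a g by (simp add: ldual_inv_iff unit_map_closed unit_map_mult_x)
  finally show ?thesis .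
qed

lemma mult_rs:
  "\<lbrakk>f \<in> carrier T; q \<in> carrier T; a \<in> carrier A\<rbrakk> \<Longrightarrow> f \<otimes>\<^bsub>T\<^esub> rs q a = rs (f \<otimes>\<^bsub>T\<^esub> q) a"
  by (simp add: mult_unit_map[symmetric] unit_map_closed T.m_assoc)

lemma rs_rs:
  "\<lbrakk>q \<in> carrier T; a \<in> carrier A; b \<in> carrier A\<rbrakk> \<Longrightarrow> rs (rs q a) b = rs q (a \<otimes>\<^bsub>A\<^esub> b)"
  by (auto simp: ldual_rsmult_def ldual_apply_closed R.m_assoc)

lemma rs_add_l:
  "\<lbrakk>q \<in> carrier T; q' \<in> carrier T; a \<in> carrier A\<rbrakk> \<Longrightarrow> rs (q \<oplus>\<^bsub>T\<^esub> q') a = rs q a \<oplus>\<^bsub>T\<^esub> rs q' a"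
  by (auto simp: ldual_rsmult_def add_ldual ldual_apply_closed R.l_distr)

lemma rs_add_r:
  "\<lbrakk>q \<in> carrier T; a \<in> carrier A; b \<in> carrier A\<rbrakk> \<Longrightarrow> rs q (a \<oplus>\<^bsub>A\<^esub> b) = rs q a \<oplus>\<^bsub>T\<^esub> rs q b"
  by (auto simp: ldual_rsmult_def add_ldual ldual_apply_closed R.r_distr)

lemma rs_one: "q \<in> carrier T \<Longrightarrow> rs q \<one>\<^bsub>A\<^esub> = q"
  using mult_unit_map[of q "\<one>\<^bsub>A\<^esub>"] by (simp add: unit_map_one)

end

section \<open>The Morita contexts of a coring\<close>

text \<open>The common input of both contexts: a subring and a subbimodule made of invariants, with
  \<open>harpoon_U\<close> sending the values of the second pairing into \<open>S\<close>.\<close>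

locale coring_morita_data = grouplike_coring +
  fixes S :: "'a set" and U :: "('b \<Rightarrow> 'a) set"
  assumes S_subring: "subring S A" and S_inv: "S \<subseteq> A_inv A C x"
    and U_inv: "U \<subseteq> ldual_inv A C x"
    and U_zero: "\<zero>\<^bsub>T\<^esub> \<in> U"
    and U_add: "\<lbrakk>q \<in> U; q' \<in> U\<rbrakk> \<Longrightarrow> q \<oplus>\<^bsub>T\<^esub> q' \<in> U"
    and U_mult: "\<lbrakk>f \<in> carrier T; q \<in> U\<rbrakk> \<Longrightarrow> f \<otimes>\<^bsub>T\<^esub> q \<in> U"
    and U_rs: "\<lbrakk>q \<in> U; s \<in> S\<rbrakk> \<Longrightarrow> rs q s \<in> U"
    and harpoon_U: "\<lbrakk>a \<in> carrier A; q \<in> U\<rbrakk> \<Longrightarrow> act a q \<in> S"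
begin

abbreviation "AS \<equiv> A\<lparr>carrier := S\<rparr>"
abbreviation "P' \<equiv> ldual_part A C U"

lemma P'_simps [simp]: "carrier P' = U" "\<zero>\<^bsub>P'\<^esub> = \<zero>\<^bsub>T\<^esub>" "q \<oplus>\<^bsub>P'\<^esub> q' = q \<oplus>\<^bsub>T\<^esub> q'"
  "f \<odot>\<^bsub>P'\<^esub> q = f \<otimes>\<^bsub>T\<^esub> q" "q \<triangleleft>\<^bsub>P'\<^esub> s = rs q s"
  by (simp_all add: ldual_part_def)

lemma S_carrier: "s \<in> S \<Longrightarrow> s \<in> carrier A"
  using S_inv by (auto simp: A_inv_iff)

lemma U_carrier: "q \<in> U \<Longrightarrow> q \<in> carrier T"
  using U_inv by (auto simp: ldual_inv_iff)

lemma S_inv': "s \<in> S \<Longrightarrow> s \<in> A_inv A C x" and U_inv': "q \<in> U \<Longrightarrow> q \<in> ldual_inv A C x"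
  using S_inv U_inv by auto

sublocale AS: ring AS
  by (rule R.subring_is_ring[OF S_subring])

text \<open>The compatibility of the two actions is \<open>A_inv_harpoon\<close>.\<close>

lemma bimodule_P: "bimodule AS T P"
proof -
  interpret P: right_module T P by (rule right_module_P)
  show ?thesis
    by (intro bimodule.intro left_module.intro left_module_axioms.intro bimodule_axioms.intro
        right_module_P AS.ring_axioms P.M.abelian_group_axioms)
      (simp_all add: S_carrier R.l_distr R.r_distr R.m_assoc A_inv_harpoon S_inv')
qed

lemma bimodule_P': "bimodule T AS P'"
proof -
  have "abelian_group P'"
  proof (rule abelian_groupI)
    fix q assume q: "q \<in> carrier P'"
    \<comment> \<open>Negatives come from the left ideal property, through multiplication by
      \<open>-1\<close>.\<close>
    then have "(\<ominus>\<^bsub>T\<^esub> \<one>\<^bsub>T\<^esub>) \<otimes>\<^bsub>T\<^esub> q \<in> U" by (intro U_mult) simp_all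
    then have "\<ominus>\<^bsub>T\<^esub> q \<in> U" using q by (simp add: T.l_minus U_carrier)
    then show "\<exists>q' \<in> carrier P'. q' \<oplus>\<^bsub>P'\<^esub> q = \<zero>\<^bsub>P'\<^esub>"
      using q by (intro bexI[of _ "\<ominus>\<^bsub>T\<^esub> q"]) (simp_all add: T.l_neg U_carrier)
  qed (simp_all add: U_zero U_add U_carrier T.a_ac)
  then show ?thesis
    by (intro bimodule.intro left_module.intro right_module.intro left_module_axioms.intro
        right_module_axioms.intro bimodule_axioms.intro AS.ring_axioms T.ring_axioms)
      (simp_all add: U_carrier S_carrier U_mult U_rs T.l_distr T.r_distr T.m_assoc
        rs_rs rs_add_l rs_add_r rs_one mult_rs)
qed

sublocale F: bimodule_pair T AS T P' P
  by (intro bimodule_pair.intro bimodule_P bimodule_P')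

sublocale G: bimodule_pair AS T AS P P'
  by (intro bimodule_pair.intro bimodule_P bimodule_P')

lemma T_comm_group: "comm_group (add_monoid T)"
  by (rule abelian_group_comm_group) (rule T.abelian_group_axioms)

lemma AS_comm_group: "comm_group (add_monoid AS)"
  by (rule abelian_group_comm_group) (rule AS.abelian_group_axioms)

lemma balanced_F: "balanced AS P' P (add_monoid T) rs"
  by (rule balancedI) (simp_all add: U_carrier S_carrier rs_closed rs_add_l rs_add_r rs_rs)

text \<open>Balancedness over \<open>T\<close> is associativity of the action,
  \<open>harpoon_mult\<close>.\<close>

lemma balanced_G: "balanced T P P' (add_monoid AS) act"
  by (rule balancedI)
    (simp_all add: U_carrier harpoon_U harpoon_mult,
     simp_all add: harpoon_def rsmult_r_distr x_closed xa_closed LH_add ldual_LH U_carrier add_ldual)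

abbreviation "X \<equiv> coring_morita A C x S U"

lemma X_simps: "mS X = AS" "mT X = T" "mP X = P" "mP' X = P'"
  "mF X = tensor_lift AS P' P (add_monoid T) rs" "mG X = tensor_lift T P P' (add_monoid AS) act"
  by (simp_all add: coring_morita_def Let_def)

lemma F_pure: "\<lbrakk>q \<in> U; a \<in> carrier A\<rbrakk> \<Longrightarrow> mF X (pure_tensor AS P' P q a) = rs q a"
  using F.lift_pure[OF T_comm_group balanced_F] by (simp add: X_simps)

lemma G_pure: "\<lbrakk>a \<in> carrier A; q \<in> U\<rbrakk> \<Longrightarrow> mG X (pure_tensor T P P' a q) = act a q"
  using G.lift_pure[OF AS_comm_group balanced_G] by (simp add: X_simps)

text \<open>Left linearity is associativity in \<open>T\<close>, right linearity is the invariance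
  of \<open>q\<close>.\<close>

lemma F_bimodule_hom: "mF X \<in> bimodule_hom T T (tensor AS P' P) (regular_bimodule T)"
proof -
  have hom: "mF X \<in> hom (tensor_group AS P' P) (add_monoid (regular_bimodule T))"
    using F.lift_hom[OF T_comm_group balanced_F] by (simp add: hom_def X_simps)
  interpret T: bimodule T T "regular_bimodule T" by (rule T.bimodule_regular)
  show ?thesis
    unfolding bimodule_hom_def
  proof (intro IntI F.left_hom_tensor[OF _ hom] F.right_hom_tensor[OF _ hom]
      T.left_module_axioms T.right_module_axioms)
    fix f q a assume f: "f \<in> carrier T" and q: "q \<in> carrier P'" and a: "a \<in> carrier P"
    show "mF X (pure_tensor AS P' P (f \<odot>\<^bsub>P'\<^esub> q) a)
        = f \<odot>\<^bsub>regular_bimodule T\<^esub> mF X (pure_tensor AS P' P q a)"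
      using f q a by (simp add: F_pure U_mult U_carrier mult_rs)
    show "mF X (pure_tensor AS P' P q (a \<triangleleft>\<^bsub>P\<^esub> f))
        = mF X (pure_tensor AS P' P q a) \<triangleleft>\<^bsub>regular_bimodule T\<^esub> f"
      using f q a by (simp add: F_pure harpoon_closed ldual_inv_rs_mult U_inv')
  qed
qed

text \<open>The sides are exchanged: left linearity is the invariance of \<open>s\<close>, right
  linearity is seen by evaluating at \<open>x a\<close>.\<close>

lemma G_bimodule_hom: "mG X \<in> bimodule_hom AS AS (tensor T P P') (regular_bimodule AS)"
proof -
  have hom: "mG X \<in> hom (tensor_group T P P') (add_monoid (regular_bimodule AS))"
    using G.lift_hom[OF AS_comm_group balanced_G] by (simp add: hom_def X_simps)
  interpret T: bimodule AS AS "regular_bimodule AS" by (rule AS.bimodule_regular)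
  show ?thesis
    unfolding bimodule_hom_def
  proof (intro IntI G.left_hom_tensor[OF _ hom] G.right_hom_tensor[OF _ hom]
      T.left_module_axioms T.right_module_axioms)
    fix s q a assume s: "s \<in> carrier AS" and q: "q \<in> carrier P'" and a: "a \<in> carrier P"
    show "mG X (pure_tensor T P P' (s \<odot>\<^bsub>P\<^esub> a) q)
        = s \<odot>\<^bsub>regular_bimodule AS\<^esub> mG X (pure_tensor T P P' a q)"
      using s q a by (simp add: G_pure S_carrier U_carrier A_inv_harpoon S_inv')
    show "mG X (pure_tensor T P P' a (q \<triangleleft>\<^bsub>P'\<^esub> s))
        = mG X (pure_tensor T P P' a q) \<triangleleft>\<^bsub>regular_bimodule AS\<^esub> s"
      using s q a by (simp add: G_pure U_rs harpoon_rs)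
  qed
qed

text \<open>The first mixed law is again the invariance of \<open>q\<close>; the second compares
  values at \<open>x a\<close>, by \<open>harpoon_rs\<close>.\<close>

lemma morita_context_X: "morita_context X"
  unfolding morita_context_def Let_def X_simps(1-4)
proof (intro conjI ballI AS.ring_axioms T.ring_axioms bimodule_P bimodule_P' F_bimodule_hom
    G_bimodule_hom)
  fix q a q' assume q: "q \<in> carrier P'" and a: "a \<in> carrier P" and q': "q' \<in> carrier P'"
  show "mF X (pure_tensor AS P' P q a) \<odot>\<^bsub>P'\<^esub> q' = q \<triangleleft>\<^bsub>P'\<^esub> mG X (pure_tensor T P P' a q')"
    using q a q' by (simp add: F_pure G_pure ldual_inv_rs_mult U_inv' U_carrier)
next
  fix a q a' assume a: "a \<in> carrier P" and q: "q \<in> carrier P'" and a': "a' \<in> carrier P"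
  show "mG X (pure_tensor T P P' a q) \<odot>\<^bsub>P\<^esub> a' = a \<triangleleft>\<^bsub>P\<^esub> mF X (pure_tensor AS P' P q a')"
    using q a a' by (simp add: F_pure G_pure harpoon_rs)
qed

end

section \<open>Invariants and coinvariants as the two instances\<close>

context grouplike_coring
begin

lemma harpoon_add_l:
  "\<lbrakk>a \<in> carrier A; b \<in> carrier A; g \<in> carrier T\<rbrakk> \<Longrightarrow> act (a \<oplus>\<^bsub>A\<^esub> b) g = act a g \<oplus>\<^bsub>A\<^esub> act b g"
  by (simp add: harpoon_def rsmult_r_distr x_closed xa_closed LH_add ldual_LH)

text \<open>Values of the action on \<open>q\<close> are invariant: acting by \<open>q\<close> and
  then by \<open>g\<close> is acting by their product, which is \<open>rs q (g x)\<close>.\<close>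

lemma inv_data: "coring_morita_data A C x (A_inv A C x) (ldual_inv A C x)"
proof (intro coring_morita_data.intro coring_morita_data_axioms.intro grouplike_coring_axioms)
  interpret P: right_module T P by (rule right_module_P)
  note cl = ldual_apply_closed[OF _ x_closed]
  have mult: "s \<otimes>\<^bsub>A\<^esub> t \<in> A_inv A C x" if "s \<in> A_inv A C x" "t \<in> A_inv A C x" for s t
    using that A_inv_harpoon[OF that(1)] by (simp add: A_inv_iff R.m_assoc cl)
  show "subring (A_inv A C x) A"
  proof (rule R.subringI)
    show "\<one>\<^bsub>A\<^esub> \<in> A_inv A C x" by (simp add: A_inv_iff harpoon_one cl)
    show "\<ominus>\<^bsub>A\<^esub> s \<in> A_inv A C x" if "s \<in> A_inv A C x" for s
    proof -
      have s: "s \<in> carrier A" using that by (simp add: A_inv_iff)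
      \<comment> \<open>Adding \<open>act s g\<close> yields \<open>act\<close> at zero, which
        equals its own double and hence vanishes.\<close>
      have "act (\<ominus>\<^bsub>A\<^esub> s) g = \<ominus>\<^bsub>A\<^esub> act s g" if "g \<in> carrier T" for g
        using harpoon_add_l[of "\<ominus>\<^bsub>A\<^esub> s" s g] harpoon_add_l[of "\<zero>\<^bsub>A\<^esub>" "\<zero>\<^bsub>A\<^esub>" g] s that
        by (metis R.add.inv_closed R.add.l_cancel_one' R.l_neg R.minus_equality R.zero_closed harpoon_closed)
      then show ?thesis using that by (simp add: A_inv_iff R.l_minus cl)
    qed
  qed (simp_all add: mult, auto simp: A_inv_iff harpoon_add_l R.l_distr cl)
  show "\<zero>\<^bsub>T\<^esub> \<in> ldual_inv A C x"
    by (auto simp: ldual_inv_iff, auto simp: ldual_rsmult_def zero_ldual cl)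
  fix q assume q: "q \<in> ldual_inv A C x"
  show "q \<oplus>\<^bsub>T\<^esub> q' \<in> ldual_inv A C x" if "q' \<in> ldual_inv A C x" for q'
    using q that by (simp add: ldual_inv_iff T.l_distr rs_add_l cl)
  show "f \<otimes>\<^bsub>T\<^esub> q \<in> ldual_inv A C x" if "f \<in> carrier T" for f
    using q that by (simp add: ldual_inv_iff T.m_assoc mult_rs cl)
  show "rs q s \<in> ldual_inv A C x" if "s \<in> A_inv A C x" for s
    using q that ldual_inv_rs_mult[OF q, of s]
    by (simp add: ldual_inv_iff A_inv_iff rs_closed rs_rs cl)
  show "act a q \<in> A_inv A C x" if "a \<in> carrier A" for a
    using q that harpoon_mult[OF that, of q, symmetric]
    by (simp add: ldual_inv_iff A_inv_iff harpoon_closed harpoon_rs)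
qed simp_all

lemma coinvariants_iff: "b \<in> coinvariants A C x \<longleftrightarrow> b \<in> carrier A \<and> x \<triangleleft>\<^bsub>C\<^esub> b = b \<odot>\<^bsub>C\<^esub> x"
  by (auto simp: coinvariants_def)

lemma Q_set_iff:
  "q \<in> Q_set A C x \<longleftrightarrow> q \<in> carrier T \<and> (\<forall>c \<in> carrier C. slice A C q c = q c \<odot>\<^bsub>C\<^esub> x)"
  by (simp add: Q_set_def slice_def)

text \<open>Right multiplication by \<open>b\<close> is additive and so moves under the Sweedler
  sum.\<close>

lemma slice_rs:
  assumes q: "q \<in> carrier T" and b: "b \<in> carrier A" and c: "c \<in> carrier C"
  shows "slice A C (rs q b) c = slice A C q c \<triangleleft>\<^bsub>C\<^esub> b"
proof -
  have "(\<lambda>c. c \<triangleleft>\<^bsub>C\<^esub> b) \<in> hom (add_monoid C) (add_monoid C)"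
    using b by (simp add: hom_def rsmult_closed rsmult_l_distr)
  from lift_apply_slice[OF ldual_LH[OF q] c C_comm_group this]
  have "slice A C q c \<triangleleft>\<^bsub>C\<^esub> b
      = tensor_lift A C C (add_monoid C) (\<lambda>c d. (c \<triangleleft>\<^bsub>C\<^esub> q d) \<triangleleft>\<^bsub>C\<^esub> b) (comult C c)" .
  also have "\<dots> = slice A C (rs q b) c"
    unfolding slice_def
    by (subst CC.lift_cong[where g = "\<lambda>c d. c \<triangleleft>\<^bsub>C\<^esub> rs q b d"])
      (simp_all add: rs_apply rsmult_assoc ldual_apply_closed q b)
  finally show ?thesis ..
qed

text \<open>Apply a functional to \<open>x b = b x\<close> and pull \<open>b\<close> out by left
  linearity.\<close>

lemma coinvariants_subset: "coinvariants A C x \<subseteq> A_inv A C x"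
  by (auto simp: coinvariants_iff A_inv_iff harpoon_def LH_smult ldual_LH x_closed)

text \<open>Applying \<open>g\<close> to the defining equation of Q computes the product:
  \<open>g(q(c) x) = q(c) g(x)\<close>.\<close>

lemma Q_set_subset: "Q_set A C x \<subseteq> ldual_inv A C x"
proof
  fix q assume q: "q \<in> Q_set A C x"
  then have qT: "q \<in> carrier T" by (simp add: Q_set_iff)
  have "q \<otimes>\<^bsub>T\<^esub> g = rs q (g x)" if g: "g \<in> carrier T" for g
    by (rule ldual_eqI) (use q qT g in \<open>simp_all add: rs_closed ldual_apply_closed x_closed
      mult_ldual_apply rs_apply Q_set_iff LH_smult ldual_LH\<close>)
  then show "q \<in> ldual_inv A C x" using qT by (simp add: ldual_inv_iff)
qed

lemma coinv_data: "coring_morita_data A C x (coinvariants A C x) (Q_set A C x)"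
proof (intro coring_morita_data.intro coring_morita_data_axioms.intro grouplike_coring_axioms
    coinvariants_subset Q_set_subset)
  note x = x_closed
  note coinv = coinvariants_iff
  show "subring (coinvariants A C x) A"
  proof (rule R.subringI)
    show "\<one>\<^bsub>A\<^esub> \<in> coinvariants A C x" by (simp add: coinv smult_one rsmult_one x)
    fix b assume b: "b \<in> coinvariants A C x"
    have n: "\<ominus>\<^bsub>A\<^esub> b \<odot>\<^bsub>C\<^esub> x = \<ominus>\<^bsub>C\<^esub> (b \<odot>\<^bsub>C\<^esub> x)"
      using b smult_l_distr[of "\<ominus>\<^bsub>A\<^esub> b" b x]
      by (intro M.minus_equality[symmetric]) (simp_all add: coinv x smult_closed R.l_neg smult_zeros)
    have z: "x \<triangleleft>\<^bsub>C\<^esub> \<zero>\<^bsub>A\<^esub> = \<zero>\<^bsub>C\<^esub>"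
      using rsmult_r_distr[OF x R.zero_closed R.zero_closed] xa_closed[OF R.zero_closed] by simp
    have "x \<triangleleft>\<^bsub>C\<^esub> \<ominus>\<^bsub>A\<^esub> b = \<ominus>\<^bsub>C\<^esub> (x \<triangleleft>\<^bsub>C\<^esub> b)"
      using b rsmult_r_distr[of x "\<ominus>\<^bsub>A\<^esub> b" b]
      by (intro M.minus_equality[symmetric]) (simp_all add: coinv x xa_closed R.l_neg z smult_closed)
    with n b show "\<ominus>\<^bsub>A\<^esub> b \<in> coinvariants A C x" by (simp add: coinv)
    show "b \<oplus>\<^bsub>A\<^esub> b' \<in> coinvariants A C x" "b \<otimes>\<^bsub>A\<^esub> b' \<in> coinvariants A C x"
      if "b' \<in> coinvariants A C x" for b'
      using b that smult_rsmult[of b x b']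
      by (simp_all add: coinv x smult_l_distr rsmult_r_distr smult_assoc rsmult_assoc)
  qed (simp add: coinv subset_iff)
  have "slice A C \<zero>\<^bsub>T\<^esub> c = \<zero>\<^bsub>C\<^esub>" if c: "c \<in> carrier C" for c
    using slice_add[OF T.zero_closed T.zero_closed c] slice_closed[OF ldual_LH[OF T.zero_closed] c]
    by simp
  then show "\<zero>\<^bsub>T\<^esub> \<in> Q_set A C x"
    by (auto simp: Q_set_iff) (simp add: zero_ldual smult_zeros x)
  fix q assume q: "q \<in> Q_set A C x"
  show "q \<oplus>\<^bsub>T\<^esub> q' \<in> Q_set A C x" if "q' \<in> Q_set A C x" for q'
    using q that by (simp add: Q_set_iff slice_add)
      (simp add: add_ldual smult_l_distr ldual_apply_closed x)
  \<comment> \<open>\<open>slice_mult\<close> turns the slice of the product into the slice of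
    \<open>q\<close> at \<open>slice A C f c\<close>, where the condition on \<open>q\<close>
    applies.\<close>
  show "f \<otimes>\<^bsub>T\<^esub> q \<in> Q_set A C x" if "f \<in> carrier T" for f
    using q that by (simp add: Q_set_iff slice_mult mult_ldual_apply slice_closed ldual_LH)
  show "rs q s \<in> Q_set A C x" if "s \<in> coinvariants A C x" for s
    using q that by (simp add: Q_set_iff coinv slice_rs rs_closed rs_apply smult_assoc smult_rsmult
        ldual_apply_closed x)
  \<comment> \<open>The slice of \<open>q\<close> at \<open>x a\<close> is computed twice:
    group-likeness gives \<open>x q(x a)\<close>, membership in Q gives
    \<open>q(x a) x\<close>.\<close>
  show "act a q \<in> coinvariants A C x" if "a \<in> carrier A" for a
    using q that slice_xa[of q a] by (simp add: Q_set_iff coinv harpoon_closed)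
      (simp add: harpoon_def xa_closed)
qed

end

section \<open>Local projectivity\<close>

text \<open>Locally, the identity of \<open>W\<close> factors through a free module; its coordinates are functionals.\<close>

lemma locally_projective_separates:
  assumes lp: "locally_projective R W" and w: "w \<in> carrier W" "w' \<in> carrier W"
    and eq: "\<And>g. g \<in> left_hom R W (regular_bimodule R) \<Longrightarrow> g w = g w'"
  shows "w = w'"
proof -
  have W: "left_module R W" using lp by (simp add: locally_projective_def)
  interpret W: left_module R W by (rule W)
  let ?F = "free_module R (carrier W)"
  let ?p = "free_lift R W (\<lambda>w. w)"
  have F: "left_module R ?F" by (rule free_module_left_module) (rule W.R.ring_axioms)
  have p: "?p \<in> left_hom R ?F W" by (rule free_lift_hom[OF W])
  have "?p ` carrier ?F = carrier W"
  proof
    show "?p ` carrier ?F \<subseteq> carrier W" using left_homD(2)[OF p] by auto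
    show "carrier W \<subseteq> ?p ` carrier ?F"
    proof
      fix w assume w: "w \<in> carrier W"
      \<comment> \<open>The basis vector at \<open>w\<close> is a preimage of
        \<open>w\<close>.\<close>
      let ?e = "\<lambda>v. if v = w then \<one>\<^bsub>R\<^esub> else \<zero>\<^bsub>R\<^esub>"
      have e: "?e \<in> carrier ?F"
        using w by (auto simp: free_module_def intro: rev_finite_subset[of "{w}"])
      have "?p ?e = (\<Oplus>\<^bsub>W\<^esub>v \<in> {w}. ?e v \<odot>\<^bsub>W\<^esub> v)"
        by (rule free_lift_eq[OF W _ e]) (use w in auto)
      also have "\<dots> = w" using w by (simp add: W.smult_one)
      finally show "w \<in> ?p ` carrier ?F" using e by (metis imageI)
    qed
  qed
  moreover have "(\<lambda>w. w) \<in> left_hom R W W" by (simp add: left_hom_def hom_def)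
  \<comment> \<open>The identity of \<open>W\<close> is lifted along \<open>?p\<close>, locally on
    the span of the two given elements. As \<open>W\<close> may have further record fields,
    \<open>locally_projective_lifts\<close> replaces the definition.\<close>
  ultimately obtain s where s: "s \<in> left_hom R W ?F"
    and ps: "\<forall>v \<in> left_span R W {w, w'}. ?p (s v) = v"
    using locally_projective_lifts[OF lp F W, unfolded lifts_locally_def, rule_format,
        OF p, of "\<lambda>w. w" "{w, w'}"] w by auto
  have coord: "f v \<in> carrier R" if "f \<in> carrier ?F" for f v
    using that by (cases "v \<in> carrier W") (auto simp: free_module_def)
  \<comment> \<open>Coordinates of the local section are functionals, so by hypothesis they agree at
    \<open>w\<close> and \<open>w'\<close>.\<close>
  have "(\<lambda>u. s u v) \<in> left_hom R W (regular_bimodule R)" for v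
    by (rule left_homI)
      (simp_all add: coord left_homD(2-4)[OF s], simp_all add: free_module_def)
  then have "s w = s w'" using eq by blast
  moreover have "w \<in> left_span R W {w, w'}" "w' \<in> left_span R W {w, w'}"
    by (auto simp: left_span_def)
  ultimately show ?thesis using ps by metis
qed

context grouplike_coring
begin

text \<open>The invariance conditions are the equations defining coinvariants and Q after applying
  every functional; separation of points removes the functionals.\<close>

lemma inv_eq_coinv:
  assumes "locally_projective A C"
  shows "A_inv A C x = coinvariants A C x" "ldual_inv A C x = Q_set A C x"
proof -
  have sep: "c = d" if "c \<in> carrier C" "d \<in> carrier C" "\<And>g. g \<in> carrier T \<Longrightarrow> g c = g d" for c d
  proof (rule locally_projective_separates[OF assms that(1,2)])
    show "g c = g d" if "g \<in> LH" for g
      using \<open>\<And>g. g \<in> carrier T \<Longrightarrow> g c = g d\<close>[OF restrict_ldual[OF that]] \<open>c \<in> carrier C\<close> \<open>d \<in> carrier C\<close>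
      by simp
  qed
  have "A_inv A C x \<subseteq> coinvariants A C x"
  proof
    fix s assume s: "s \<in> A_inv A C x"
    have "x \<triangleleft>\<^bsub>C\<^esub> s = s \<odot>\<^bsub>C\<^esub> x"
      by (rule sep) (use s in \<open>simp_all add: A_inv_iff harpoon_def xa_closed smult_closed x_closed
        LH_smult ldual_LH\<close>)
    then show "s \<in> coinvariants A C x" using s by (simp add: coinvariants_iff A_inv_iff)
  qed
  with coinvariants_subset show "A_inv A C x = coinvariants A C x" by blast
  have "ldual_inv A C x \<subseteq> Q_set A C x"
  proof
    fix q assume q: "q \<in> ldual_inv A C x"
    then have qT: "q \<in> carrier T" by (simp add: ldual_inv_iff)
    have "slice A C q c = q c \<odot>\<^bsub>C\<^esub> x" if c: "c \<in> carrier C" for c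
    proof (rule sep)
      show "g (slice A C q c) = g (q c \<odot>\<^bsub>C\<^esub> x)" if g: "g \<in> carrier T" for g
      proof -
        have "(q \<otimes>\<^bsub>T\<^esub> g) c = rs q (g x) c" using q g by (simp add: ldual_inv_iff)
        then show ?thesis
          by (simp add: mult_ldual_apply qT g c rs_apply LH_smult ldual_LH ldual_apply_closed x_closed)
      qed
    qed (simp_all add: slice_closed ldual_LH smult_closed ldual_apply_closed x_closed qT c)
    then show "q \<in> Q_set A C x" using qT by (simp add: Q_set_iff)
  qed
  with Q_set_subset show "ldual_inv A C x = Q_set A C x" by blast
qed

end

section \<open>The context derived from a right module\<close>

text \<open>One proof for the endomorphism ring, with \<open>N\<close> the module itself, and for
  the dual, with \<open>N\<close> the ring. \<open>H\<close> is given by its fields so that both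
  records fit.\<close>

lemma right_hom_abelian_group:
  assumes M: "right_module S M" and N: "right_module S N"
    and H: "carrier H = right_hom S M N \<inter> extensional (carrier M)"
      "add H = (\<lambda>f g. \<lambda>m \<in> carrier M. f m \<oplus>\<^bsub>N\<^esub> g m)" "\<zero>\<^bsub>H\<^esub> = (\<lambda>m \<in> carrier M. \<zero>\<^bsub>N\<^esub>)"
  shows "abelian_group H"
proof -
  interpret M: right_module S M by (rule M)
  interpret N: right_module S N by (rule N)
  have rh: "f \<in> right_hom S M N" if "f \<in> carrier H" for f using that by (simp add: H)
  note c = right_homD(2)[OF rh] and D = right_homD(3,4)[OF rh]
  have ext: "restrict f (carrier M) = f" if "f \<in> carrier H" for f
    using that by (simp add: H extensional_restrict)
  have I: "restrict f (carrier M) \<in> carrier H"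
    if "\<And>m. m \<in> carrier M \<Longrightarrow> f m \<in> carrier N"
      "\<And>m m'. \<lbrakk>m \<in> carrier M; m' \<in> carrier M\<rbrakk> \<Longrightarrow> f (m \<oplus>\<^bsub>M\<^esub> m') = f m \<oplus>\<^bsub>N\<^esub> f m'"
      "\<And>m s. \<lbrakk>m \<in> carrier M; s \<in> carrier S\<rbrakk> \<Longrightarrow> f (m \<triangleleft>\<^bsub>M\<^esub> s) = f m \<triangleleft>\<^bsub>N\<^esub> s" for f
    unfolding H(1) by (intro IntI right_homI) (simp_all add: that M.rsmult_closed)
  \<comment> \<open>This element equals its own double.\<close>
  have zs: "\<zero>\<^bsub>N\<^esub> \<triangleleft>\<^bsub>N\<^esub> s = \<zero>\<^bsub>N\<^esub>" if "s \<in> carrier S" for s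
    using N.rsmult_l_distr[of "\<zero>\<^bsub>N\<^esub>" "\<zero>\<^bsub>N\<^esub>" s] N.rsmult_closed[of "\<zero>\<^bsub>N\<^esub>" s] that by simp
  have ns: "(\<ominus>\<^bsub>N\<^esub> n) \<triangleleft>\<^bsub>N\<^esub> s = \<ominus>\<^bsub>N\<^esub> (n \<triangleleft>\<^bsub>N\<^esub> s)" if "n \<in> carrier N" "s \<in> carrier S" for n s
    using N.rsmult_l_distr[of "\<ominus>\<^bsub>N\<^esub> n" n s] that
    by (intro N.minus_equality[symmetric]) (simp_all add: N.rsmult_closed N.l_neg zs)
  show ?thesis
  proof (rule abelian_groupI)
    fix f g assume f: "f \<in> carrier H" and g: "g \<in> carrier H"
    show "f \<oplus>\<^bsub>H\<^esub> g \<in> carrier H"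
      unfolding H(2) by (rule I) (simp_all add: f g c D N.M.a_ac N.rsmult_l_distr)
    show "f \<oplus>\<^bsub>H\<^esub> g = g \<oplus>\<^bsub>H\<^esub> f"
      unfolding H(2) by (rule restrict_ext) (simp add: f g c N.M.a_comm)
    show "f \<oplus>\<^bsub>H\<^esub> g \<oplus>\<^bsub>H\<^esub> k = f \<oplus>\<^bsub>H\<^esub> (g \<oplus>\<^bsub>H\<^esub> k)" if "k \<in> carrier H" for k
      unfolding H(2) by (rule restrict_ext) (simp add: f g that c N.M.a_assoc)
  next
    show "\<zero>\<^bsub>H\<^esub> \<in> carrier H" unfolding H(3) by (rule I) (simp_all add: zs)
    fix f assume f: "f \<in> carrier H"
    have "\<zero>\<^bsub>H\<^esub> \<oplus>\<^bsub>H\<^esub> f = restrict f (carrier M)"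
      unfolding H(2,3) by (rule restrict_ext) (simp add: f c)
    then show "\<zero>\<^bsub>H\<^esub> \<oplus>\<^bsub>H\<^esub> f = f" by (simp add: ext[OF f])
    show "\<exists>g \<in> carrier H. g \<oplus>\<^bsub>H\<^esub> f = \<zero>\<^bsub>H\<^esub>"
    proof
      show "(\<lambda>m \<in> carrier M. \<ominus>\<^bsub>N\<^esub> f m) \<in> carrier H"
        by (rule I) (simp_all add: f c D N.M.minus_add ns)
      show "(\<lambda>m \<in> carrier M. \<ominus>\<^bsub>N\<^esub> f m) \<oplus>\<^bsub>H\<^esub> f = \<zero>\<^bsub>H\<^esub>"
        unfolding H(2,3) by (rule restrict_ext) (simp add: f c N.M.l_neg)
    qed
  qed
qed

section \<open>Endomorphisms and dual of \<open>A\<close>, identified by evaluation at 1\<close>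

context grouplike_coring
begin

abbreviation "E \<equiv> End_ring T P"
abbreviation "D \<equiv> dual_bimodule T P"
text \<open>Like \<open>P\<close>, but with endomorphisms acting from the left by
  evaluation.\<close>

abbreviation "PE \<equiv> mP (derived_morita T P)"
abbreviation "AX \<equiv> A\<lparr>carrier := A_inv A C x\<rparr>"
abbreviation "TX \<equiv> ldual_part A C (ldual_inv A C x)"

lemma derived_simps: "mS (derived_morita T P) = E" "mT (derived_morita T P) = T"
  "mP' (derived_morita T P) = D"
  "mF (derived_morita T P) = tensor_lift E D PE (add_monoid T) (\<lambda>f p. f p)"
  "mG (derived_morita T P) = tensor_lift T PE D (add_monoid E) (\<lambda>p f. \<lambda>p' \<in> carrier A. act p (f p'))"
  by (simp_all add: derived_morita_def Let_def)

lemma PE_simps [simp]: "carrier PE = carrier A" "\<zero>\<^bsub>PE\<^esub> = \<zero>\<^bsub>A\<^esub>" "a \<oplus>\<^bsub>PE\<^esub> b = a \<oplus>\<^bsub>A\<^esub> b"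
  "f \<odot>\<^bsub>PE\<^esub> a = f a" "a \<triangleleft>\<^bsub>PE\<^esub> g = act a g"
  by (simp_all add: derived_morita_def Let_def A_module_def)

lemma E_simps: "carrier E = right_hom T P P \<inter> extensional (carrier A)"
  "f \<otimes>\<^bsub>E\<^esub> g = compose (carrier A) f g" "\<one>\<^bsub>E\<^esub> = (\<lambda>a \<in> carrier A. a)"
  "f \<oplus>\<^bsub>E\<^esub> g = (\<lambda>a \<in> carrier A. f a \<oplus>\<^bsub>A\<^esub> g a)"
  by (simp_all add: End_ring_def)

lemma D_simps: "carrier D = right_hom T P (regular_bimodule T) \<inter> extensional (carrier A)"
  "f \<oplus>\<^bsub>D\<^esub> g = (\<lambda>a \<in> carrier A. f a \<oplus>\<^bsub>T\<^esub> g a)"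
  "t \<odot>\<^bsub>D\<^esub> f = (\<lambda>a \<in> carrier A. t \<otimes>\<^bsub>T\<^esub> f a)" "f \<triangleleft>\<^bsub>D\<^esub> s = compose (carrier A) f s"
  by (simp_all add: dual_bimodule_def)

lemma right_module_regular: "right_module T (regular_bimodule T)"
  using T.bimodule_regular by (simp add: bimodule_def)

lemma E_abelian_group: "abelian_group E"
  by (rule right_hom_abelian_group[OF right_module_P right_module_P]) (simp_all add: End_ring_def)

lemma D_abelian_group: "abelian_group D"
  by (rule right_hom_abelian_group[OF right_module_P right_module_regular])
    (simp_all add: dual_bimodule_def)

lemma PE_abelian_group: "abelian_group PE"
  by (rule abelian_group_cong[OF R.abelian_group_axioms])
    (simp_all add: derived_morita_def Let_def A_module_def)

lemma E_hom: "f \<in> carrier E \<Longrightarrow> f \<in> right_hom T P P"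
  by (simp add: E_simps)

lemma D_hom: "f \<in> carrier D \<Longrightarrow> f \<in> right_hom T P (regular_bimodule T)"
  by (simp add: D_simps)

lemmas E_homD = right_homD(2-4)[OF E_hom, simplified]
lemmas D_homD = right_homD(2-4)[OF D_hom, simplified]

text \<open>\<open>\<iota> a\<close> sends 1 to \<open>a\<close>, so a right linear map on
  \<open>A\<close> is determined by its value at 1.\<close>

lemma right_hom_one_acts:
  assumes "f \<in> right_hom T P N" "a \<in> carrier A"
  shows "f a = f \<one>\<^bsub>A\<^esub> \<triangleleft>\<^bsub>N\<^esub> \<iota> a"
  using right_homD(4)[OF assms(1) unit_map_closed[OF assms(2)], of "\<one>\<^bsub>A\<^esub>"] assms(2)
  by (simp add: harpoon_unit_map)

lemma E_apply:
  assumes "f \<in> carrier E" "a \<in> carrier A"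
  shows "f a = f \<one>\<^bsub>A\<^esub> \<otimes>\<^bsub>A\<^esub> a"
  by (subst right_hom_one_acts[OF E_hom]) (simp_all add: assms E_homD harpoon_unit_map)

lemma D_apply:
  assumes "f \<in> carrier D" "a \<in> carrier A"
  shows "f a = rs (f \<one>\<^bsub>A\<^esub>) a"
  by (subst right_hom_one_acts[OF D_hom]) (simp_all add: assms D_homD mult_unit_map)

text \<open>Linearity moves the action of \<open>g\<close> inside \<open>f\<close>, where it sends 1
  to \<open>g x\<close>; then \<open>E_apply\<close> takes \<open>g x\<close> out as a
  factor.\<close>

lemma E_one:
  assumes f: "f \<in> carrier E"
  shows "f \<one>\<^bsub>A\<^esub> \<in> A_inv A C x"
  unfolding A_inv_iff
proof (intro conjI ballI)
  show "f \<one>\<^bsub>A\<^esub> \<in> carrier A" by (simp add: E_homD f)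
  fix g assume g: "g \<in> carrier T"
  have "act (f \<one>\<^bsub>A\<^esub>) g = f (g x)"
    using E_homD(3)[OF f g R.one_closed] g by (simp add: harpoon_one)
  also have "\<dots> = f \<one>\<^bsub>A\<^esub> \<otimes>\<^bsub>A\<^esub> g x" by (rule E_apply[OF f ldual_apply_closed[OF g x_closed]])
  finally show "act (f \<one>\<^bsub>A\<^esub>) g = f \<one>\<^bsub>A\<^esub> \<otimes>\<^bsub>A\<^esub> g x" .
qed

text \<open>The argument of \<open>E_one\<close> with values in \<open>T\<close> and
  \<open>D_apply\<close> in place of \<open>E_apply\<close>.\<close>

lemma D_one:
  assumes f: "f \<in> carrier D"
  shows "f \<one>\<^bsub>A\<^esub> \<in> ldual_inv A C x"
  unfolding ldual_inv_iff
proof (intro conjI ballI)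
  show "f \<one>\<^bsub>A\<^esub> \<in> carrier T" by (simp add: D_homD f)
  fix g assume g: "g \<in> carrier T"
  have "f \<one>\<^bsub>A\<^esub> \<otimes>\<^bsub>T\<^esub> g = f (g x)"
    using D_homD(3)[OF f g R.one_closed] g by (simp add: harpoon_one)
  also have "\<dots> = rs (f \<one>\<^bsub>A\<^esub>) (g x)" by (rule D_apply[OF f ldual_apply_closed[OF g x_closed]])
  finally show "f \<one>\<^bsub>A\<^esub> \<otimes>\<^bsub>T\<^esub> g = rs (f \<one>\<^bsub>A\<^esub>) (g x)" .
qed

text \<open>Right linearity of left multiplication by \<open>s\<close> is
  \<open>A_inv_harpoon\<close>.\<close>

lemma A_inv_E: "s \<in> A_inv A C x \<Longrightarrow> (\<lambda>a \<in> carrier A. s \<otimes>\<^bsub>A\<^esub> a) \<in> carrier E"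
  unfolding E_simps
  by (intro IntI right_homI) (simp_all add: A_inv_iff R.r_distr harpoon_closed A_inv_harpoon[unfolded A_inv_iff])

lemma ldual_inv_D: "q \<in> ldual_inv A C x \<Longrightarrow> (\<lambda>a \<in> carrier A. rs q a) \<in> carrier D"
  unfolding D_simps
  by (intro IntI right_homI)
    (simp_all add: ldual_inv_iff rs_closed rs_add_r harpoon_closed ldual_inv_rs_mult[unfolded ldual_inv_iff])

lemma E_bij: "bij_betw (\<lambda>f. f \<one>\<^bsub>A\<^esub>) (carrier E) (A_inv A C x)"
\<comment> \<open>The inverse sends \<open>s\<close> to left multiplication by \<open>s\<close>:
  \<open>E_apply\<close> recovers \<open>f\<close> on the carrier, extensionality off it.\<close>
proof (rule bij_betw_byWitness[where f' = "\<lambda>s. \<lambda>a \<in> carrier A. s \<otimes>\<^bsub>A\<^esub> a"])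
  show "\<forall>f \<in> carrier E. (\<lambda>a \<in> carrier A. f \<one>\<^bsub>A\<^esub> \<otimes>\<^bsub>A\<^esub> a) = f"
  proof
    fix f assume f: "f \<in> carrier E"
    then have "f \<in> extensional (carrier A)" by (simp add: E_simps)
    then show "(\<lambda>a \<in> carrier A. f \<one>\<^bsub>A\<^esub> \<otimes>\<^bsub>A\<^esub> a) = f"
      by (rule extensionalityI[OF restrict_extensional]) (simp add: E_apply[OF f, symmetric])
  qed
qed (auto simp: E_one A_inv_E, simp add: A_inv_iff)

lemma D_bij: "bij_betw (\<lambda>f. f \<one>\<^bsub>A\<^esub>) (carrier D) (ldual_inv A C x)"
proof (rule bij_betw_byWitness[where f' = "\<lambda>q. \<lambda>a \<in> carrier A. rs q a"])
  show "\<forall>f \<in> carrier D. (\<lambda>a \<in> carrier A. rs (f \<one>\<^bsub>A\<^esub>) a) = f"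
  proof
    fix f assume f: "f \<in> carrier D"
    then have "f \<in> extensional (carrier A)" by (simp add: D_simps)
    then show "(\<lambda>a \<in> carrier A. rs (f \<one>\<^bsub>A\<^esub>) a) = f"
      by (rule extensionalityI[OF restrict_extensional]) (simp add: D_apply[OF f, symmetric])
  qed
qed (auto simp: D_one ldual_inv_D, simp add: ldual_inv_iff rs_one)

lemma D_smult_closed:
  assumes "t \<in> carrier T" "f \<in> carrier D"
  shows "t \<odot>\<^bsub>D\<^esub> f \<in> carrier D"
  unfolding D_simps(1,3)
  by (intro IntI right_homI)
    (simp_all add: assms D_homD[OF assms(2)] T.r_distr T.m_assoc harpoon_closed)

lemma D_rsmult_closed:
  assumes "f \<in> carrier D" "s \<in> carrier E"
  shows "f \<triangleleft>\<^bsub>D\<^esub> s \<in> carrier D"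
  unfolding D_simps(1,4) compose_def
  by (intro IntI right_homI)
    (simp_all add: assms D_homD[OF assms(1)] E_homD[OF assms(2)] harpoon_closed)

lemma G_fun_closed:
  assumes "a \<in> carrier A" "f \<in> carrier D"
  shows "(\<lambda>b \<in> carrier A. act a (f b)) \<in> carrier E"
  unfolding E_simps(1)
  by (intro IntI right_homI)
    (simp_all add: assms D_homD[OF assms(2)] harpoon_closed harpoon_mult,
     simp_all add: harpoon_def add_ldual xa_closed assms)

lemma D_PE: "tensor_pair E D PE"
  by (rule tensor_pair.intro[OF D_abelian_group D_rsmult_closed PE_abelian_group])
    (simp_all add: E_homD)

lemma PE_D: "tensor_pair T PE D"
  by (rule tensor_pair.intro[OF PE_abelian_group _ D_abelian_group D_smult_closed])
    (simp_all add: harpoon_closed)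

lemma derived_F_pure:
  assumes "f \<in> carrier D" "a \<in> carrier A"
  shows "mF (derived_morita T P) (pure_tensor E D PE f a) = f a"
proof -
  \<comment> \<open>Balancedness over \<open>E\<close> says that a composite applied to
    \<open>a\<close> is \<open>f\<close> applied to the inner value.\<close>
  have "balanced E D PE (add_monoid T) (\<lambda>f p. f p)"
    by (rule balancedI) (simp_all add: D_homD, simp_all add: D_simps compose_eq)
  then show ?thesis
    unfolding derived_simps
    using tensor_pair.lift_pure[OF D_PE abelian_group_comm_group[OF T.abelian_group_axioms]] assms
    by simp
qed

lemma derived_G_pure:
  assumes "a \<in> carrier A" "f \<in> carrier D"
  shows "mG (derived_morita T P) (pure_tensor T PE D a f) = (\<lambda>b \<in> carrier A. act a (f b))"
proof -
  have "balanced T PE D (add_monoid E) (\<lambda>p f. \<lambda>p' \<in> carrier A. act p (f p'))"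
  proof (rule balancedI)
    fix a f assume a: "a \<in> carrier PE" and f: "f \<in> carrier D"
    show "(\<lambda>b \<in> carrier A. act a (f b)) \<in> carrier (add_monoid E)"
      using G_fun_closed a f by simp
    show "(\<lambda>b \<in> carrier A. act (a \<oplus>\<^bsub>PE\<^esub> a') (f b))
        = (\<lambda>b \<in> carrier A. act a (f b)) \<otimes>\<^bsub>add_monoid E\<^esub> (\<lambda>b \<in> carrier A. act a' (f b))"
      if "a' \<in> carrier PE" for a'
      using a f that by (auto simp: E_simps harpoon_add_l D_homD)
    show "(\<lambda>b \<in> carrier A. act a ((f \<oplus>\<^bsub>D\<^esub> f') b))
        = (\<lambda>b \<in> carrier A. act a (f b)) \<otimes>\<^bsub>add_monoid E\<^esub> (\<lambda>b \<in> carrier A. act a (f' b))"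
      for f'
      using a by (auto simp: E_simps D_simps harpoon_def add_ldual xa_closed)
    show "(\<lambda>b \<in> carrier A. act (a \<triangleleft>\<^bsub>PE\<^esub> t) (f b)) = (\<lambda>b \<in> carrier A. act a ((t \<odot>\<^bsub>D\<^esub> f) b))"
      if "t \<in> carrier T" for t
      using a f that by (intro restrict_ext) (simp add: D_simps(3) harpoon_mult D_homD)
  qed
  then show ?thesis
    unfolding derived_simps
    using tensor_pair.lift_pure[OF PE_D abelian_group_comm_group[OF E_abelian_group]] assms
    by (simp add: restrict_def)
qed

text \<open>Actions and pairings match either directly by evaluation at 1, or by
  \<open>E_apply\<close> and \<open>D_apply\<close>, which express \<open>f a\<close> through the
  value of \<open>f\<close> at 1.\<close>

lemma derived_iso:
  "morita_iso (derived_morita T P) (inv_morita A C x) (\<lambda>f. f \<one>\<^bsub>A\<^esub>) (\<lambda>g. g) (\<lambda>a. a) (\<lambda>f. f \<one>\<^bsub>A\<^esub>)"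
proof -
  interpret M: coring_morita_data A C x "A_inv A C x" "ldual_inv A C x" by (rule inv_data)
  have "(\<lambda>f. f \<one>\<^bsub>A\<^esub>) \<in> ring_iso E AX"
    unfolding ring_iso_def mem_Collect_eq
  proof
    show "(\<lambda>f. f \<one>\<^bsub>A\<^esub>) \<in> ring_hom E AX"
    proof (rule ring_hom_memI)
      fix f g assume f: "f \<in> carrier E" and g: "g \<in> carrier E"
      show "(f \<otimes>\<^bsub>E\<^esub> g) \<one>\<^bsub>A\<^esub> = f \<one>\<^bsub>A\<^esub> \<otimes>\<^bsub>AX\<^esub> g \<one>\<^bsub>A\<^esub>"
        \<comment> \<open>The composite at 1 is \<open>f\<close> at the value of \<open>g\<close> at
          1, which \<open>E_apply\<close> turns into a product.\<close>
        using f g by (simp add: E_simps(2) compose_eq E_homD E_apply[OF f, of "g \<one>\<^bsub>A\<^esub>"])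
      show "(f \<oplus>\<^bsub>E\<^esub> g) \<one>\<^bsub>A\<^esub> = f \<one>\<^bsub>A\<^esub> \<oplus>\<^bsub>AX\<^esub> g \<one>\<^bsub>A\<^esub>" by (simp add: E_simps)
    qed (simp_all add: E_one, simp add: E_simps)
    show "bij_betw (\<lambda>f. f \<one>\<^bsub>A\<^esub>) (carrier E) (carrier AX)" using E_bij by simp
  qed
  moreover have "(\<lambda>f. f \<one>\<^bsub>A\<^esub>) \<in> iso (add_monoid D) (add_monoid TX)"
    unfolding iso_def using D_bij by (auto simp: hom_def D_one D_simps(2))
  moreover have "(\<lambda>g. g) \<in> ring_iso T T"
    by (simp add: ring_iso_def ring_hom_def bij_betw_def inj_on_def)
  moreover have "(\<lambda>a. a) \<in> iso (add_monoid PE) (add_monoid P)"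
    by (simp add: iso_def hom_def bij_betw_def inj_on_def)
  ultimately show ?thesis
    unfolding morita_iso_def inv_morita_def M.X_simps(1-4) derived_simps(1-3)
    by (auto simp: derived_F_pure derived_G_pure M.F_pure M.G_pure E_one D_one
        E_homD D_homD D_simps(3,4) compose_eq E_apply[symmetric] D_apply[symmetric])
qed

end

theorem theorem1p3:
  fixes A :: "'a ring" and C :: "('a, 'c) coring" and x :: 'c
  assumes "coring A C" and "grouplike A C x"
  shows "(let X = inv_morita A C x in
      morita_context X \<and>
      (\<forall>q \<in> ldual_inv A C x. \<forall>a \<in> carrier A.
        mF X (pure_tensor (mS X) (mP' X) (mP X) q a) = ldual_rsmult A C q a) \<and>
      (\<forall>a \<in> carrier A. \<forall>q \<in> ldual_inv A C x.
        mG X (pure_tensor (mT X) (mP X) (mP' X) a q) = harpoon C x a q) \<and>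
      morita_iso (derived_morita (ldual A C) (A_module A C x)) X
        (\<lambda>f. f \<one>\<^bsub>A\<^esub>) (\<lambda>g. g) (\<lambda>a. a) (\<lambda>f. f \<one>\<^bsub>A\<^esub>)) \<and>
    (let Y = coinv_morita A C x in
      morita_context Y \<and>
      (\<forall>q \<in> Q_set A C x. \<forall>a \<in> carrier A.
        mF Y (pure_tensor (mS Y) (mP' Y) (mP Y) q a) = ldual_rsmult A C q a) \<and>
      (\<forall>a \<in> carrier A. \<forall>q \<in> Q_set A C x.
        mG Y (pure_tensor (mT Y) (mP Y) (mP' Y) a q) = harpoon C x a q)) \<and>
    (locally_projective A C \<longrightarrow> inv_morita A C x = coinv_morita A C x)"
proof -
  interpret grouplike_coring A C x
    using assms by (simp add: grouplike_coring_def grouplike_coring_axioms_def)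
  interpret I: coring_morita_data A C x "A_inv A C x" "ldual_inv A C x" by (rule inv_data)
  interpret J: coring_morita_data A C x "coinvariants A C x" "Q_set A C x" by (rule coinv_data)
  show ?thesis
    unfolding Let_def
  proof (intro conjI impI derived_iso)
    \<comment> \<open>Both are \<open>coring_morita\<close>, now on the same two sets, so the
      records are equal.\<close>
    show "inv_morita A C x = coinv_morita A C x" if "locally_projective A C"
      by (simp add: inv_morita_def coinv_morita_def inv_eq_coinv[OF that])
  qed (use I.morita_context_X J.morita_context_X I.F_pure I.G_pure J.F_pure J.G_pure in
    \<open>simp_all add: inv_morita_def coinv_morita_def I.X_simps(1-4) J.X_simps(1-4)\<close>)
qed

end
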